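(* Consider the sequence of linear models $\mathbf y=\mathbf X\boldsymbol\beta+\boldsymbol\epsilon$ and test designs $\widetilde{\mathbf X}$ described in the context, let $\hat{\boldsymbol\beta}_\lambda=(\mathbf X^\top\mathbf X+\lambda\mathbf I)^{-1}\mathbf X^\top\mathbf y$ be the ridge estimator, and let $R_{\mathbf X,\mathbf y}(\hat{\boldsymbol\beta}_\lambda,\boldsymbol\beta)$ be its conditional out-of-sample risk. Fix $0<\lambda_1<\lambda_2<\infty$ and define $$\mathsf R_{\mathbf D}(r^2,\sigma^2)=\mathsf R_{\mathbf D}(r^2,\sigma^2;\lambda)=r^2\left(\frac{\lambda^2}{\gamma}v'_{\mathbf D}(-\lambda)+\frac{\gamma-1}{\gamma}\right)+\sigma^2\left(v_{\mathbf D}(-\lambda)-\lambda v'_{\mathbf D}(-\lambda)\right).$$ Then, as $n\to\infty$, $$\sup_{\lambda\in[\lambda_1,\lambda_2]}\left|R_{\mathbf X,\mathbf y}(\hat{\boldsymbol\beta}_\lambda,\boldsymbol\beta)-\mathsf R_{\mathbf D}(r^2,\sigma^2)\right|\xrightarrow{a.s.}0,$$ where $r^2=\|\boldsymbol\beta\|^2/n$ and $\sigma^2=\mathbb E[\epsilon_i^2]$.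
   Context: Right-rotationally invariant design: a random matrix $\mathbf X\in\mathbb R^{n\times p}$ with $\mathbf X\mathbf O_0\stackrel d=\mathbf X$ for every $p\times p$ orthogonal matrix $\mathbf O_0$; equivalently, it has a singular value decomposition $\mathbf X=\mathbf Q^\top\mathbf D\mathbf O$ ($\mathbf Q$ an $n\times n$ orthogonal matrix, $\mathbf D\in\mathbb R^{n\times p}$ diagonal with the singular values on the diagonal, $\mathbf O$ a $p\times p$ orthogonal matrix) with $\mathbf O$ Haar distributed on the orthogonal group and independent of $(\mathbf Q,\mathbf D)$. Setting (all objects are indexed by $n$; the index is suppressed): - $\mathbf X=\mathbf Q^\top\mathbf D\mathbf O\in\mathbb R^{n\times p}$ is right-rotationally invariant, $p=p(n)$, $n\to\infty$, $p(n)/n\to\gamma\in(0,\infty)$. - There is a constant $C$ such that almost surely the limsup as $n\to\infty$ of the largest diagonal entry (largest singular value) of $\mathbf D$ is $<C$. - $\mathbf y=\mathbf X\boldsymbol\beta+\boldsymbol\epsilon$, with $\boldsymbol\beta\in\mathbb R^p$, $\|\boldsymbol\beta\|=r\sqrt n$ for a constant $r\ge 0$, and $\boldsymbol\beta$ either fixed or random and independent of $(\mathbf X,\boldsymbol\epsilon)$. - $\boldsymbol\epsilon\in\mathbb R^n$ is independent of $\mathbf X$ and has independent entries with $\mathbb E[\epsilon_i]=0$, $\mathbb E[\epsilon_i^2]=\sigma^2$, and $\mathbb E[|\epsilon_i|^{4+\eta}]<\infty$ for some $\eta>0$. - The test design $\widetilde{\mathbf X}=\widetilde{\mathbf Q}^\top\widetilde{\mathbf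 D}\widetilde{\mathbf O}\in\mathbb R^{n'\times p}$ is drawn independently of the training data and of $\boldsymbol\beta$ from a possibly different right-rotationally invariant ensemble, normalized so that $\frac{n\,\mathbb E[\mathrm{Tr}(\widetilde{\mathbf D}^\top\widetilde{\mathbf D})]}{n'p}=1$. Risk: $R_{\mathbf X,\mathbf y}(\hat{\boldsymbol\beta},\boldsymbol\beta)=\frac1{n'}\mathbb E\left[\|\widetilde{\mathbf X}\hat{\boldsymbol\beta}-\widetilde{\mathbf X}\boldsymbol\beta\|^2\mid\mathbf X,\mathbf y\right]$, where the expectation is over $\widetilde{\mathbf X}$ only, with $\boldsymbol\beta$ and the training data held fixed. Notation: with $D_{ii}:=0$ for $i>\min(n,p)$, $v_{\mathbf D}(z)=\frac1n\sum_{i=1}^n\frac{1}{D_{ii}^2-z}$, and $v'_{\mathbf D}$ is its derivative in $z$, so $v'_{\mathbf D}(-\lambda)=\frac1n\sum_{i=1}^n\frac1{(D_{ii}^2+\lambda)^2}$.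
   Formalization: The moment condition E|ε_i|^{4+η} < ∞ is taken uniformly: one η and one constant K bound it for all i and n; with only entrywise finiteness the claim fails (e.g. ε_i = ±σn^{3/2} with total probability n^{-3}, else 0). *)

theory Defs
  imports "HOL-Probability.Probability" "Jordan_Normal_Form.Gauss_Jordan_Elimination"
begin

text \<open>
  Matrices and vectors have dimensions that vary with the sample size, so they are the
  carrier-based ones of Jordan_Normal_Form. That library provides no measurable structure; it is
  the usual Borel structure of the \<open>n \<times> p\<close> (resp. \<open>n\<close>) real entries.
\<close>

unbundle no vec_syntax
unbundle no inner_syntax

definition borel_mat :: "nat \<Rightarrow> nat \<Rightarrow> real mat measure" where
  "borel_mat n p = vimage_algebra (carrier_mat n p)
     (\<lambda>A. \<lambda>ij\<in>{..<n} \<times> {..<p}. A $$ ij) (PiM ({..<n} \<times> {..<p}) (\<lambda>_. borel))"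

definition borel_vec :: "nat \<Rightarrow> real vec measure" where
  "borel_vec n = vimage_algebra (carrier_vec n)
     (\<lambda>v. \<lambda>i\<in>{..<n}. v $ i) (PiM {..<n} (\<lambda>_. borel))"

text \<open>
  Independence of two random elements with possibly different value types (the library's
  \<open>indep_var\<close> needs equal types).
\<close>

definition indep_rv ::
  "'w measure \<Rightarrow> 'a measure \<Rightarrow> ('w \<Rightarrow> 'a) \<Rightarrow> 'b measure \<Rightarrow> ('w \<Rightarrow> 'b) \<Rightarrow> bool" where
  "indep_rv M S U T V \<longleftrightarrow> U \<in> measurable M S \<and> V \<in> measurable M T \<and>
     prob_space.indep_set M {U -` A \<inter> space M | A. A \<in> sets S} {V -` B \<inter> space M | B. B \<in> sets T}"

text \<open>
  Orthogonality in the usual sense; the library's \<open>orthogonal_mat\<close> does not normalize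
  the columns.
\<close>

definition is_orthogonal :: "nat \<Rightarrow> real mat \<Rightarrow> bool" where
  "is_orthogonal n A \<longleftrightarrow> A \<in> carrier_mat n n \<and> transpose_mat A * A = 1\<^sub>m n"

definition right_rot_invariant :: "'w measure \<Rightarrow> nat \<Rightarrow> nat \<Rightarrow> ('w \<Rightarrow> real mat) \<Rightarrow> bool" where
  "right_rot_invariant M n p X \<longleftrightarrow> X \<in> measurable M (borel_mat n p) \<and>
     (\<forall>O\<^sub>0. is_orthogonal p O\<^sub>0 \<longrightarrow>
        distr M (borel_mat n p) (\<lambda>\<omega>. X \<omega> * O\<^sub>0) = distr M (borel_mat n p) X)"

text \<open>
  The decomposition \<open>X = Q\<^sup>T D V\<close>, with no order imposed on the singular values.
\<close>

definition is_svd :: "nat \<Rightarrow> nat \<Rightarrow> real mat \<Rightarrow> real mat \<Rightarrow> real mat \<Rightarrow> real mat \<Rightarrow> bool" where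
  "is_svd n p X Q D V \<longleftrightarrow>
     is_orthogonal n Q \<and> is_orthogonal p V \<and>
     D \<in> carrier_mat n p \<and> diagonal_mat D \<and> (\<forall>i<min n p. D $$ (i, i) \<ge> 0) \<and>
     X = transpose_mat Q * D * V"

definition max_diag :: "real mat \<Rightarrow> real" where
  "max_diag D = Max ((\<lambda>i. D $$ (i, i)) ` {..<min (dim_row D) (dim_col D)})"

definition mat_trace :: "real mat \<Rightarrow> real" where
  "mat_trace A = (\<Sum>i<dim_row A. A $$ (i, i))"

definition l2norm :: "real vec \<Rightarrow> real" where
  "l2norm v = sqrt (v \<bullet> v)"

text \<open>For \<open>l > 0\<close> the matrix is positive definite, so the inverse is never \<open>None\<close>.\<close>

definition ridge :: "real mat \<Rightarrow> real vec \<Rightarrow> real \<Rightarrow> real vec" where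
  "ridge X y l =
     the (mat_inverse (transpose_mat X * X + l \<cdot>\<^sub>m 1\<^sub>m (dim_col X))) *\<^sub>v (transpose_mat X *\<^sub>v y)"

text \<open>
  The expectation is over the test design \<open>X'\<close> only: the estimate \<open>b\<close> and the
  signal \<open>\<beta>\<close> are plain vectors here.
\<close>

definition risk :: "'w measure \<Rightarrow> nat \<Rightarrow> ('w \<Rightarrow> real mat) \<Rightarrow> real vec \<Rightarrow> real vec \<Rightarrow> real" where
  "risk M n' X' b \<beta> =
     1 / real n' * (\<integral>\<omega>. (l2norm (X' \<omega> *\<^sub>v b - X' \<omega> *\<^sub>v \<beta>))\<^sup>2 \<partial>M)"

definition diag_ext :: "real mat \<Rightarrow> nat \<Rightarrow> real" where
  "diag_ext D i = (if i < min (dim_row D) (dim_col D) then D $$ (i, i) else 0)"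

text \<open>
  The average runs over all \<open>n = dim_row D\<close> rows: for \<open>n > p\<close> the missing diagonal entries count as 0.
\<close>

definition v_st :: "real mat \<Rightarrow> real \<Rightarrow> real" where
  "v_st D z = 1 / real (dim_row D) * (\<Sum>i<dim_row D. 1 / ((diag_ext D i)\<^sup>2 - z))"

definition asym_risk :: "real \<Rightarrow> real mat \<Rightarrow> real \<Rightarrow> real \<Rightarrow> real \<Rightarrow> real" where
  "asym_risk \<gamma> D r2 s2 l =
     r2 * (l\<^sup>2 / \<gamma> * deriv (v_st D) (- l) + (\<gamma> - 1) / \<gamma>)
     + s2 * (v_st D (- l) - l * deriv (v_st D) (- l))"

end

theory Submission
  imports Defs "Jordan_Normal_Form.Determinant"
begin

text \<open>
  The test design enters the risk only through the second moment of \<open>X' c\<close> for a fixed vector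
  \<open>c\<close>. Right-rotational invariance makes this second moment a multiple of \<open>|c|\<^sup>2\<close>, and the
  normalization fixes the multiple, so the risk is exactly \<open>|b - \<beta>|\<^sup>2 / n\<close> (\<open>test_risk_eq\<close>).
  Write \<open>G\<close> for the inverse of \<open>X\<^sup>T X + l I\<close>. The estimation error is
  \<open>G X\<^sup>T \<epsilon> - l G \<beta>\<close>, and its squared norm splits into a bias term \<open>|l G \<beta>|\<^sup>2\<close>, a variance
  term \<open>|G X\<^sup>T \<epsilon>|\<^sup>2\<close> and a cross term. The operators \<open>l G\<close> and \<open>G X\<^sup>T\<close> have norms at most
  \<open>1\<close> and \<open>1 / (2 sqrt l)\<close> (\<open>smult_resolvent_bound\<close>, \<open>resolvent_transpose_bound\<close>), so each term
  can be treated with the design frozen.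

  Nothing relates the probability laws for different \<open>n\<close>, hence almost sure convergence has to come
  from bounds whose sum over \<open>n\<close> is finite. Variances are of order \<open>1/n\<close> and do not suffice. For the
  cross term, which is linear in the noise, and for the off-diagonal part of a quadratic form, fourth
  moments are of order \<open>1/n\<^sup>2\<close> after normalization; this is hypercontractivity, obtained by adding
  the variables one at a time (\<open>fourth_moment_step\<close>). The diagonal part of
  \<open>|G X\<^sup>T \<epsilon>|\<^sup>2\<close> is a weighted sum of the variables \<open>\<epsilon>\<^sub>i\<^sup>2 - \<sigma>\<^sup>2\<close>, which have slightly more than
  two moments; it is controlled by its moment of that order (\<open>sum_powr_moment\<close>), and this is where
  more than four moments of the noise enter.

  The bias term needs no integration over the orthogonal group. Any two vectors of equal norm are
  related by an orthogonal matrix, so by invariance of the design the moments of the deviation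
  \<open>|l G v|\<^sup>2 - |v|\<^sup>2 tr ((l G)\<^sup>T (l G)) / p\<close> are the same for all \<open>v\<close> of a given norm. They may
  therefore be averaged over vectors with independent random signs as entries. For those the diagonal
  part of the quadratic form is exactly the trace term, and the off-diagonal part is again covered
  by fourth moments (\<open>quad_dev_fourth_moment\<close>).

  The two traces that remain are functions of the singular values alone (\<open>frob2_svd_resolvent\<close>), and
  they produce the limiting risk (\<open>risk_pointwise\<close>). Finally the squared error divided by \<open>n\<close> and
  the limiting risk are both Lipschitz in \<open>l\<close> on \<open>[l\<^sub>1, \<infinity>)\<close>, with constants that almost surely
  stay bounded in \<open>n\<close>, so convergence at countably many grid points gives uniform convergence
  (\<open>risk_uniform\<close>).
\<close>

section \<open>Almost sure convergence and independence\<close>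

text \<open>
  The random series of the \<open>Z n\<close> has finite expectation, so it converges almost surely and its terms
  tend to zero. Nothing is asked of the joint law of the \<open>Z n\<close>, as befits a triangular array.
\<close>

lemma AE_tendsto_zero_of_summable_nn_integral:
  fixes Z :: "nat \<Rightarrow> 'a \<Rightarrow> real"
  assumes meas: "\<And>n. n \<ge> 1 \<Longrightarrow> Z n \<in> borel_measurable M"
    and nonneg: "\<And>n x. 0 \<le> Z n x" "\<And>n. 0 \<le> c n"
    and bound: "\<And>n. n \<ge> 1 \<Longrightarrow> (\<integral>\<^sup>+x. ennreal (Z n x) \<partial>M) \<le> ennreal (c n)"
    and sm: "summable c"
  shows "AE x in M. (\<lambda>n. Z n x) \<longlonglongrightarrow> 0"
proof -
  have [measurable]: "Z (Suc n) \<in> borel_measurable M" for n by (rule meas) simp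
  have sm': "summable (\<lambda>n. c (Suc n))" using sm by (simp add: summable_Suc_iff)
  have "(\<integral>\<^sup>+x. (\<Sum>n. ennreal (Z (Suc n) x)) \<partial>M) = (\<Sum>n. \<integral>\<^sup>+x. ennreal (Z (Suc n) x) \<partial>M)"
    by (rule nn_integral_suminf) simp
  also have "\<dots> \<le> (\<Sum>n. ennreal (c (Suc n)))"
    by (intro suminf_le bound) auto
  also have "\<dots> = ennreal (\<Sum>n. c (Suc n))"
    by (rule suminf_ennreal2[OF _ sm']) (use nonneg in auto)
  also have "\<dots> < \<infinity>" by simp
  finally have "AE x in M. (\<Sum>n. ennreal (Z (Suc n) x)) \<noteq> \<infinity>"
    by (intro nn_integral_noteq_infinite) auto
  then show ?thesis
  proof eventually_elim
    case (elim x)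
    have "summable (\<lambda>n. Z (Suc n) x)"
      by (rule summable_suminf_not_top[OF nonneg(1)]) (fact elim[unfolded infinity_ennreal_def])
    then show ?case by (rule LIMSEQ_imp_Suc[OF summable_LIMSEQ_zero])
  qed
qed

text \<open>
  The second argument is replaced by an independent copy. In the inner integral the first argument
  is a constant, so estimates for deterministic data can be integrated afterwards.
\<close>

lemma (in prob_space) nn_integral_indep_product:
  assumes [measurable]: "U \<in> measurable M S" "V \<in> measurable M T"
    and joint: "distr M S U \<Otimes>\<^sub>M distr M T V = distr M (S \<Otimes>\<^sub>M T) (\<lambda>\<omega>. (U \<omega>, V \<omega>))"
    and [measurable]: "F \<in> borel_measurable (S \<Otimes>\<^sub>M T)"
  shows "(\<integral>\<^sup>+\<omega>. F (U \<omega>, V \<omega>) \<partial>M) = (\<integral>\<^sup>+\<omega>. (\<integral>\<^sup>+\<omega>'. F (U \<omega>, V \<omega>') \<partial>M) \<partial>M)"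
proof -
  interpret V: prob_space "distr M T V" by (rule prob_space_distr) measurable
  have "(\<integral>\<^sup>+\<omega>. F (U \<omega>, V \<omega>) \<partial>M) = (\<integral>\<^sup>+z. F z \<partial>distr M (S \<Otimes>\<^sub>M T) (\<lambda>\<omega>. (U \<omega>, V \<omega>)))"
    by (subst nn_integral_distr) auto
  also have "\<dots> = (\<integral>\<^sup>+u. (\<integral>\<^sup>+v. F (u, v) \<partial>distr M T V) \<partial>distr M S U)"
    unfolding joint[symmetric] by (rule V.nn_integral_fst[symmetric]) measurable
  also have "\<dots> = (\<integral>\<^sup>+\<omega>. (\<integral>\<^sup>+v. F (U \<omega>, v) \<partial>distr M T V) \<partial>M)"
    by (rule nn_integral_distr) measurable
  also have "\<dots> = (\<integral>\<^sup>+\<omega>. (\<integral>\<^sup>+\<omega>'. F (U \<omega>, V \<omega>') \<partial>M) \<partial>M)"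
    by (intro nn_integral_cong nn_integral_distr) measurable
  finally show ?thesis .
qed

lemma (in prob_space) nn_integral_indep_rv:
  assumes ind: "indep_rv M S U T V"
    and F: "F \<in> borel_measurable (S \<Otimes>\<^sub>M T)"
  shows "(\<integral>\<^sup>+\<omega>. F (U \<omega>, V \<omega>) \<partial>M) = (\<integral>\<^sup>+\<omega>. (\<integral>\<^sup>+\<omega>'. F (U \<omega>, V \<omega>') \<partial>M) \<partial>M)"
proof -
  have [measurable]: "U \<in> measurable M S" "V \<in> measurable M T"
    and iset: "indep_set {U -` A \<inter> space M | A. A \<in> sets S} {V -` B \<inter> space M | B. B \<in> sets T}"
    using ind by (auto simp: indep_rv_def)
  interpret U: prob_space "distr M S U" by (rule prob_space_distr) measurable
  interpret V: prob_space "distr M T V" by (rule prob_space_distr) measurable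
  have "distr M S U \<Otimes>\<^sub>M distr M T V = distr M (S \<Otimes>\<^sub>M T) (\<lambda>\<omega>. (U \<omega>, V \<omega>))"
  proof (rule pair_measure_eqI)
    show "sigma_finite_measure (distr M S U)" "sigma_finite_measure (distr M T V)" ..
    fix A B assume A: "A \<in> sets (distr M S U)" and B: "B \<in> sets (distr M T V)"
    then have [measurable]: "A \<in> sets S" "B \<in> sets T" by auto
    have "emeasure (distr M (S \<Otimes>\<^sub>M T) (\<lambda>\<omega>. (U \<omega>, V \<omega>))) (A \<times> B)
        = emeasure M ((U -` A \<inter> space M) \<inter> (V -` B \<inter> space M))"
      by (subst emeasure_distr) (auto intro!: arg_cong[of _ _ "emeasure M"])
    also have "\<dots> = emeasure M (U -` A \<inter> space M) * emeasure M (V -` B \<inter> space M)"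
    proof -
      have "prob ((U -` A \<inter> space M) \<inter> (V -` B \<inter> space M))
          = prob (U -` A \<inter> space M) * prob (V -` B \<inter> space M)"
        by (rule indep_setD[OF iset]) (use A B in auto)
      then show ?thesis by (simp add: emeasure_eq_measure ennreal_mult)
    qed
    finally show "emeasure (distr M S U) A * emeasure (distr M T V) B
        = emeasure (distr M (S \<Otimes>\<^sub>M T) (\<lambda>\<omega>. (U \<omega>, V \<omega>))) (A \<times> B)"
      by (simp add: emeasure_distr)
  qed simp
  then show ?thesis by (intro nn_integral_indep_product[OF _ _ _ F]) auto
qed

lemma (in prob_space) indep_rv_commute:
  assumes "indep_rv M S U T V" shows "indep_rv M T V S U"
proof -
  have ind: "indep_set {U -` A \<inter> space M | A. A \<in> sets S} {V -` B \<inter> space M | B. B \<in> sets T}"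
    using assms by (simp add: indep_rv_def)
  have "indep_set {V -` B \<inter> space M | B. B \<in> sets T} {U -` A \<inter> space M | A. A \<in> sets S}"
  proof (rule indep_setI[OF indep_setD_ev2[OF ind] indep_setD_ev1[OF ind]])
    fix a b assume "a \<in> {V -` B \<inter> space M | B. B \<in> sets T}" "b \<in> {U -` A \<inter> space M | A. A \<in> sets S}"
    from indep_setD[OF ind this(2,1)] show "prob (a \<inter> b) = prob a * prob b"
      by (simp only: Int_commute[of a b] mult.commute[of "prob a"])
  qed
  then show ?thesis using assms by (simp add: indep_rv_def)
qed

text \<open>
  The instance for a sequence: its last variable against all the earlier ones. This drives the
  inductions on the number of variables below.
\<close>

lemma (in prob_space) nn_integral_indep_vars_last:
  fixes X :: "nat \<Rightarrow> 'a \<Rightarrow> real"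
  assumes ind: "indep_vars (\<lambda>_. borel) X {..<n}" and k: "k < n"
    and F[measurable]: "F \<in> borel_measurable (PiM {..<k} (\<lambda>_. borel) \<Otimes>\<^sub>M borel)"
  shows "(\<integral>\<^sup>+\<omega>. F (\<lambda>i\<in>{..<k}. X i \<omega>, X k \<omega>) \<partial>M)
       = (\<integral>\<^sup>+\<omega>. (\<integral>\<^sup>+\<omega>'. F (\<lambda>i\<in>{..<k}. X i \<omega>, X k \<omega>') \<partial>M) \<partial>M)"
proof -
  have *: "indep_var (PiM {..<k} (\<lambda>_. borel)) (\<lambda>\<omega>. \<lambda>i\<in>{..<k}. X i \<omega>)
     (PiM {k} (\<lambda>_. borel)) (\<lambda>\<omega>. \<lambda>i\<in>{k}. X i \<omega>)"
    using k by (intro indep_var_restrict[OF ind]) auto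
  define F' where "F' = (\<lambda>z. F (fst z, snd z k))"
  have [measurable]: "F' \<in> borel_measurable (PiM {..<k} (\<lambda>_. borel) \<Otimes>\<^sub>M PiM {k} (\<lambda>_. borel))"
    unfolding F'_def by measurable
  note ind' = *[unfolded indep_var_distribution_eq]
  have "(\<integral>\<^sup>+\<omega>. F' (\<lambda>i\<in>{..<k}. X i \<omega>, \<lambda>i\<in>{k}. X i \<omega>) \<partial>M)
       = (\<integral>\<^sup>+\<omega>. (\<integral>\<^sup>+\<omega>'. F' (\<lambda>i\<in>{..<k}. X i \<omega>, \<lambda>i\<in>{k}. X i \<omega>') \<partial>M) \<partial>M)"
    by (rule nn_integral_indep_product[OF ind'[THEN conjunct1] ind'[THEN conjunct2, THEN conjunct1]
          ind'[THEN conjunct2, THEN conjunct2]]) measurable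
  then show ?thesis by (simp add: F'_def)
qed


section \<open>Fourth moments of linear and bilinear forms\<close>

text \<open>
  Expanding the fourth power, the term \<open>4 g h\<^sup>3 x\<^sup>3\<close> is split between its neighbours, so that no third
  moment occurs after integration, only the mean in the term that is linear in \<open>x\<close>.
\<close>

lemma fourth_power_sum_le:
  "((g::real) + h * x) ^ 4 \<le> g ^ 4 + 4 * g ^ 3 * h * x + 8 * g\<^sup>2 * h\<^sup>2 * x\<^sup>2 + 3 * h ^ 4 * x ^ 4"
proof -
  have "0 \<le> 2 * (h * x)\<^sup>2 * (g - h * x)\<^sup>2" by simp
  then show ?thesis by (simp add: power2_eq_square power3_eq_cube power4_eq_xxxx algebra_simps)
qed

text \<open>
  The bound is the expanded square of \<open>g\<^sup>2 + 4 m h\<^sup>2\<close>, which is what lets the induction step below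
  complete a square. The second moment is covered by \<open>m\<close> as well, because \<open>2 x\<^sup>2 \<le> 1 + x\<^sup>4\<close> and \<open>1 \<le> m\<close>.
\<close>

lemma (in prob_space) fourth_moment_add_centred:
  fixes X :: "'a \<Rightarrow> real"
  assumes [measurable]: "X \<in> borel_measurable M"
    and mean: "expectation X = 0"
    and int4: "integrable M (\<lambda>\<omega>. X \<omega> ^ 4)" and m4: "expectation (\<lambda>\<omega>. X \<omega> ^ 4) \<le> m" and m: "1 \<le> m"
  shows "(\<integral>\<^sup>+\<omega>. ennreal ((g + h * X \<omega>) ^ 4) \<partial>M)
    \<le> ennreal (g ^ 4 + 8 * m * (g\<^sup>2 * h\<^sup>2) + 16 * m\<^sup>2 * h ^ 4)"
proof -
  have sq: "x\<^sup>2 \<le> (1 + x ^ 4) / 2" for x :: real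
  proof -
    have "0 \<le> (x\<^sup>2 - 1)\<^sup>2" by simp
    then show ?thesis by (simp add: power2_diff)
  qed
  have ab: "\<bar>x\<bar> \<le> 1 + x ^ 4" for x :: real
  proof -
    have "2 * \<bar>x\<bar> \<le> 1 + x\<^sup>2" using sum_squares_bound[of 1 "\<bar>x\<bar>"] by simp
    moreover have "0 \<le> x ^ 4" by simp
    moreover have "a \<le> 1 + c" if "2 * a \<le> 1 + b" "0 \<le> c" "b \<le> (1 + c) / 2" for a b c :: real
      using that by (simp add: field_simps)
    ultimately show ?thesis using sq[of x] by blast
  qed
  have int2: "integrable M (\<lambda>\<omega>. (X \<omega>)\<^sup>2)"
    by (rule Bochner_Integration.integrable_bound[of _ "\<lambda>\<omega>. 1 + X \<omega> ^ 4"])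
       (use int4 sq in \<open>auto intro!: AE_I2 order_trans[OF sq]\<close>)
  have int1: "integrable M X"
    by (rule Bochner_Integration.integrable_bound[of _ "\<lambda>\<omega>. 1 + X \<omega> ^ 4"])
       (use int4 ab in auto)
  have "expectation (\<lambda>\<omega>. (X \<omega>)\<^sup>2) \<le> expectation (\<lambda>\<omega>. (1 + X \<omega> ^ 4) / 2)"
    by (intro integral_mono int2) (use int4 sq in auto)
  also have "\<dots> \<le> m" using int4 m4 m by (simp add: prob_space)
  finally have m2: "expectation (\<lambda>\<omega>. (X \<omega>)\<^sup>2) \<le> m" .
  let ?R = "\<lambda>\<omega>. g ^ 4 + 4 * g ^ 3 * h * X \<omega> + 8 * g\<^sup>2 * h\<^sup>2 * (X \<omega>)\<^sup>2 + 3 * h ^ 4 * X \<omega> ^ 4"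
  have intR: "integrable M ?R" using int1 int2 int4 by auto
  have R0: "0 \<le> ?R \<omega>" for \<omega>
    by (rule order_trans[OF _ fourth_power_sum_le]) simp
  have "(\<integral>\<^sup>+\<omega>. ennreal ((g + h * X \<omega>) ^ 4) \<partial>M) \<le> (\<integral>\<^sup>+\<omega>. ennreal (?R \<omega>) \<partial>M)"
    by (intro nn_integral_mono ennreal_leI fourth_power_sum_le)
  also have "\<dots> = ennreal (expectation ?R)"
    by (rule nn_integral_eq_integral[OF intR]) (use R0 in auto)
  also have "expectation ?R = g ^ 4 + 8 * g\<^sup>2 * h\<^sup>2 * expectation (\<lambda>\<omega>. (X \<omega>)\<^sup>2)
      + 3 * h ^ 4 * expectation (\<lambda>\<omega>. X \<omega> ^ 4)"
    using int1 int2 int4 by (simp add: mean prob_space)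
  also have "\<dots> \<le> g ^ 4 + 8 * g\<^sup>2 * h\<^sup>2 * m + 3 * h ^ 4 * m"
    by (intro add_mono mult_left_mono m2 m4) auto
  also have "\<dots> \<le> g ^ 4 + 8 * m * (g\<^sup>2 * h\<^sup>2) + 16 * m\<^sup>2 * h ^ 4"
  proof -
    have "3 * m \<le> 16 * m\<^sup>2" using m by (simp add: power2_eq_square mult_mono)
    then have "h ^ 4 * (3 * m) \<le> h ^ 4 * (16 * m\<^sup>2)" by (intro mult_left_mono) auto
    then show ?thesis by (simp add: algebra_simps)
  qed
  finally show ?thesis by (simp add: ennreal_leI)
qed

text \<open>
  Square roots in the extended nonnegative reals, for undoing the square in the Cauchy-Schwarz inequality.
\<close>

lemma ennreal_square_le:
  fixes x :: ennreal
  assumes "x\<^sup>2 \<le> ennreal (c\<^sup>2)" "0 \<le> c"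
  shows "x \<le> ennreal c"
proof (cases x)
  case (real v)
  have "ennreal (v\<^sup>2) \<le> ennreal (c\<^sup>2)" using assms(1) real by (simp only: ennreal_power)
  then have "v\<^sup>2 \<le> c\<^sup>2" by (subst (asm) ennreal_le_iff) auto
  then have "v \<le> c" using assms(2) by (rule power2_le_imp_le)
  then show ?thesis unfolding real by (rule ennreal_leI)
next
  case top
  then show ?thesis using assms by (simp add: power2_eq_square top_unique)
qed

lemma nn_integral_square_mult_le:
  fixes g h :: "'a \<Rightarrow> real"
  assumes [measurable]: "g \<in> borel_measurable M" "h \<in> borel_measurable M"
    and A: "(\<integral>\<^sup>+\<omega>. ennreal (g \<omega> ^ 4) \<partial>M) \<le> ennreal (A\<^sup>2)" "0 \<le> A"
    and B: "(\<integral>\<^sup>+\<omega>. ennreal (h \<omega> ^ 4) \<partial>M) \<le> ennreal (B\<^sup>2)" "0 \<le> B"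
  shows "(\<integral>\<^sup>+\<omega>. ennreal ((g \<omega>)\<^sup>2 * (h \<omega>)\<^sup>2) \<partial>M) \<le> ennreal (A * B)"
proof -
  let ?I = "\<integral>\<^sup>+\<omega>. ennreal ((g \<omega>)\<^sup>2) * ennreal ((h \<omega>)\<^sup>2) \<partial>M"
  have "?I\<^sup>2 \<le> (\<integral>\<^sup>+\<omega>. ennreal ((g \<omega>)\<^sup>2) ^ 2 \<partial>M) * (\<integral>\<^sup>+\<omega>. ennreal ((h \<omega>)\<^sup>2) ^ 2 \<partial>M)"
    by (rule Cauchy_Schwarz_nn_integral) measurable
  also have "\<dots> = (\<integral>\<^sup>+\<omega>. ennreal (g \<omega> ^ 4) \<partial>M) * (\<integral>\<^sup>+\<omega>. ennreal (h \<omega> ^ 4) \<partial>M)"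
    by (simp add: ennreal_power flip: power_mult)
  also have "\<dots> \<le> ennreal (A\<^sup>2) * ennreal (B\<^sup>2)" by (intro mult_mono A B) auto
  also have "\<dots> = ennreal ((A * B)\<^sup>2)" by (simp add: power_mult_distrib flip: ennreal_mult)
  finally have le: "?I\<^sup>2 \<le> ennreal ((A * B)\<^sup>2)" .
  then have "?I \<le> ennreal (A * B)" by (rule ennreal_square_le) (use A B in simp)
  moreover have "ennreal ((g \<omega>)\<^sup>2 * (h \<omega>)\<^sup>2) = ennreal ((g \<omega>)\<^sup>2) * ennreal ((h \<omega>)\<^sup>2)" for \<omega>
    by (rule ennreal_mult) auto
  ultimately show ?thesis by (simp only:)
qed

text \<open>
  Both the noise and random signs are of this kind.
\<close>

locale centred_indep_fourth = prob_space +
  fixes X :: "nat \<Rightarrow> 'a \<Rightarrow> real" and n :: nat and m :: real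
  assumes indep: "indep_vars (\<lambda>_. borel) X {..<n}"
    and mean0: "\<And>i. i < n \<Longrightarrow> expectation (X i) = 0"
    and int4: "\<And>i. i < n \<Longrightarrow> integrable M (\<lambda>\<omega>. X i \<omega> ^ 4)"
    and m4: "\<And>i. i < n \<Longrightarrow> expectation (\<lambda>\<omega>. X i \<omega> ^ 4) \<le> m"
    and m1: "1 \<le> m"
begin

lemma rv[measurable]: "i < n \<Longrightarrow> X i \<in> borel_measurable M"
  using indep unfolding indep_vars_def by auto

text \<open>
  In terms of \<open>N(f) = sqrt (E f\<^sup>4)\<close> this reads \<open>N(g + h X\<^sub>k) \<le> N(g) + 4 m N(h)\<close> when \<open>g\<close> and
  \<open>h\<close> depend on the earlier variables only: after integrating out \<open>X\<^sub>k\<close>, the Cauchy-Schwarz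
  inequality bounds the mixed term and completes the square. Any polynomial that is affine in
  each variable can be treated by iteration.
\<close>

lemma fourth_moment_step:
  assumes k: "k < n"
    and [measurable]: "g \<in> borel_measurable (PiM {..<k} (\<lambda>_. borel))"
      "h \<in> borel_measurable (PiM {..<k} (\<lambda>_. borel))"
    and A: "(\<integral>\<^sup>+\<omega>. ennreal (g (\<lambda>i\<in>{..<k}. X i \<omega>) ^ 4) \<partial>M) \<le> ennreal (A\<^sup>2)" "0 \<le> A"
    and B: "(\<integral>\<^sup>+\<omega>. ennreal (h (\<lambda>i\<in>{..<k}. X i \<omega>) ^ 4) \<partial>M) \<le> ennreal (B\<^sup>2)" "0 \<le> B"
  shows "(\<integral>\<^sup>+\<omega>. ennreal ((g (\<lambda>i\<in>{..<k}. X i \<omega>) + h (\<lambda>i\<in>{..<k}. X i \<omega>) * X k \<omega>) ^ 4) \<partial>M)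
      \<le> ennreal ((A + 4 * m * B)\<^sup>2)"
proof -
  let ?R = "\<lambda>\<omega>. (\<lambda>i\<in>{..<k}. X i \<omega>)"
  let ?g = "\<lambda>\<omega>. g (?R \<omega>)" and ?h = "\<lambda>\<omega>. h (?R \<omega>)"
  have [measurable]: "?R \<in> measurable M (PiM {..<k} (\<lambda>_. borel))"
    using k by (intro measurable_restrict) auto
  have "(\<integral>\<^sup>+\<omega>. ennreal ((?g \<omega> + ?h \<omega> * X k \<omega>) ^ 4) \<partial>M)
      = (\<integral>\<^sup>+\<omega>. (\<integral>\<^sup>+\<omega>'. ennreal ((?g \<omega> + ?h \<omega> * X k \<omega>') ^ 4) \<partial>M) \<partial>M)"
    using nn_integral_indep_vars_last[OF indep k, of "\<lambda>z. ennreal ((g (fst z) + h (fst z) * snd z) ^ 4)"]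
    by simp
  also have "\<dots> \<le> (\<integral>\<^sup>+\<omega>. ennreal (?g \<omega> ^ 4 + 8 * m * ((?g \<omega>)\<^sup>2 * (?h \<omega>)\<^sup>2) + 16 * m\<^sup>2 * ?h \<omega> ^ 4) \<partial>M)"
    by (intro nn_integral_mono fourth_moment_add_centred) (use k mean0 int4 m4 m1 in auto)
  also have "\<dots> = (\<integral>\<^sup>+\<omega>. ennreal (?g \<omega> ^ 4) + ennreal (8 * m) * ennreal ((?g \<omega>)\<^sup>2 * (?h \<omega>)\<^sup>2)
      + ennreal (16 * m\<^sup>2) * ennreal (?h \<omega> ^ 4) \<partial>M)"
    using m1 by (intro nn_integral_cong) (simp flip: ennreal_mult ennreal_plus)
  also have "\<dots> = (\<integral>\<^sup>+\<omega>. ennreal (?g \<omega> ^ 4) \<partial>M)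
      + ennreal (8 * m) * (\<integral>\<^sup>+\<omega>. ennreal ((?g \<omega>)\<^sup>2 * (?h \<omega>)\<^sup>2) \<partial>M)
      + ennreal (16 * m\<^sup>2) * (\<integral>\<^sup>+\<omega>. ennreal (?h \<omega> ^ 4) \<partial>M)"
    by (simp add: nn_integral_add nn_integral_cmult)
  also have "\<dots> \<le> ennreal (A\<^sup>2) + ennreal (8 * m) * ennreal (A * B) + ennreal (16 * m\<^sup>2) * ennreal (B\<^sup>2)"
    by (intro add_mono mult_left_mono A B nn_integral_square_mult_le) auto
  also have "\<dots> = ennreal (A\<^sup>2 + 8 * m * (A * B) + 16 * m\<^sup>2 * B\<^sup>2)"
    using m1 A B by (simp flip: ennreal_mult ennreal_plus)
  also have "A\<^sup>2 + 8 * m * (A * B) + 16 * m\<^sup>2 * B\<^sup>2 = (A + 4 * m * B)\<^sup>2"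
    by (simp add: power2_eq_square algebra_simps)
  finally show ?thesis .
qed

lemma linear_form_fourth_moment:
  assumes "k \<le> n"
  shows "(\<integral>\<^sup>+\<omega>. ennreal ((\<Sum>i<k. a i * X i \<omega>) ^ 4) \<partial>M) \<le> ennreal ((4 * m * (\<Sum>i<k. (a i)\<^sup>2))\<^sup>2)"
  using assms
proof (induction k)
  case (Suc k)
  let ?g = "\<lambda>f. \<Sum>i<k. a i * f i"
  have [measurable]: "?g \<in> borel_measurable (PiM {..<k} (\<lambda>_. borel))" by measurable
  have "(\<integral>\<^sup>+\<omega>. ennreal ((?g (\<lambda>i\<in>{..<k}. X i \<omega>) + a k * X k \<omega>) ^ 4) \<partial>M)
      \<le> ennreal ((4 * m * (\<Sum>i<k. (a i)\<^sup>2) + 4 * m * (a k)\<^sup>2)\<^sup>2)"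
    using Suc m1 by (intro fourth_moment_step) (auto intro!: sum_nonneg mult_nonneg_nonneg simp: emeasure_space_1)
  then show ?case by (simp add: algebra_simps)
qed simp

text \<open>
  Increasing \<open>k\<close> adds the variable \<open>X\<^sub>k\<close> times a linear form in the earlier variables, whose fourth
  moment is already known. The bound is quadratic in the squared Frobenius norm, as it would be for a
  squared variance.
\<close>

lemma bilinear_form_fourth_moment:
  assumes "k \<le> n"
  shows "(\<integral>\<^sup>+\<omega>. ennreal ((\<Sum>j<k. \<Sum>i<j. a i j * X i \<omega> * X j \<omega>) ^ 4) \<partial>M)
    \<le> ennreal ((16 * m\<^sup>2 * (\<Sum>j<k. \<Sum>i<j. (a i j)\<^sup>2))\<^sup>2)"
  using assms
proof (induction k)
  case (Suc k)
  let ?g = "\<lambda>f. \<Sum>j<k. \<Sum>i<j. a i j * f i * f j" and ?h = "\<lambda>f. \<Sum>i<k. a i k * f i"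
  have [measurable]: "?g \<in> borel_measurable (PiM {..<k} (\<lambda>_. borel))"
    by (intro borel_measurable_sum borel_measurable_times measurable_const measurable_component_singleton) auto
  have [measurable]: "?h \<in> borel_measurable (PiM {..<k} (\<lambda>_. borel))" by measurable
  have "(\<integral>\<^sup>+\<omega>. ennreal ((?g (\<lambda>i\<in>{..<k}. X i \<omega>) + ?h (\<lambda>i\<in>{..<k}. X i \<omega>) * X k \<omega>) ^ 4) \<partial>M)
      \<le> ennreal ((16 * m\<^sup>2 * (\<Sum>j<k. \<Sum>i<j. (a i j)\<^sup>2) + 4 * m * (4 * m * (\<Sum>i<k. (a i k)\<^sup>2)))\<^sup>2)"
  proof (rule fourth_moment_step)
    show "(\<integral>\<^sup>+\<omega>. ennreal (?g (\<lambda>i\<in>{..<k}. X i \<omega>) ^ 4) \<partial>M)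
        \<le> ennreal ((16 * m\<^sup>2 * (\<Sum>j<k. \<Sum>i<j. (a i j)\<^sup>2))\<^sup>2)"
      using Suc by simp
    show "(\<integral>\<^sup>+\<omega>. ennreal (?h (\<lambda>i\<in>{..<k}. X i \<omega>) ^ 4) \<partial>M)
        \<le> ennreal ((4 * m * (\<Sum>i<k. (a i k)\<^sup>2))\<^sup>2)"
      using linear_form_fourth_moment[of k "\<lambda>i. a i k"] Suc by simp
  qed (use Suc m1 in \<open>auto intro!: sum_nonneg mult_nonneg_nonneg\<close>)
  moreover have "?g (\<lambda>i\<in>{..<k}. X i \<omega>) + ?h (\<lambda>i\<in>{..<k}. X i \<omega>) * X k \<omega>
      = (\<Sum>j<Suc k. \<Sum>i<j. a i j * X i \<omega> * X j \<omega>)" for \<omega>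
    by (simp add: sum_distrib_right)
  moreover have "16 * m\<^sup>2 * (\<Sum>j<k. \<Sum>i<j. (a i j)\<^sup>2) + 4 * m * (4 * m * (\<Sum>i<k. (a i k)\<^sup>2))
      = 16 * m\<^sup>2 * (\<Sum>j<Suc k. \<Sum>i<j. (a i j)\<^sup>2)"
    by (simp add: power2_eq_square distrib_left)
  ultimately show ?case by (simp only:)
qed simp

end


section \<open>Sums of independent variables with slightly more than two moments\<close>

lemma powr_add_le_double:
  fixes a b s :: real
  assumes "0 \<le> a" "0 \<le> b" "0 < s" "s \<le> 1"
  shows "(a + b) powr s \<le> 2 * (a powr s + b powr s)"
proof -
  have "(a + b) powr s \<le> (2 * max a b) powr s"
    using assms by (intro powr_mono2) auto
  also have "\<dots> = 2 powr s * max a b powr s" using assms by (simp add: powr_mult)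
  also have "\<dots> \<le> 2 powr 1 * (a powr s + b powr s)"
  proof (rule mult_mono)
    show "2 powr s \<le> (2 powr 1 :: real)" using assms by (intro powr_mono) auto
    show "max a b powr s \<le> a powr s + b powr s" by (cases "a \<le> b") (auto simp: max_def)
  qed auto
  finally show ?thesis by simp
qed

text \<open>
  The function \<open>(T + x\<^sup>2)\<^sup>1\<^sup>+\<^sup>s\<close> is a smooth majorant of \<open>|x|\<^sup>2\<^sup>+\<^sup>2\<^sup>s\<close>, and this is its second-order
  Taylor bound. The remainder is arranged to involve only \<open>z\<^sup>2\<close> and \<open>|z|\<^sup>2\<^sup>+\<^sup>2\<^sup>s\<close>, because \<open>z\<close> will
  be a variable of which only a moment of order \<open>2 + 2 s\<close> is known, and only \<open>g\<^sup>2\<close>, which is easy to integrate.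
  The latter uses \<open>(1 + u)\<^sup>s \<le> 1 + u\<close>, hence the restriction \<open>s \<le> 1\<close>.
\<close>

lemma powr_quadratic_expansion_le:
  fixes T s g z :: real
  assumes T: "0 < T" and s: "0 < s" "s \<le> 1"
  shows "(T + (g + z)\<^sup>2) powr (1 + s) \<le> (T + g\<^sup>2) powr (1 + s) + 2 * (1 + s) * g * (T + g\<^sup>2) powr s * z
      + 12 * (T powr s * (1 + 2 * g\<^sup>2 / T) * z\<^sup>2 + 2 * \<bar>z\<bar> powr (2 + 2 * s))"
proof (cases "z = 0")
  case False
  define d :: "nat \<Rightarrow> real \<Rightarrow> real" where "d j = (if j = 0 then (\<lambda>x. (T + x\<^sup>2) powr (1 + s))
    else if j = 1 then (\<lambda>x. 2 * (1 + s) * x * (T + x\<^sup>2) powr s)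
    else (\<lambda>x. 2 * (1 + s) * (T + x\<^sup>2) powr s + 4 * s * (1 + s) * x\<^sup>2 * (T + x\<^sup>2) powr (s - 1)))" for j
  have pos: "0 < T + x\<^sup>2" for x :: real using T by (simp add: add_pos_nonneg)
  have D: "DERIV (\<lambda>x. (T + x\<^sup>2) powr r) x :> r * (T + x\<^sup>2) powr (r - 1) * (2 * x)" for r x
  proof -
    have "DERIV (\<lambda>x. T + x\<^sup>2) x :> 2 * x" by (auto intro!: derivative_eq_intros)
    from DERIV_fun_powr[OF this pos, of r] show ?thesis by simp
  qed
  have D0: "DERIV (d 0) x :> d 1 x" for x
  proof -
    have "d 1 x = (1 + s) * (T + x\<^sup>2) powr ((1 + s) - 1) * (2 * x)"
      by (simp add: d_def algebra_simps)
    moreover have "d 0 = (\<lambda>x. (T + x\<^sup>2) powr (1 + s))" by (simp add: d_def)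
    ultimately show ?thesis using D[of "1 + s" x] by (simp only:)
  qed
  have D1: "DERIV (d 1) x :> d 2 x" for x
  proof -
    have "DERIV (\<lambda>x. 2 * (1 + s) * x * (T + x\<^sup>2) powr s) x :>
        2 * (1 + s) * (T + x\<^sup>2) powr s + 2 * (1 + s) * x * (s * (T + x\<^sup>2) powr (s - 1) * (2 * x))"
      by (auto intro!: derivative_eq_intros D pos)
    then show ?thesis unfolding d_def by (simp add: power2_eq_square algebra_simps)
  qed
  \<comment> \<open>Taylor expansion needs two distinct points, hence \<open>z \<noteq> 0\<close>.\<close>
  have "\<exists>t. (if g + z < g then g + z < t \<and> t < g else g < t \<and> t < g + z) \<and>
      d 0 (g + z) = (\<Sum>m<2. d m g / fact m * ((g + z) - g) ^ m) + d 2 t / fact 2 * ((g + z) - g) ^ 2"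
  proof (rule Taylor[where a = "min g (g + z)" and b = "max g (g + z)"])
    show "\<forall>m t. m < 2 \<and> min g (g + z) \<le> t \<and> t \<le> max g (g + z) \<longrightarrow> DERIV (d m) t :> d (Suc m) t"
      using D0 D1 by (auto simp: numeral_2_eq_2 less_Suc_eq)
  qed (use False in auto)
  then obtain t where t: "if g + z < g then g + z < t \<and> t < g else g < t \<and> t < g + z"
    and eq: "d 0 (g + z) = (\<Sum>m<2. d m g / fact m * z ^ m) + d 2 t / fact 2 * z ^ 2" by auto
  have "\<bar>t\<bar> \<le> \<bar>g\<bar> + \<bar>z\<bar>" using t by (auto split: if_splits)
  then have "t\<^sup>2 \<le> (\<bar>g\<bar> + \<bar>z\<bar>)\<^sup>2" by (simp add: abs_le_square_iff[symmetric])
  also have "\<dots> \<le> 2 * g\<^sup>2 + 2 * z\<^sup>2"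
    using sum_squares_bound[of "\<bar>g\<bar>" "\<bar>z\<bar>"] by (simp add: power2_sum)
  finally have t2: "t\<^sup>2 \<le> 2 * g\<^sup>2 + 2 * z\<^sup>2" .
  have "(T + t\<^sup>2) powr s \<le> ((T + 2 * g\<^sup>2) + 2 * z\<^sup>2) powr s"
    using t2 T s by (intro powr_mono2) auto
  also have "\<dots> \<le> 2 * ((T + 2 * g\<^sup>2) powr s + (2 * z\<^sup>2) powr s)"
    using T s by (intro powr_add_le_double) auto
  also have "\<dots> \<le> 2 * (T powr s * (1 + 2 * g\<^sup>2 / T) + 2 * \<bar>z\<bar> powr (2 * s))"
  proof (intro mult_left_mono add_mono)
    have "(T + 2 * g\<^sup>2) powr s = T powr s * (1 + 2 * g\<^sup>2 / T) powr s"
    proof -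
      have "T + 2 * g\<^sup>2 = T * (1 + 2 * g\<^sup>2 / T)" using T by (simp add: distrib_left)
      then show ?thesis using T by (simp add: powr_mult)
    qed
    also have "(1 + 2 * g\<^sup>2 / T) powr s \<le> (1 + 2 * g\<^sup>2 / T) powr 1"
      using T s by (intro powr_mono) auto
    finally show "(T + 2 * g\<^sup>2) powr s \<le> T powr s * (1 + 2 * g\<^sup>2 / T)" using T by (simp add: mult_left_mono)
    have "(2 * z\<^sup>2) powr s = 2 powr s * \<bar>z\<bar> powr (2 * s)"
      using False by (simp add: powr_mult powr_powr[symmetric] flip: powr_realpow)
    also have "2 powr s \<le> (2::real) powr 1" using s by (intro powr_mono) auto
    finally show "(2 * z\<^sup>2) powr s \<le> 2 * \<bar>z\<bar> powr (2 * s)" by (simp add: mult_right_mono)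
  qed auto
  finally have B: "(T + t\<^sup>2) powr s \<le> 2 * (T powr s * (1 + 2 * g\<^sup>2 / T) + 2 * \<bar>z\<bar> powr (2 * s))" .
  have "t\<^sup>2 * (T + t\<^sup>2) powr (s - 1) \<le> (T + t\<^sup>2) * (T + t\<^sup>2) powr (s - 1)"
    using T by (intro mult_right_mono) auto
  also have "\<dots> = (T + t\<^sup>2) powr s" using pos[of t] by (simp add: powr_mult_base)
  finally have e: "t\<^sup>2 * (T + t\<^sup>2) powr (s - 1) \<le> (T + t\<^sup>2) powr s" .
  have ss: "s * (1 + s) \<le> 1 * (1 + 1)" using s by (intro mult_mono) auto
  have "d 2 t = 2 * (1 + s) * (T + t\<^sup>2) powr s + 4 * (s * (1 + s)) * (t\<^sup>2 * (T + t\<^sup>2) powr (s - 1))"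
    by (simp add: d_def)
  also have "\<dots> \<le> 4 * (T + t\<^sup>2) powr s + 8 * (T + t\<^sup>2) powr s"
    using s ss by (intro add_mono mult_mono e) auto
  also have "\<dots> = 12 * (T + t\<^sup>2) powr s" by simp
  finally have d2: "d 2 t \<le> 12 * (T + t\<^sup>2) powr s" .
  have "d 2 t / fact 2 * z\<^sup>2 \<le> 6 * (T + t\<^sup>2) powr s * z\<^sup>2"
    by (rule mult_right_mono) (use d2 in simp_all)
  also have "\<dots> \<le> 6 * (2 * (T powr s * (1 + 2 * g\<^sup>2 / T) + 2 * \<bar>z\<bar> powr (2 * s))) * z\<^sup>2"
    using B by (intro mult_right_mono mult_left_mono) auto
  also have "\<dots> = 12 * (T powr s * (1 + 2 * g\<^sup>2 / T) * z\<^sup>2 + 2 * (\<bar>z\<bar> powr (2 * s) * \<bar>z\<bar> powr 2))"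
    using False by (simp add: algebra_simps)
  also have "\<bar>z\<bar> powr (2 * s) * \<bar>z\<bar> powr 2 = \<bar>z\<bar> powr (2 + 2 * s)"
    unfolding powr_add by (rule mult.commute)
  finally have "d 2 t / fact 2 * z\<^sup>2 \<le> 12 * (T powr s * (1 + 2 * g\<^sup>2 / T) * z\<^sup>2 + 2 * \<bar>z\<bar> powr (2 + 2 * s))" .
  moreover have "(\<Sum>m<2. d m g / fact m * z ^ m) = (T + g\<^sup>2) powr (1 + s) + 2 * (1 + s) * g * (T + g\<^sup>2) powr s * z"
    by (simp add: numeral_2_eq_2 d_def)
  moreover have "d 0 (g + z) = (T + (g + z)\<^sup>2) powr (1 + s)" by (simp add: d_def)
  ultimately show ?thesis using eq by linarith
qed (use T in simp)

lemma square_le_one_plus_powr: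
  fixes z s :: real assumes "0 < s"
  shows "z\<^sup>2 \<le> 1 + \<bar>z\<bar> powr (2 + 2 * s)"
proof (cases "\<bar>z\<bar> \<le> 1")
  case True
  then have "z\<^sup>2 \<le> 1" by (simp add: abs_square_le_1)
  then show ?thesis by (smt (verit) powr_ge_zero)
next
  case False
  then have "\<bar>z\<bar> powr 2 \<le> \<bar>z\<bar> powr (2 + 2 * s)" using assms by (intro powr_mono) auto
  moreover have "\<bar>z\<bar> powr 2 = z\<^sup>2" using False by simp
  ultimately show ?thesis by simp
qed

locale centred_indep_powr = prob_space +
  fixes X :: "nat \<Rightarrow> 'a \<Rightarrow> real" and n :: nat and s m :: real
  assumes indep: "indep_vars (\<lambda>_. borel) X {..<n}"
    and mean0: "\<And>i. i < n \<Longrightarrow> expectation (X i) = 0"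
    and intp: "\<And>i. i < n \<Longrightarrow> integrable M (\<lambda>\<omega>. \<bar>X i \<omega>\<bar> powr (2 + 2 * s))"
    and mp: "\<And>i. i < n \<Longrightarrow> expectation (\<lambda>\<omega>. \<bar>X i \<omega>\<bar> powr (2 + 2 * s)) \<le> m"
    and m1: "1 \<le> m" and s: "0 < s" "s \<le> 1"
begin

lemma rv[measurable]: "i < n \<Longrightarrow> X i \<in> borel_measurable M"
  using indep unfolding indep_vars_def by auto

lemma integrable_square: "i < n \<Longrightarrow> integrable M (\<lambda>\<omega>. (X i \<omega>)\<^sup>2)"
  by (rule Bochner_Integration.integrable_bound[of _ "\<lambda>\<omega>. 1 + \<bar>X i \<omega>\<bar> powr (2 + 2 * s)"])
     (use intp square_le_one_plus_powr[OF s(1)] in \<open>auto\<close>)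

lemma integrable_X: "i < n \<Longrightarrow> integrable M (X i)"
  using integrable_square square_integrable_imp_integrable rv by blast

lemma expectation_square_le: assumes "i < n" shows "expectation (\<lambda>\<omega>. (X i \<omega>)\<^sup>2) \<le> 2 * m"
proof -
  have "expectation (\<lambda>\<omega>. (X i \<omega>)\<^sup>2) \<le> expectation (\<lambda>\<omega>. 1 + \<bar>X i \<omega>\<bar> powr (2 + 2 * s))"
    by (intro integral_mono integrable_square assms)
       (use intp[OF assms] square_le_one_plus_powr[OF s(1)] in auto)
  also have "\<dots> \<le> 2 * m" using intp[OF assms] mp[OF assms] m1 by (simp add: prob_space)
  finally show ?thesis .
qed

lemma add_centred_square_le:
  assumes k: "k < n"
  shows "(\<integral>\<^sup>+\<omega>. ennreal ((g + X k \<omega>)\<^sup>2) \<partial>M) \<le> ennreal (g\<^sup>2 + 2 * m)"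
proof -
  have i: "integrable M (\<lambda>\<omega>. g\<^sup>2 + 2 * g * X k \<omega> + (X k \<omega>)\<^sup>2)"
    using integrable_X[OF k] integrable_square[OF k] by auto
  have "(\<integral>\<^sup>+\<omega>. ennreal ((g + X k \<omega>)\<^sup>2) \<partial>M) = (\<integral>\<^sup>+\<omega>. ennreal (g\<^sup>2 + 2 * g * X k \<omega> + (X k \<omega>)\<^sup>2) \<partial>M)"
    by (intro nn_integral_cong arg_cong[of _ _ ennreal]) (simp add: power2_sum)
  also have "\<dots> = ennreal (expectation (\<lambda>\<omega>. g\<^sup>2 + 2 * g * X k \<omega> + (X k \<omega>)\<^sup>2))"
  proof (rule nn_integral_eq_integral[OF i], rule AE_I2)
    fix \<omega> show "0 \<le> g\<^sup>2 + 2 * g * X k \<omega> + (X k \<omega>)\<^sup>2"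
      using zero_le_power2[of "g + X k \<omega>"] by (simp add: power2_sum)
  qed
  also have "expectation (\<lambda>\<omega>. g\<^sup>2 + 2 * g * X k \<omega> + (X k \<omega>)\<^sup>2) \<le> g\<^sup>2 + 2 * m"
    using integrable_X[OF k] integrable_square[OF k] mean0[OF k] expectation_square_le[OF k]
    by (simp add: prob_space)
  finally show ?thesis by (simp add: ennreal_leI)
qed

lemma add_centred_powr_le:
  assumes k: "k < n" and T: "0 < T"
  shows "(\<integral>\<^sup>+\<omega>. ennreal ((T + (g + X k \<omega>)\<^sup>2) powr (1 + s)) \<partial>M)
    \<le> ennreal ((T + g\<^sup>2) powr (1 + s) + 24 * m * (T powr s * (1 + 2 * g\<^sup>2 / T) + 1))"
proof -
  let ?R = "\<lambda>\<omega>. (T + g\<^sup>2) powr (1 + s) + 2 * (1 + s) * g * (T + g\<^sup>2) powr s * X k \<omega>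
      + 12 * (T powr s * (1 + 2 * g\<^sup>2 / T) * (X k \<omega>)\<^sup>2 + 2 * \<bar>X k \<omega>\<bar> powr (2 + 2 * s))"
  have i: "integrable M ?R" using integrable_X[OF k] integrable_square[OF k] intp[OF k] by auto
  have le: "(T + (g + X k \<omega>)\<^sup>2) powr (1 + s) \<le> ?R \<omega>" for \<omega>
    by (rule powr_quadratic_expansion_le[OF T s])
  have "(\<integral>\<^sup>+\<omega>. ennreal ((T + (g + X k \<omega>)\<^sup>2) powr (1 + s)) \<partial>M) \<le> (\<integral>\<^sup>+\<omega>. ennreal (?R \<omega>) \<partial>M)"
    by (intro nn_integral_mono ennreal_leI le)
  also have "\<dots> = ennreal (expectation ?R)"
    by (rule nn_integral_eq_integral[OF i], rule AE_I2, rule order_trans[OF powr_ge_zero le])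
  also have "expectation ?R = (T + g\<^sup>2) powr (1 + s)
      + 12 * (T powr s * (1 + 2 * g\<^sup>2 / T) * expectation (\<lambda>\<omega>. (X k \<omega>)\<^sup>2)
        + 2 * expectation (\<lambda>\<omega>. \<bar>X k \<omega>\<bar> powr (2 + 2 * s)))"
    using integrable_X[OF k] integrable_square[OF k] intp[OF k] mean0[OF k] by (simp add: prob_space)
  also have "\<dots> \<le> (T + g\<^sup>2) powr (1 + s) + 12 * (T powr s * (1 + 2 * g\<^sup>2 / T) * (2 * m) + 2 * m)"
    using T by (intro add_mono mult_left_mono expectation_square_le mp k order_refl) auto
  also have "\<dots> = (T + g\<^sup>2) powr (1 + s) + 24 * m * (T powr s * (1 + 2 * g\<^sup>2 / T) + 1)"
    by (simp add: algebra_simps)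
  finally show ?thesis by (simp add: ennreal_leI)
qed

lemma sum_square_le:
  assumes "k \<le> n"
  shows "(\<integral>\<^sup>+\<omega>. ennreal ((\<Sum>i<k. X i \<omega>)\<^sup>2) \<partial>M) \<le> ennreal (real k * (2 * m))"
  using assms
proof (induction k)
  case (Suc k)
  then have k: "k < n" by simp
  let ?g = "\<lambda>f. \<Sum>i<k. f i :: real" and ?R = "\<lambda>\<omega>. \<lambda>i\<in>{..<k}. X i \<omega>"
  have [measurable]: "?g \<in> borel_measurable (PiM {..<k} (\<lambda>_. borel))" by measurable
  have [measurable]: "?R \<in> measurable M (PiM {..<k} (\<lambda>_. borel))"
    using k by (intro measurable_restrict) auto
  have "(\<integral>\<^sup>+\<omega>. ennreal ((?g (?R \<omega>) + X k \<omega>)\<^sup>2) \<partial>M)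
      = (\<integral>\<^sup>+\<omega>. (\<integral>\<^sup>+\<omega>'. ennreal ((?g (?R \<omega>) + X k \<omega>')\<^sup>2) \<partial>M) \<partial>M)"
    using nn_integral_indep_vars_last[OF indep k, of "\<lambda>z. ennreal ((?g (fst z) + snd z)\<^sup>2)"] by simp
  also have "\<dots> \<le> (\<integral>\<^sup>+\<omega>. ennreal ((?g (?R \<omega>))\<^sup>2 + 2 * m) \<partial>M)"
    by (intro nn_integral_mono add_centred_square_le k)
  also have "\<dots> = (\<integral>\<^sup>+\<omega>. ennreal ((?g (?R \<omega>))\<^sup>2) + ennreal (2 * m) \<partial>M)"
    using m1 by (intro nn_integral_cong ennreal_plus) auto
  also have "\<dots> = (\<integral>\<^sup>+\<omega>. ennreal ((?g (?R \<omega>))\<^sup>2) \<partial>M) + ennreal (2 * m)"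
    by (subst nn_integral_add) (auto simp: emeasure_space_1 simp del: restrict_apply)
  also have "\<dots> \<le> ennreal (real k * (2 * m)) + ennreal (2 * m)"
    using Suc by (intro add_mono) auto
  also have "\<dots> = ennreal (real (Suc k) * (2 * m))"
    using m1 by (simp add: algebra_simps flip: ennreal_plus)
  finally show ?case by simp
qed simp

text \<open>
  With \<open>T = n\<close> the partial sums satisfy \<open>E g\<^sup>2 / T \<le> 2 m\<close>, so every new variable adds
  at most a constant times \<open>n\<^sup>s\<close>.
\<close>

lemma sum_powr_moment_aux:
  assumes "k \<le> n" "1 \<le> n"
  shows "(\<integral>\<^sup>+\<omega>. ennreal ((real n + (\<Sum>i<k. X i \<omega>)\<^sup>2) powr (1 + s)) \<partial>M)
     \<le> ennreal (real n powr (1 + s) + real k * (144 * m\<^sup>2 * real n powr s))"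
  using assms
proof (induction k)
  case 0
  then show ?case by (simp add: emeasure_space_1)
next
  case (Suc k)
  then have k: "k < n" by simp
  let ?g = "\<lambda>f. \<Sum>i<k. f i :: real" and ?R = "\<lambda>\<omega>. \<lambda>i\<in>{..<k}. X i \<omega>" and ?T = "real n"
  have T: "1 \<le> ?T" using Suc by simp
  have Ts: "1 \<le> ?T powr s" using T s by (simp add: ge_one_powr_ge_zero)
  have [measurable]: "?g \<in> borel_measurable (PiM {..<k} (\<lambda>_. borel))" by measurable
  have [measurable]: "?R \<in> measurable M (PiM {..<k} (\<lambda>_. borel))"
    using k by (intro measurable_restrict) auto
  have "(\<integral>\<^sup>+\<omega>. ennreal ((?T + (?g (?R \<omega>) + X k \<omega>)\<^sup>2) powr (1 + s)) \<partial>M)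
      = (\<integral>\<^sup>+\<omega>. (\<integral>\<^sup>+\<omega>'. ennreal ((?T + (?g (?R \<omega>) + X k \<omega>')\<^sup>2) powr (1 + s)) \<partial>M) \<partial>M)"
    using nn_integral_indep_vars_last[OF indep k, of "\<lambda>z. ennreal ((?T + (?g (fst z) + snd z)\<^sup>2) powr (1 + s))"]
    by simp
  also have "\<dots> \<le> (\<integral>\<^sup>+\<omega>. ennreal ((?T + (?g (?R \<omega>))\<^sup>2) powr (1 + s)
        + 24 * m * (?T powr s * (1 + 2 * (?g (?R \<omega>))\<^sup>2 / ?T) + 1)) \<partial>M)"
    using T by (intro nn_integral_mono add_centred_powr_le k) auto
  also have "\<dots> = (\<integral>\<^sup>+\<omega>. ennreal ((?T + (?g (?R \<omega>))\<^sup>2) powr (1 + s)) + (ennreal (24 * m * (?T powr s + 1))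
        + ennreal (48 * m * ?T powr s / ?T) * ennreal ((?g (?R \<omega>))\<^sup>2)) \<partial>M)"
  proof (rule nn_integral_cong)
    fix \<omega>
    have "(?T + (?g (?R \<omega>))\<^sup>2) powr (1 + s) + 24 * m * (?T powr s * (1 + 2 * (?g (?R \<omega>))\<^sup>2 / ?T) + 1)
      = (?T + (?g (?R \<omega>))\<^sup>2) powr (1 + s) + (24 * m * (?T powr s + 1)
        + (48 * m * ?T powr s / ?T) * (?g (?R \<omega>))\<^sup>2)"
      using T by (simp add: field_simps del: restrict_apply)
    then show "ennreal ((?T + (?g (?R \<omega>))\<^sup>2) powr (1 + s) + 24 * m * (?T powr s * (1 + 2 * (?g (?R \<omega>))\<^sup>2 / ?T) + 1))
      = ennreal ((?T + (?g (?R \<omega>))\<^sup>2) powr (1 + s)) + (ennreal (24 * m * (?T powr s + 1))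
        + ennreal (48 * m * ?T powr s / ?T) * ennreal ((?g (?R \<omega>))\<^sup>2))"
      using T m1 by (simp flip: ennreal_plus ennreal_mult del: restrict_apply)
  qed
  also have "\<dots> = (\<integral>\<^sup>+\<omega>. ennreal ((?T + (?g (?R \<omega>))\<^sup>2) powr (1 + s)) \<partial>M) + (ennreal (24 * m * (?T powr s + 1))
        + ennreal (48 * m * ?T powr s / ?T) * (\<integral>\<^sup>+\<omega>. ennreal ((?g (?R \<omega>))\<^sup>2) \<partial>M))"
    by (simp add: nn_integral_add nn_integral_cmult emeasure_space_1 del: restrict_apply)
  also have "\<dots> \<le> ennreal (?T powr (1 + s) + real k * (144 * m\<^sup>2 * ?T powr s)) + (ennreal (24 * m * (?T powr s + 1))
        + ennreal (48 * m * ?T powr s / ?T) * ennreal (real k * (2 * m)))"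
    using Suc sum_square_le[of k] by (intro add_mono mult_left_mono) auto
  also have "\<dots> = ennreal (?T powr (1 + s) + real k * (144 * m\<^sup>2 * ?T powr s) + (24 * m * (?T powr s + 1)
        + (48 * m * ?T powr s / ?T) * (real k * (2 * m))))"
    using T m1 by (simp flip: ennreal_plus ennreal_mult)
  also have "\<dots> \<le> ennreal (?T powr (1 + s) + real (Suc k) * (144 * m\<^sup>2 * ?T powr s))"
  proof (rule ennreal_leI)
    \<comment> \<open>The constant splits as \<open>144 = 48 + 96\<close>: the part that does not involve the partial sum, and
      the part proportional to its square.\<close>
    have "24 * m * (?T powr s + 1) \<le> 24 * m * (2 * ?T powr s)"
      using Ts m1 by (intro mult_left_mono) auto
    also have "\<dots> \<le> 48 * m\<^sup>2 * ?T powr s"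
    proof -
      have "m * ?T powr s * 1 \<le> m * ?T powr s * m" using m1 by (intro mult_left_mono) auto
      then show ?thesis by (simp add: power2_eq_square mult_ac)
    qed
    finally have 1: "24 * m * (?T powr s + 1) \<le> 48 * m\<^sup>2 * ?T powr s" .
    have "(48 * m * ?T powr s / ?T) * (real k * (2 * m)) \<le> (48 * m * ?T powr s / ?T) * (?T * (2 * m))"
      using k m1 by (intro mult_left_mono mult_right_mono) auto
    also have "\<dots> = 96 * m\<^sup>2 * ?T powr s" using T by (simp add: power2_eq_square)
    finally have 2: "(48 * m * ?T powr s / ?T) * (real k * (2 * m)) \<le> 96 * m\<^sup>2 * ?T powr s" .
    have "real (Suc k) * (144 * m\<^sup>2 * ?T powr s) = real k * (144 * m\<^sup>2 * ?T powr s) + 144 * m\<^sup>2 * ?T powr s"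
      by (simp add: algebra_simps)
    then show "?T powr (1 + s) + real k * (144 * m\<^sup>2 * ?T powr s) + (24 * m * (?T powr s + 1)
        + (48 * m * ?T powr s / ?T) * (real k * (2 * m)))
        \<le> ?T powr (1 + s) + real (Suc k) * (144 * m\<^sup>2 * ?T powr s)"
      using 1 2 by linarith
  qed
  finally show ?case by simp
qed

text \<open>
  The order \<open>n\<^sup>1\<^sup>+\<^sup>s\<close> is that of the central limit theorem. After division by \<open>n\<close> inside the absolute
  value the moment becomes \<open>O(n\<^sup>-\<^sup>1\<^sup>-\<^sup>s)\<close>, which is summable.
\<close>

lemma sum_powr_moment:
  assumes "1 \<le> n"
  shows "(\<integral>\<^sup>+\<omega>. ennreal (\<bar>\<Sum>i<n. X i \<omega>\<bar> powr (2 + 2 * s)) \<partial>M)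
     \<le> ennreal ((1 + 144 * m\<^sup>2) * real n powr (1 + s))"
proof -
  have "(\<integral>\<^sup>+\<omega>. ennreal (\<bar>\<Sum>i<n. X i \<omega>\<bar> powr (2 + 2 * s)) \<partial>M)
      \<le> (\<integral>\<^sup>+\<omega>. ennreal ((real n + (\<Sum>i<n. X i \<omega>)\<^sup>2) powr (1 + s)) \<partial>M)"
  proof (intro nn_integral_mono ennreal_leI)
    fix \<omega>
    have "\<bar>x\<bar> powr (2 + 2 * s) \<le> (real n + x\<^sup>2) powr (1 + s)" for x :: real
    proof (cases "x = 0")
      case False
      have "\<bar>x\<bar> powr (2 + 2 * s) = (\<bar>x\<bar> powr 2) powr (1 + s)"
        unfolding powr_powr by (simp add: algebra_simps)
      also have "\<bar>x\<bar> powr 2 = x\<^sup>2" using False by simp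
      also have "x\<^sup>2 powr (1 + s) \<le> (real n + x\<^sup>2) powr (1 + s)" using s by (intro powr_mono2) auto
      finally show ?thesis .
    qed auto
    then show "\<bar>\<Sum>i<n. X i \<omega>\<bar> powr (2 + 2 * s) \<le> (real n + (\<Sum>i<n. X i \<omega>)\<^sup>2) powr (1 + s)" .
  qed
  also have "\<dots> \<le> ennreal (real n powr (1 + s) + real n * (144 * m\<^sup>2 * real n powr s))"
    by (rule sum_powr_moment_aux) (use assms in auto)
  also have "real n powr (1 + s) + real n * (144 * m\<^sup>2 * real n powr s) = (1 + 144 * m\<^sup>2) * real n powr (1 + s)"
    using assms by (simp add: powr_add algebra_simps)
  finally show ?thesis .
qed

end


section \<open>Quadratic forms\<close>

lemma scalar_prod_self_sum:
  fixes v :: "real vec" assumes "v \<in> carrier_vec n"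
  shows "v \<bullet> v = (\<Sum>i<n. (v $ i)\<^sup>2)"
  using assms by (simp add: scalar_prod_def power2_eq_square atLeast0LessThan)

lemma scalar_prod_self_nonneg: "0 \<le> v \<bullet> (v :: real vec)"
  by (subst scalar_prod_self_sum[OF carrier_vec_dim_vec]) (simp add: sum_nonneg)

lemma scalar_prod_Cauchy_Schwarz:
  fixes v w :: "real vec" assumes "v \<in> carrier_vec n" "w \<in> carrier_vec n"
  shows "(v \<bullet> w)\<^sup>2 \<le> (v \<bullet> v) * (w \<bullet> w)"
  using Cauchy_Schwarz_ineq_sum[of "\<lambda>i. v $ i" "\<lambda>i. w $ i" "{..<n}"] assms
  by (simp add: scalar_prod_self_sum) (simp add: scalar_prod_def atLeast0LessThan)

text \<open>
  Young's inequality with a free parameter \<open>t\<close>; choosing \<open>t\<close> lets one term be absorbed.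
\<close>

lemma scalar_prod_le_squares:
  fixes v w :: "real vec" assumes "v \<in> carrier_vec n" "w \<in> carrier_vec n" and t: "0 < t"
  shows "v \<bullet> w \<le> t * (v \<bullet> v) + (w \<bullet> w) / (4 * t)"
proof -
  have "x * y \<le> t * x\<^sup>2 + y\<^sup>2 / (4 * t)" for x y :: real
  proof -
    have "0 \<le> (2 * t * x - y)\<^sup>2 / (4 * t)" using t by simp
    also have "\<dots> = t * x\<^sup>2 - x * y + y\<^sup>2 / (4 * t)"
      using t by (simp add: power2_diff power2_eq_square field_simps)
    finally show ?thesis by simp
  qed
  then have "(\<Sum>i<n. v $ i * w $ i) \<le> (\<Sum>i<n. t * (v $ i)\<^sup>2 + (w $ i)\<^sup>2 / (4 * t))"
    by (intro sum_mono)
  then show ?thesis using assms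
    by (simp add: scalar_prod_self_sum sum.distrib sum_distrib_left sum_divide_distrib)
       (simp add: scalar_prod_def atLeast0LessThan)
qed

lemma transpose_scalar_prod:
  fixes A :: "real mat"
  assumes "A \<in> carrier_mat m n" "v \<in> carrier_vec n" "w \<in> carrier_vec m"
  shows "(A *\<^sub>v v) \<bullet> w = v \<bullet> (transpose_mat A *\<^sub>v w)"
  using transpose_vec_mult_scalar[OF assms] assms
  by (metis comm_scalar_prod mult_mat_vec_carrier transpose_carrier_mat)

text \<open>
  An operator and its adjoint have the same norm.
\<close>

lemma transpose_op_bound:
  fixes P :: "real mat"
  assumes P: "P \<in> carrier_mat m k" and c: "0 \<le> c"
    and bd: "\<And>v. v \<in> carrier_vec k \<Longrightarrow> (P *\<^sub>v v) \<bullet> (P *\<^sub>v v) \<le> c * (v \<bullet> v)"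
    and w: "w \<in> carrier_vec m"
  shows "(transpose_mat P *\<^sub>v w) \<bullet> (transpose_mat P *\<^sub>v w) \<le> c * (w \<bullet> w)"
proof -
  define z where "z = transpose_mat P *\<^sub>v w"
  have z: "z \<in> carrier_vec k" unfolding z_def using P w by simp
  have Pz: "P *\<^sub>v z \<in> carrier_vec m" using P z by simp
  have "z \<bullet> z = (P *\<^sub>v z) \<bullet> w"
    unfolding transpose_scalar_prod[OF P z w] by (simp add: z_def)
  then have "(z \<bullet> z)\<^sup>2 \<le> ((P *\<^sub>v z) \<bullet> (P *\<^sub>v z)) * (w \<bullet> w)"
    using scalar_prod_Cauchy_Schwarz[OF Pz w] by simp
  also have "\<dots> \<le> (c * (z \<bullet> z)) * (w \<bullet> w)"
    by (intro mult_right_mono bd z scalar_prod_self_nonneg)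
  finally have le: "(z \<bullet> z) * (z \<bullet> z) \<le> (z \<bullet> z) * (c * (w \<bullet> w))" by (simp add: power2_eq_square mult_ac)
  show ?thesis
  proof (cases "z \<bullet> z = 0")
    case True
    then show ?thesis unfolding z_def[symmetric] by (simp add: c scalar_prod_self_nonneg)
  next
    case False
    then have "0 < z \<bullet> z" using scalar_prod_self_nonneg[of z] by simp
    then show ?thesis using le unfolding z_def[symmetric] by simp
  qed
qed

definition col_gram :: "real mat \<Rightarrow> nat \<Rightarrow> nat \<Rightarrow> real" where
  "col_gram P i j = (\<Sum>r<dim_row P. P $$ (r, i) * P $$ (r, j))"

lemma col_gram_scalar_prod:
  assumes "P \<in> carrier_mat m k" "i < k" "j < k"
  shows "col_gram P i j = (P *\<^sub>v unit_vec k i) \<bullet> (P *\<^sub>v unit_vec k j)"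
  using assms by (simp add: col_gram_def scalar_prod_def[of "P *\<^sub>v unit_vec k i"] atLeast0LessThan)

lemma col_gram_sym: "col_gram P i j = col_gram P j i"
  by (simp add: col_gram_def mult.commute)

lemma norm_mult_mat_vec_col_gram:
  assumes P: "P \<in> carrier_mat m k" and v: "v \<in> carrier_vec k"
  shows "(P *\<^sub>v v) \<bullet> (P *\<^sub>v v) = (\<Sum>i<k. \<Sum>j<k. col_gram P i j * v $ i * v $ j)"
proof -
  have "(P *\<^sub>v v) \<bullet> (P *\<^sub>v v) = (\<Sum>r<m. ((P *\<^sub>v v) $ r)\<^sup>2)"
    using P v by (intro scalar_prod_self_sum) simp
  also have "\<dots> = (\<Sum>r<m. \<Sum>i<k. \<Sum>j<k. (P $$ (r, i) * v $ i) * (P $$ (r, j) * v $ j))"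
    using P v by (intro sum.cong refl)
      (auto simp: scalar_prod_def power2_eq_square sum_product atLeast0LessThan)
  also have "\<dots> = (\<Sum>i<k. \<Sum>j<k. \<Sum>r<m. (P $$ (r, i) * v $ i) * (P $$ (r, j) * v $ j))"
    by (subst sum.swap, intro sum.cong refl sum.swap)
  also have "\<dots> = (\<Sum>i<k. \<Sum>j<k. col_gram P i j * v $ i * v $ j)"
    using P by (intro sum.cong refl) (auto simp: col_gram_def sum_distrib_right sum_distrib_left mult_ac)
  finally show ?thesis .
qed

lemma sum_square_split:
  fixes f :: "nat \<Rightarrow> nat \<Rightarrow> real"
  assumes "\<And>i j. f i j = f j i"
  shows "(\<Sum>i<k. \<Sum>j<k. f i j) = (\<Sum>i<k. f i i) + 2 * (\<Sum>j<k. \<Sum>i<j. f i j)"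
proof (induction k)
  case (Suc k)
  have "(\<Sum>i<Suc k. \<Sum>j<Suc k. f i j) = (\<Sum>i<k. \<Sum>j<k. f i j) + (\<Sum>i<k. f i k) + (\<Sum>j<k. f k j) + f k k"
    by (simp add: sum.distrib)
  moreover have "(\<Sum>j<k. f k j) = (\<Sum>i<k. f i k)" by (intro sum.cong refl assms)
  ultimately show ?case using Suc by simp
qed simp

text \<open>
  The two parts concentrate for different reasons: the diagonal one is a sum of independent variables
  when the entries of \<open>v\<close> are independent, the other one is centred.
\<close>

lemma norm_mult_mat_vec_split:
  assumes P: "P \<in> carrier_mat m k" and v: "v \<in> carrier_vec k"
  shows "(P *\<^sub>v v) \<bullet> (P *\<^sub>v v) = (\<Sum>i<k. col_gram P i i * (v $ i)\<^sup>2)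
      + 2 * (\<Sum>j<k. \<Sum>i<j. col_gram P i j * v $ i * v $ j)"
  unfolding norm_mult_mat_vec_col_gram[OF P v]
  by (subst sum_square_split) (auto simp: power2_eq_square mult_ac col_gram_sym)

text \<open>
  A column of \<open>P\<^sup>T P\<close> is the image of a unit vector under an operator of norm at most \<open>c\<close>, so its
  squared norm is at most \<open>c\<^sup>2\<close>. Thus the squared Frobenius norm grows only linearly in \<open>k\<close>.
\<close>

lemma
  fixes P :: "real mat"
  assumes P: "P \<in> carrier_mat m k" and c: "0 \<le> c"
    and bd: "\<And>v. v \<in> carrier_vec k \<Longrightarrow> (P *\<^sub>v v) \<bullet> (P *\<^sub>v v) \<le> c * (v \<bullet> v)"
  shows col_gram_diag_bound: "i < k \<Longrightarrow> col_gram P i i \<le> c"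
    and col_gram_offdiag_bound: "(\<Sum>j<k. \<Sum>i<j. (col_gram P i j)\<^sup>2) \<le> c\<^sup>2 * real k"
proof -
  show diag: "col_gram P i i \<le> c" if i: "i < k" for i
    using bd[of "unit_vec k i"] i by (simp add: col_gram_scalar_prod[OF P])
  have "(\<Sum>i<j. (col_gram P i j)\<^sup>2) \<le> c\<^sup>2" if j: "j < k" for j
  proof -
    let ?w = "P *\<^sub>v unit_vec k j"
    have w: "?w \<in> carrier_vec m" using P by simp
    have *: "(transpose_mat P *\<^sub>v ?w) $ i = col_gram P i j" if "i < k" for i
    proof -
      have "(transpose_mat P *\<^sub>v ?w) $ i = unit_vec k i \<bullet> (transpose_mat P *\<^sub>v ?w)"
        using that P by (subst scalar_prod_left_unit[of _ k]) auto
      also have "\<dots> = col_gram P i j"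
        using that j P by (subst transpose_scalar_prod[OF P _ w, symmetric]) (auto simp: col_gram_scalar_prod[OF P])
      finally show ?thesis .
    qed
    have "(\<Sum>i<j. (col_gram P i j)\<^sup>2) \<le> (\<Sum>i<k. (col_gram P i j)\<^sup>2)"
      using j by (intro sum_mono2) auto
    also have "\<dots> = (transpose_mat P *\<^sub>v ?w) \<bullet> (transpose_mat P *\<^sub>v ?w)"
      using P by (subst scalar_prod_self_sum[of _ k]) (auto simp: * simp del: index_mult_mat_vec)
    also have "\<dots> \<le> c * (?w \<bullet> ?w)" by (rule transpose_op_bound[OF P c bd w])
    also have "\<dots> \<le> c * c"
      using diag[OF j] c by (intro mult_left_mono) (auto simp: col_gram_scalar_prod[OF P j j])
    finally show ?thesis by (simp add: power2_eq_square)
  qed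
  then have "(\<Sum>j<k. \<Sum>i<j. (col_gram P i j)\<^sup>2) \<le> (\<Sum>j<k. c\<^sup>2)" by (intro sum_mono) auto
  then show "(\<Sum>j<k. \<Sum>i<j. (col_gram P i j)\<^sup>2) \<le> c\<^sup>2 * real k" by (simp add: mult.commute)
qed


section \<open>The ridge resolvent\<close>

definition ridge_gram :: "real mat \<Rightarrow> real \<Rightarrow> real mat" where
  "ridge_gram X l = transpose_mat X * X + l \<cdot>\<^sub>m 1\<^sub>m (dim_col X)"

definition resolvent :: "real mat \<Rightarrow> real \<Rightarrow> real mat" where
  "resolvent X l = the (mat_inverse (ridge_gram X l))"

lemma ridge_resolvent: "ridge X y l = resolvent X l *\<^sub>v (transpose_mat X *\<^sub>v y)"
  by (simp add: ridge_def resolvent_def ridge_gram_def)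

context
  fixes X :: "real mat" and n p :: nat and l :: real
  assumes X: "X \<in> carrier_mat n p" and l: "0 < l"
begin

lemma XT: "transpose_mat X \<in> carrier_mat p n" using X by simp

lemma ridge_gram_carrier: "ridge_gram X l \<in> carrier_mat p p"
  using X by (simp add: ridge_gram_def)

lemma ridge_gram_mult_vec:
  assumes "u \<in> carrier_vec p"
  shows "ridge_gram X l *\<^sub>v u = transpose_mat X *\<^sub>v (X *\<^sub>v u) + l \<cdot>\<^sub>v u"
proof -
  have "ridge_gram X l *\<^sub>v u = (transpose_mat X * X) *\<^sub>v u + (l \<cdot>\<^sub>m 1\<^sub>m p) *\<^sub>v u"
    unfolding ridge_gram_def using X assms by (subst add_mult_distrib_mat_vec[of _ p p]) auto
  also have "(transpose_mat X * X) *\<^sub>v u = transpose_mat X *\<^sub>v (X *\<^sub>v u)"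
    using X assms by (intro assoc_mult_mat_vec) auto
  also have "(l \<cdot>\<^sub>m 1\<^sub>m p) *\<^sub>v u = l \<cdot>\<^sub>v u"
    using assms by (intro eq_vecI) auto
  finally show ?thesis .
qed

text \<open>
  Pairing \<open>(X\<^sup>T X + l I) u\<close> with \<open>u\<close> gives the energy identity behind all bounds on the resolvent.
\<close>

lemma ridge_gram_form:
  assumes u: "u \<in> carrier_vec p"
  shows "u \<bullet> (ridge_gram X l *\<^sub>v u) = (X *\<^sub>v u) \<bullet> (X *\<^sub>v u) + l * (u \<bullet> u)"
proof -
  have Xu: "X *\<^sub>v u \<in> carrier_vec n" using X u by simp
  have "u \<bullet> (ridge_gram X l *\<^sub>v u) = u \<bullet> (transpose_mat X *\<^sub>v (X *\<^sub>v u)) + u \<bullet> (l \<cdot>\<^sub>v u)"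
    unfolding ridge_gram_mult_vec[OF u] using u XT Xu by (intro scalar_prod_add_distrib[of _ p]) auto
  then show ?thesis using u by (simp add: transpose_scalar_prod[OF X u Xu])
qed

lemma ridge_gram_det: "det (ridge_gram X l) \<noteq> 0"
proof
  assume "det (ridge_gram X l) = 0"
  then obtain v where v: "v \<in> carrier_vec p" "v \<noteq> 0\<^sub>v p" "ridge_gram X l *\<^sub>v v = 0\<^sub>v p"
    using det_0_iff_vec_prod_zero_field[OF ridge_gram_carrier] by auto
  have "(X *\<^sub>v v) \<bullet> (X *\<^sub>v v) + l * (v \<bullet> v) = 0"
    using ridge_gram_form[OF v(1)] v by simp
  then have "l * (v \<bullet> v) = 0"
    using scalar_prod_self_nonneg[of "X *\<^sub>v v"] scalar_prod_self_nonneg[of v] l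
    by (smt (verit) mult_nonneg_nonneg)
  then have "(\<Sum>i<p. (v $ i)\<^sup>2) = 0" using l by (simp add: scalar_prod_self_sum[OF v(1)])
  then have "\<forall>i<p. v $ i = 0" by (subst (asm) sum_nonneg_eq_0_iff) auto
  then have "v = 0\<^sub>v p" using v(1) by (intro eq_vecI) auto
  with v show False by simp
qed

lemma
  shows resolvent_carrier: "resolvent X l \<in> carrier_mat p p"
    and ridge_gram_mult_resolvent: "ridge_gram X l * resolvent X l = 1\<^sub>m p"
    and resolvent_mult_ridge_gram: "resolvent X l * ridge_gram X l = 1\<^sub>m p"
proof -
  note K = ridge_gram_carrier
  have "ridge_gram X l \<in> Units (ring_mat TYPE(real) p undefined)"
    by (rule det_non_zero_imp_unit[OF K ridge_gram_det])
  then obtain B where B: "mat_inverse (ridge_gram X l) = Some B"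
    using mat_inverse(1)[OF K, of undefined] by (cases "mat_inverse (ridge_gram X l)") auto
  with mat_inverse(2)[OF K B] show "resolvent X l \<in> carrier_mat p p"
    "ridge_gram X l * resolvent X l = 1\<^sub>m p" "resolvent X l * ridge_gram X l = 1\<^sub>m p"
    by (auto simp: resolvent_def)
qed

lemma resolvent_unique:
  assumes B: "B \<in> carrier_mat p p" "ridge_gram X l * B = 1\<^sub>m p"
  shows "resolvent X l = B"
proof -
  have "resolvent X l = resolvent X l * (ridge_gram X l * B)"
    using B resolvent_carrier by simp
  also have "\<dots> = (resolvent X l * ridge_gram X l) * B"
    using B resolvent_carrier ridge_gram_carrier by (intro assoc_mult_mat[symmetric]) auto
  also have "\<dots> = B" using B by (simp add: resolvent_mult_ridge_gram)
  finally show ?thesis .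
qed

lemma ridge_gram_resolvent_vec:
  assumes v: "v \<in> carrier_vec p" shows "ridge_gram X l *\<^sub>v (resolvent X l *\<^sub>v v) = v"
  using assoc_mult_mat_vec[OF ridge_gram_carrier resolvent_carrier v] v
  by (simp add: ridge_gram_mult_resolvent)

lemma resolvent_ridge_gram_vec:
  assumes v: "v \<in> carrier_vec p" shows "resolvent X l *\<^sub>v (ridge_gram X l *\<^sub>v v) = v"
  using assoc_mult_mat_vec[OF resolvent_carrier ridge_gram_carrier v] v
  by (simp add: resolvent_mult_ridge_gram)

lemma resolvent_bound:
  assumes v: "v \<in> carrier_vec p"
  shows "l\<^sup>2 * ((resolvent X l *\<^sub>v v) \<bullet> (resolvent X l *\<^sub>v v)) \<le> v \<bullet> v"
proof -
  define u where "u = resolvent X l *\<^sub>v v"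
  have u: "u \<in> carrier_vec p" unfolding u_def using resolvent_carrier v by simp
  have "(X *\<^sub>v u) \<bullet> (X *\<^sub>v u) + l * (u \<bullet> u) = u \<bullet> v"
    using ridge_gram_form[OF u] ridge_gram_resolvent_vec[OF v] by (simp add: u_def)
  also have "\<dots> \<le> (l / 2) * (u \<bullet> u) + (v \<bullet> v) / (4 * (l / 2))"
    using l by (intro scalar_prod_le_squares[OF u v]) auto
  finally have "l * (u \<bullet> u) \<le> (l / 2) * (u \<bullet> u) + (v \<bullet> v) / (2 * l)"
    using scalar_prod_self_nonneg[of "X *\<^sub>v u"] by simp
  then have "(l / 2) * (u \<bullet> u) \<le> (v \<bullet> v) / (2 * l)" by (simp add: field_simps)
  then have "(2 * l) * ((l / 2) * (u \<bullet> u)) \<le> (2 * l) * ((v \<bullet> v) / (2 * l))"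
    using l by (intro mult_left_mono) auto
  then show ?thesis using l by (simp add: u_def power2_eq_square)
qed

text \<open>
  In singular values: \<open>d / (d\<^sup>2 + l) \<le> 1 / (2 sqrt l)\<close>, whatever the size of \<open>d\<close>. The proof applies the
  energy identity to \<open>u = G X\<^sup>T e\<close> and absorbs \<open>|X u|\<^sup>2\<close>.
\<close>

lemma resolvent_transpose_bound:
  assumes e: "e \<in> carrier_vec n"
  shows "((resolvent X l * transpose_mat X) *\<^sub>v e) \<bullet> ((resolvent X l * transpose_mat X) *\<^sub>v e)
    \<le> 1 / (4 * l) * (e \<bullet> e)"
proof -
  define u where "u = (resolvent X l * transpose_mat X) *\<^sub>v e"
  have u_eq: "u = resolvent X l *\<^sub>v (transpose_mat X *\<^sub>v e)"
    unfolding u_def using resolvent_carrier XT e by (intro assoc_mult_mat_vec) auto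
  have Xe: "transpose_mat X *\<^sub>v e \<in> carrier_vec p" using XT e by simp
  have u: "u \<in> carrier_vec p" unfolding u_eq using resolvent_carrier Xe by simp
  have Xu: "X *\<^sub>v u \<in> carrier_vec n" using X u by simp
  have "(X *\<^sub>v u) \<bullet> (X *\<^sub>v u) + l * (u \<bullet> u) = u \<bullet> (transpose_mat X *\<^sub>v e)"
    using ridge_gram_form[OF u] ridge_gram_resolvent_vec[OF Xe] by (simp add: u_eq)
  also have "\<dots> = (X *\<^sub>v u) \<bullet> e" by (rule transpose_scalar_prod[OF X u e, symmetric])
  also have "\<dots> \<le> 1 * ((X *\<^sub>v u) \<bullet> (X *\<^sub>v u)) + (e \<bullet> e) / (4 * 1)"
    by (intro scalar_prod_le_squares[OF Xu e]) auto
  finally have "l * (u \<bullet> u) \<le> (e \<bullet> e) / 4" by simp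
  then show ?thesis using l by (simp add: u_def field_simps)
qed

text \<open>
  Replacing \<open>X\<^sup>T X\<close> by \<open>(X\<^sup>T X + l I) - l I\<close> in the signal part leaves \<open>\<beta> - l G \<beta>\<close>.
\<close>

lemma ridge_error:
  assumes b: "b \<in> carrier_vec p" and e: "e \<in> carrier_vec n"
  shows "ridge X (X *\<^sub>v b + e) l - b
    = (resolvent X l * transpose_mat X) *\<^sub>v e - (l \<cdot>\<^sub>m resolvent X l) *\<^sub>v b"
proof -
  let ?G = "resolvent X l" and ?Xt = "transpose_mat X"
  have Xb: "X *\<^sub>v b \<in> carrier_vec n" using X b by simp
  have c1: "?Xt *\<^sub>v (X *\<^sub>v b) \<in> carrier_vec p" "?Xt *\<^sub>v e \<in> carrier_vec p" using XT Xb e by auto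
  have c2: "?G *\<^sub>v (?Xt *\<^sub>v (X *\<^sub>v b)) \<in> carrier_vec p" "?G *\<^sub>v (?Xt *\<^sub>v e) \<in> carrier_vec p" "?G *\<^sub>v b \<in> carrier_vec p"
    by (rule mult_mat_vec_carrier[OF resolvent_carrier c1(1)],
        rule mult_mat_vec_carrier[OF resolvent_carrier c1(2)],
        rule mult_mat_vec_carrier[OF resolvent_carrier b])
  have "b = ?G *\<^sub>v (?Xt *\<^sub>v (X *\<^sub>v b) + l \<cdot>\<^sub>v b)"
    using resolvent_ridge_gram_vec[OF b] ridge_gram_mult_vec[OF b] by simp
  also have "\<dots> = ?G *\<^sub>v (?Xt *\<^sub>v (X *\<^sub>v b)) + ?G *\<^sub>v (l \<cdot>\<^sub>v b)"
    using c1 b by (intro mult_add_distrib_mat_vec[OF resolvent_carrier]) auto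
  also have "?G *\<^sub>v (l \<cdot>\<^sub>v b) = l \<cdot>\<^sub>v (?G *\<^sub>v b)"
    by (rule mult_mat_vec[OF resolvent_carrier b])
  finally have b_eq: "b = ?G *\<^sub>v (?Xt *\<^sub>v (X *\<^sub>v b)) + l \<cdot>\<^sub>v (?G *\<^sub>v b)" .
  have "ridge X (X *\<^sub>v b + e) l = ?G *\<^sub>v (?Xt *\<^sub>v (X *\<^sub>v b) + ?Xt *\<^sub>v e)"
    unfolding ridge_resolvent using Xb e XT by (simp add: mult_add_distrib_mat_vec[of _ p n])
  also have "\<dots> = ?G *\<^sub>v (?Xt *\<^sub>v (X *\<^sub>v b)) + ?G *\<^sub>v (?Xt *\<^sub>v e)"
    using c1 by (intro mult_add_distrib_mat_vec[OF resolvent_carrier]) auto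
  finally have r_eq: "ridge X (X *\<^sub>v b + e) l = ?G *\<^sub>v (?Xt *\<^sub>v (X *\<^sub>v b)) + ?G *\<^sub>v (?Xt *\<^sub>v e)" .
  have s_eq: "(l \<cdot>\<^sub>m ?G) *\<^sub>v b = l \<cdot>\<^sub>v (?G *\<^sub>v b)"
    using resolvent_carrier b by (intro eq_vecI) (auto simp: carrier_matD)
  have t_eq: "(?G * ?Xt) *\<^sub>v e = ?G *\<^sub>v (?Xt *\<^sub>v e)"
    using resolvent_carrier XT e by (intro assoc_mult_mat_vec) auto
  show ?thesis
  proof (rule eq_vecI)
    fix i assume "i < dim_vec ((?G * ?Xt) *\<^sub>v e - (l \<cdot>\<^sub>m ?G) *\<^sub>v b)"
    then have i: "i < p" using resolvent_carrier by (simp add: carrier_matD)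
    have "b $ i = (?G *\<^sub>v (?Xt *\<^sub>v (X *\<^sub>v b))) $ i + l * (?G *\<^sub>v b) $ i"
      using i c2 by (subst b_eq) (simp add: carrier_matD[OF resolvent_carrier] del: index_mult_mat_vec)
    then show "(ridge X (X *\<^sub>v b + e) l - b) $ i = ((?G * ?Xt) *\<^sub>v e - (l \<cdot>\<^sub>m ?G) *\<^sub>v b) $ i"
      unfolding r_eq s_eq t_eq using i c2 b
      by (simp add: carrier_matD[OF resolvent_carrier] del: index_mult_mat_vec)
  qed (use b resolvent_carrier in \<open>simp add: carrier_matD\<close>)
qed

end


section \<open>Orthogonal matrices and the Frobenius norm\<close>

lemma is_orthogonal_norm:
  assumes O: "is_orthogonal n U" and v: "v \<in> carrier_vec n"
  shows "(U *\<^sub>v v) \<bullet> (U *\<^sub>v v) = v \<bullet> v"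
proof -
  have U: "U \<in> carrier_mat n n" and UU: "transpose_mat U * U = 1\<^sub>m n" using O by (auto simp: is_orthogonal_def)
  have Uv: "U *\<^sub>v v \<in> carrier_vec n" using U v by simp
  have "transpose_mat U *\<^sub>v (U *\<^sub>v v) = v"
    using assoc_mult_mat_vec[of "transpose_mat U" n n U n v] U v UU by simp
  then show ?thesis by (simp add: transpose_scalar_prod[OF U v Uv])
qed

lemma is_orthogonal_right_inverse:
  assumes "is_orthogonal n U"
  shows "U * transpose_mat U = 1\<^sub>m n"
  using assms mat_mult_left_right_inverse[of "transpose_mat U" n U] by (auto simp: is_orthogonal_def)

lemma is_orthogonal_transpose:
  assumes "is_orthogonal n U"
  shows "is_orthogonal n (transpose_mat U)"
  using assms is_orthogonal_right_inverse[OF assms] by (auto simp: is_orthogonal_def)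

definition frob2 :: "real mat \<Rightarrow> real" where
  "frob2 A = (\<Sum>j<dim_col A. \<Sum>i<dim_row A. (A $$ (i, j))\<^sup>2)"

lemma frob2_transpose: "frob2 (transpose_mat A) = frob2 A"
  unfolding frob2_def by (subst sum.swap) auto

lemma frob2_cols:
  "frob2 A = (\<Sum>j<dim_col A. col A j \<bullet> col A j)"
  by (auto simp: frob2_def scalar_prod_self_sum[of _ "dim_row A"] intro!: sum.cong)

lemma frob2_orthogonal_left:
  assumes O: "is_orthogonal n U" and A: "A \<in> carrier_mat n k"
  shows "frob2 (U * A) = frob2 A"
proof -
  have U: "U \<in> carrier_mat n n" using O by (auto simp: is_orthogonal_def)
  have "col (U * A) j \<bullet> col (U * A) j = col A j \<bullet> col A j" if "j < k" for j
  proof -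
    have "col (U * A) j = U *\<^sub>v col A j" using U A that by (intro eq_vecI) auto
    then show ?thesis using is_orthogonal_norm[OF O, of "col A j"] A that by simp
  qed
  then show ?thesis unfolding frob2_cols using A by simp
qed

lemma frob2_orthogonal_right:
  assumes O: "is_orthogonal k U" and A: "A \<in> carrier_mat n k"
  shows "frob2 (A * U) = frob2 A"
proof -
  have U: "U \<in> carrier_mat k k" using O by (auto simp: is_orthogonal_def)
  have "frob2 (A * U) = frob2 (transpose_mat U * transpose_mat A)"
    using transpose_mult[OF A U] frob2_transpose[of "A * U"] by simp
  also have "\<dots> = frob2 (transpose_mat A)"
    using A by (intro frob2_orthogonal_left[OF is_orthogonal_transpose[OF O]]) simp
  finally show ?thesis by (simp add: frob2_transpose)
qed

lemma mat_trace_transpose_mult: "mat_trace (transpose_mat A * A) = frob2 A"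
  by (auto simp: mat_trace_def frob2_cols intro!: sum.cong)

lemma sum_col_gram_frob2: "P \<in> carrier_mat m k \<Longrightarrow> (\<Sum>i<k. col_gram P i i) = frob2 P"
  by (simp add: frob2_def col_gram_def power2_eq_square)

text \<open>
  Unless the vectors agree, take the Householder reflection in the hyperplane orthogonal to \<open>v - w\<close>.
\<close>

lemma exists_orthogonal_mapping:
  fixes v w :: "real vec"
  assumes v: "v \<in> carrier_vec p" and w: "w \<in> carrier_vec p" and eq: "v \<bullet> v = w \<bullet> w"
  shows "\<exists>U. is_orthogonal p U \<and> U *\<^sub>v v = w"
proof (cases "v = w")
  case True
  then show ?thesis using v by (intro exI[of _ "1\<^sub>m p"]) (simp add: is_orthogonal_def)
next
  case False
  define d where "d = (\<lambda>i. v $ i - w $ i)"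
  define D where "D = (\<Sum>i<p. (d i)\<^sup>2)"
  have D0: "D \<noteq> 0"
  proof
    assume "D = 0"
    then have "\<forall>i<p. d i = 0" unfolding D_def by (subst (asm) sum_nonneg_eq_0_iff) auto
    then have "v = w" using v w by (intro eq_vecI) (auto simp: d_def)
    with False show False by simp
  qed
  have "(\<Sum>i<p. (v $ i)\<^sup>2) = (\<Sum>i<p. (w $ i)\<^sup>2)"
    using eq v w by (simp add: scalar_prod_self_sum)
  moreover have "D = (\<Sum>i<p. (v $ i)\<^sup>2) + (\<Sum>i<p. (w $ i)\<^sup>2) - 2 * (\<Sum>i<p. v $ i * w $ i)"
    by (simp add: D_def d_def power2_diff sum.distrib sum_subtractf sum_distrib_left mult.assoc)
  moreover have dv: "(\<Sum>i<p. d i * v $ i) = (\<Sum>i<p. (v $ i)\<^sup>2) - (\<Sum>i<p. v $ i * w $ i)"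
    by (simp add: d_def algebra_simps sum_subtractf power2_eq_square)
  ultimately have dv: "(\<Sum>i<p. d i * v $ i) = D / 2" by simp
  define U where "U = mat p p (\<lambda>(i, j). (if i = j then 1 else 0) - (2 / D) * d i * d j)"
  have U: "U \<in> carrier_mat p p" by (simp add: U_def)
  have "U *\<^sub>v v = w"
  proof (rule eq_vecI)
    fix i assume "i < dim_vec w"
    then have i: "i < p" using w by simp
    have "(U *\<^sub>v v) $ i = (\<Sum>j<p. ((if i = j then 1 else 0) - (2 / D) * d i * d j) * v $ j)"
      using i v by (simp add: U_def scalar_prod_def atLeast0LessThan)
    also have "\<dots> = (\<Sum>j<p. (if i = j then v $ j else 0)) - (2 / D) * d i * (\<Sum>j<p. d j * v $ j)"
      unfolding sum_distrib_left sum_subtractf[symmetric]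
      by (intro sum.cong refl) (simp add: left_diff_distrib mult.assoc)
    also have "\<dots> = v $ i - d i" using i D0 unfolding dv by simp
    finally show "(U *\<^sub>v v) $ i = w $ i" by (simp add: d_def)
  qed (use w in \<open>simp add: U_def\<close>)
  moreover have "transpose_mat U * U = 1\<^sub>m p"
  proof (rule eq_matI)
    fix i j assume "i < dim_row (1\<^sub>m p :: real mat)" "j < dim_col (1\<^sub>m p :: real mat)"
    then have i: "i < p" and j: "j < p" by auto
    have "(transpose_mat U * U) $$ (i, j) = (\<Sum>k<p. U $$ (k, i) * U $$ (k, j))"
      using i j U by (simp add: scalar_prod_def atLeast0LessThan)
    also have "\<dots> = (\<Sum>k<p. (if k = i then (if k = j then 1 else 0) else 0)
        - (if k = i then (2 / D) * d k * d j else 0) - (if k = j then (2 / D) * d k * d i else 0)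
        + (2 / D)\<^sup>2 * d i * d j * (d k)\<^sup>2)"
      using i j by (intro sum.cong refl) (auto simp: U_def power2_eq_square algebra_simps)
    also have "\<dots> = (if i = j then 1 else 0) - (2 / D) * d i * d j - (2 / D) * d j * d i
        + (2 / D)\<^sup>2 * d i * d j * D"
      using i j by (simp add: sum.distrib sum_subtractf D_def sum_distrib_left)
    also have "\<dots> = (if i = j then 1 else 0)"
      using D0 by (simp add: power2_eq_square field_simps)
    finally show "(transpose_mat U * U) $$ (i, j) = 1\<^sub>m p $$ (i, j)" using i j by simp
  qed (use U in auto)
  ultimately show ?thesis using U by (auto simp: is_orthogonal_def)
qed


section \<open>Singular values of the resolvent\<close>

lemma resolvent_rotate:
  assumes X: "X \<in> carrier_mat n p" and l: "0 < l" and O: "is_orthogonal p U"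
  shows "resolvent (X * U) l = transpose_mat U * resolvent X l * U"
proof -
  have U: "U \<in> carrier_mat p p" and UU: "U * transpose_mat U = 1\<^sub>m p" and UU': "transpose_mat U * U = 1\<^sub>m p"
    using O is_orthogonal_right_inverse[OF O] by (auto simp: is_orthogonal_def)
  have XU: "X * U \<in> carrier_mat n p" using X U by simp
  note K = ridge_gram_carrier[OF X l] and G = resolvent_carrier[OF X l]
  have Ut: "transpose_mat U \<in> carrier_mat p p" using U by simp
  have S: "transpose_mat X * X \<in> carrier_mat p p" using X by simp
  have K': "ridge_gram (X * U) l = transpose_mat U * ridge_gram X l * U"
  proof -
    have "transpose_mat U * ridge_gram X l * U = transpose_mat U * ((transpose_mat X * X) * U + (l \<cdot>\<^sub>m 1\<^sub>m p) * U)"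
      unfolding ridge_gram_def using X U Ut S
      by (subst assoc_mult_mat[of _ p p _ p _ p]) (auto simp: add_mult_distrib_mat[of _ p p])
    also have "\<dots> = transpose_mat U * ((transpose_mat X * X) * U) + transpose_mat U * ((l \<cdot>\<^sub>m 1\<^sub>m p) * U)"
      using U Ut S by (intro mult_add_distrib_mat[of _ p p _ p]) auto
    also have "transpose_mat U * ((l \<cdot>\<^sub>m 1\<^sub>m p) * U) = l \<cdot>\<^sub>m 1\<^sub>m p"
    proof -
      have "(l \<cdot>\<^sub>m 1\<^sub>m p) * U = l \<cdot>\<^sub>m U" using U by (simp add: mult_smult_assoc_mat[of _ p p])
      then show ?thesis using U Ut UU' by (simp add: mult_smult_distrib[of _ p p])
    qed
    also have "transpose_mat U * ((transpose_mat X * X) * U) = transpose_mat (X * U) * (X * U)"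
      using X U Ut S by (simp add: transpose_mult[OF X U] assoc_mult_mat[of _ p n _ p _ p]
          assoc_mult_mat[of _ p p _ n _ p])
    finally show ?thesis unfolding ridge_gram_def using X U by simp
  qed
  show ?thesis
  proof (rule resolvent_unique[OF XU l])
    show "transpose_mat U * resolvent X l * U \<in> carrier_mat p p" using U G by simp
    have UtK: "transpose_mat U * ridge_gram X l \<in> carrier_mat p p" using Ut K by simp
    have GU: "resolvent X l * U \<in> carrier_mat p p" using G U by simp
    have "(transpose_mat U * ridge_gram X l * U) * (transpose_mat U * resolvent X l * U)
        = (transpose_mat U * ridge_gram X l) * (U * (transpose_mat U * (resolvent X l * U)))"
      using U Ut K G UtK GU by (simp add: assoc_mult_mat[of _ p p _ p _ p])
    also have "U * (transpose_mat U * (resolvent X l * U)) = (U * transpose_mat U) * (resolvent X l * U)"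
      using U Ut GU by (intro assoc_mult_mat[symmetric]) auto
    also have "\<dots> = resolvent X l * U" unfolding UU by (rule left_mult_one_mat[OF GU])
    also have "(transpose_mat U * ridge_gram X l) * (resolvent X l * U)
        = transpose_mat U * ((ridge_gram X l * resolvent X l) * U)"
      using U Ut K G GU by (simp add: assoc_mult_mat[of _ p p _ p _ p])
    also have "\<dots> = 1\<^sub>m p" using ridge_gram_mult_resolvent[OF X l] U UU' by simp
    finally show "ridge_gram (X * U) l * (transpose_mat U * resolvent X l * U) = 1\<^sub>m p"
      unfolding K' .
  qed
qed

lemma diag_gram:
  assumes D: "D \<in> carrier_mat n p" and diag: "diagonal_mat D" and i: "i < p" and j: "j < p"
  shows "(transpose_mat D * D) $$ (i, j) = (if i = j then (diag_ext D i)\<^sup>2 else 0)"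
proof -
  have Dij: "D $$ (k, i) = (if k = i then diag_ext D i else 0)" if "k < n" "i < p" for k i
    using that D diag unfolding diagonal_mat_def diag_ext_def by auto
  have "(transpose_mat D * D) $$ (i, j) = (\<Sum>k<n. D $$ (k, i) * D $$ (k, j))"
    using D i j by (simp add: scalar_prod_def atLeast0LessThan)
  also have "\<dots> = (\<Sum>k<n. if k = i then (if i = j then (diag_ext D i)\<^sup>2 else 0) else 0)"
    using i j by (intro sum.cong refl) (auto simp: Dij power2_eq_square)
  also have "\<dots> = (if i < n then (if i = j then (diag_ext D i)\<^sup>2 else 0) else 0)" by simp
  also have "\<dots> = (if i = j then (diag_ext D i)\<^sup>2 else 0)"
    using D by (auto simp: diag_ext_def)
  finally show ?thesis .
qed

text \<open>
  For a rectangular diagonal matrix, \<open>diag_ext\<close> supplies the value 0 in the columns beyond the last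
  diagonal entry, where the resolvent is \<open>1 / l\<close>.
\<close>

lemma resolvent_diag:
  assumes D: "D \<in> carrier_mat n p" and diag: "diagonal_mat D" and l: "0 < l"
  shows "resolvent D l = mat p p (\<lambda>(i, j). if i = j then 1 / ((diag_ext D i)\<^sup>2 + l) else 0)"
proof (rule resolvent_unique[OF D l])
  let ?E = "mat p p (\<lambda>(i, j). if i = j then 1 / ((diag_ext D i)\<^sup>2 + l) else 0)"
  have K: "ridge_gram D l $$ (i, j) = (if i = j then (diag_ext D i)\<^sup>2 + l else 0)" if "i < p" "j < p" for i j
    using diag_gram[OF D diag that] that D unfolding ridge_gram_def by (auto simp del: index_mult_mat(1))
  note Kc = ridge_gram_carrier[OF D l]
  show "ridge_gram D l * ?E = 1\<^sub>m p"
  proof (rule eq_matI)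
    fix i j assume "i < dim_row (1\<^sub>m p :: real mat)" "j < dim_col (1\<^sub>m p :: real mat)"
    then have i: "i < p" and j: "j < p" by auto
    have "(ridge_gram D l * ?E) $$ (i, j) = (\<Sum>k<p. ridge_gram D l $$ (i, k) * ?E $$ (k, j))"
      using i j Kc by (simp add: scalar_prod_def atLeast0LessThan)
    also have "\<dots> = (\<Sum>k<p. if k = i then (if i = j then 1 else 0) else 0)"
    proof (intro sum.cong refl)
      fix k assume "k \<in> {..<p}"
      moreover have "(diag_ext D i)\<^sup>2 + l \<noteq> 0" for i using l by (smt (verit) zero_le_power2)
      ultimately show "ridge_gram D l $$ (i, k) * ?E $$ (k, j) = (if k = i then (if i = j then 1 else 0) else 0)"
        using i j by (auto simp: K)
    qed
    also have "\<dots> = 1\<^sub>m p $$ (i, j)" using i j by simp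
    finally show "(ridge_gram D l * ?E) $$ (i, j) = 1\<^sub>m p $$ (i, j)" .
  qed (use Kc in auto)
qed simp

lemma resolvent_left_orthogonal:
  assumes O: "is_orthogonal n U" and X: "X \<in> carrier_mat n p"
  shows "resolvent (U * X) l = resolvent X l"
proof -
  have U: "U \<in> carrier_mat n n" and UU: "transpose_mat U * U = 1\<^sub>m n" using O by (auto simp: is_orthogonal_def)
  have "transpose_mat (U * X) * (U * X) = transpose_mat X * (transpose_mat U * U) * X"
    using U X by (simp add: transpose_mult[OF U X] assoc_mult_mat[of _ p n _ n _ p] assoc_mult_mat[of _ n n _ n _ p])
  also have "\<dots> = transpose_mat X * X" using X UU by simp
  finally show ?thesis using U X by (simp add: resolvent_def ridge_gram_def)
qed

text \<open>
  In a singular value decomposition the left orthogonal factor drops out of \<open>X\<^sup>T X\<close> and the right one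
  conjugates the resolvent. Frobenius norms do not change under either, so the diagonal factor decides.
\<close>

lemma frob2_svd_resolvent:
  assumes svd: "is_svd n p X Q D V" and l: "0 < l"
  shows "frob2 (l \<cdot>\<^sub>m resolvent X l) = (\<Sum>i<p. l\<^sup>2 / ((diag_ext D i)\<^sup>2 + l)\<^sup>2)"
    and "frob2 (resolvent X l * transpose_mat X) = (\<Sum>i<p. (diag_ext D i)\<^sup>2 / ((diag_ext D i)\<^sup>2 + l)\<^sup>2)"
proof -
  have Q: "is_orthogonal n Q" and V: "is_orthogonal p V" and D: "D \<in> carrier_mat n p"
    and diag: "diagonal_mat D" and X: "X = transpose_mat Q * D * V"
    using svd by (auto simp: is_svd_def)
  have Vc: "V \<in> carrier_mat p p" and VV: "transpose_mat V * V = 1\<^sub>m p" and VV': "V * transpose_mat V = 1\<^sub>m p"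
    using V is_orthogonal_right_inverse[OF V] by (auto simp: is_orthogonal_def)
  have Qc: "Q \<in> carrier_mat n n" using Q by (auto simp: is_orthogonal_def)
  have QD: "transpose_mat Q * D \<in> carrier_mat n p" using Qc D by simp
  define E where "E = resolvent D l"
  have E: "E = mat p p (\<lambda>(i, j). if i = j then 1 / ((diag_ext D i)\<^sup>2 + l) else 0)"
    unfolding E_def by (rule resolvent_diag[OF D diag l])
  have Ec: "E \<in> carrier_mat p p" by (simp add: E)
  have "resolvent X l = transpose_mat V * resolvent (transpose_mat Q * D) l * V"
    unfolding X by (rule resolvent_rotate[OF QD l V])
  also have "resolvent (transpose_mat Q * D) l = E"
    unfolding E_def by (rule resolvent_left_orthogonal[OF is_orthogonal_transpose[OF Q] D])
  finally have G: "resolvent X l = transpose_mat V * E * V" .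
  have Vt: "is_orthogonal p (transpose_mat V)" by (rule is_orthogonal_transpose[OF V])
  have "frob2 (resolvent X l) = frob2 E"
    unfolding G using Ec Vc frob2_orthogonal_right[OF V, of "transpose_mat V * E" p]
      frob2_orthogonal_left[OF Vt Ec] by simp
  moreover have "frob2 (l \<cdot>\<^sub>m resolvent X l) = l\<^sup>2 * frob2 (resolvent X l)"
    unfolding frob2_def sum_distrib_left by (auto simp: power_mult_distrib intro!: sum.cong)
  moreover have "frob2 E = (\<Sum>i<p. 1 / ((diag_ext D i)\<^sup>2 + l)\<^sup>2)"
  proof -
    have "frob2 E = (\<Sum>j<p. \<Sum>i<p. if i = j then (1 / ((diag_ext D i)\<^sup>2 + l))\<^sup>2 else 0)"
      unfolding frob2_def using Ec by (auto simp: E if_distrib[of "\<lambda>x. x\<^sup>2"] cong: if_cong)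
    then show ?thesis by (simp add: power_divide)
  qed
  ultimately show "frob2 (l \<cdot>\<^sub>m resolvent X l) = (\<Sum>i<p. l\<^sup>2 / ((diag_ext D i)\<^sup>2 + l)\<^sup>2)"
    by (simp add: sum_distrib_left)
  have Dt: "transpose_mat D \<in> carrier_mat p n" using D by simp
  have EDt: "E * transpose_mat D \<in> carrier_mat p n" using Ec Dt by simp
  have "transpose_mat X = transpose_mat V * (transpose_mat D * Q)"
    unfolding X using transpose_mult[OF QD Vc] transpose_mult[of "transpose_mat Q" n n D p] Qc D by simp
  then have "resolvent X l * transpose_mat X = (transpose_mat V * E * V) * (transpose_mat V * (transpose_mat D * Q))"
    unfolding G by simp
  also have "\<dots> = (transpose_mat V * E) * ((V * transpose_mat V) * (transpose_mat D * Q))"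
    using Vc Ec Dt Qc by (simp add: assoc_mult_mat[of _ p p _ p _ n] assoc_mult_mat[of _ p p _ p _ p])
  also have "\<dots> = transpose_mat V * ((E * transpose_mat D) * Q)"
    unfolding VV' using Vc Ec Dt Qc
    by (simp add: assoc_mult_mat[of _ p p _ p _ n] assoc_mult_mat[of _ p p _ n _ n])
  finally have "frob2 (resolvent X l * transpose_mat X) = frob2 (transpose_mat V * ((E * transpose_mat D) * Q))"
    by simp
  also have "\<dots> = frob2 ((E * transpose_mat D) * Q)"
    using EDt Qc by (intro frob2_orthogonal_left[OF Vt, of _ n]) simp
  also have "\<dots> = frob2 (E * transpose_mat D)" by (rule frob2_orthogonal_right[OF Q EDt])
  also have "\<dots> = frob2 (transpose_mat (E * transpose_mat D))" by (simp add: frob2_transpose)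
  also have "\<dots> = (\<Sum>j<p. \<Sum>i<n. (E * transpose_mat D) $$ (j, i) ^ 2)"
    using Ec D by (auto simp: frob2_def intro: sum.swap)
  also have "\<dots> = (\<Sum>j<p. \<Sum>i<n. (1 / ((diag_ext D j)\<^sup>2 + l))\<^sup>2 * (D $$ (i, j))\<^sup>2)"
  proof (intro sum.cong refl)
    fix j i assume "j \<in> {..<p}" "i \<in> {..<n}"
    then have j: "j < p" and i: "i < n" by auto
    have "(E * transpose_mat D) $$ (j, i) = (\<Sum>k<p. E $$ (j, k) * D $$ (i, k))"
      using i j Ec D by (simp add: scalar_prod_def atLeast0LessThan)
    also have "\<dots> = (\<Sum>k<p. if k = j then (1 / ((diag_ext D j)\<^sup>2 + l)) * D $$ (i, j) else 0)"
      using j by (intro sum.cong refl) (auto simp: E)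
    finally show "(E * transpose_mat D) $$ (j, i) ^ 2 = (1 / ((diag_ext D j)\<^sup>2 + l))\<^sup>2 * (D $$ (i, j))\<^sup>2"
      using j by (simp add: power_mult_distrib power_divide)
  qed
  also have "\<dots> = (\<Sum>j<p. (diag_ext D j)\<^sup>2 / ((diag_ext D j)\<^sup>2 + l)\<^sup>2)"
  proof (intro sum.cong refl)
    fix j assume "j \<in> {..<p}"
    then have "(\<Sum>i<n. (D $$ (i, j))\<^sup>2) = (diag_ext D j)\<^sup>2"
      using diag_gram[OF D diag, of j j] D by (simp add: scalar_prod_def atLeast0LessThan power2_eq_square)
    then show "(\<Sum>i<n. (1 / ((diag_ext D j)\<^sup>2 + l))\<^sup>2 * (D $$ (i, j))\<^sup>2) = (diag_ext D j)\<^sup>2 / ((diag_ext D j)\<^sup>2 + l)\<^sup>2"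
      unfolding sum_distrib_left[symmetric] by (simp add: power_divide)
  qed
  finally show "frob2 (resolvent X l * transpose_mat X) = (\<Sum>i<p. (diag_ext D i)\<^sup>2 / ((diag_ext D i)\<^sup>2 + l)\<^sup>2)" .
qed


section \<open>Measurability\<close>

lemma space_borel_mat: "space (borel_mat n p) = carrier_mat n p"
  by (simp add: borel_mat_def)

lemma space_borel_vec: "space (borel_vec n) = carrier_vec n"
  by (simp add: borel_vec_def)

lemma measurable_borel_matI:
  assumes "\<And>\<omega>. \<omega> \<in> space N \<Longrightarrow> f \<omega> \<in> carrier_mat n p"
    and "\<And>i j. i < n \<Longrightarrow> j < p \<Longrightarrow> (\<lambda>\<omega>. f \<omega> $$ (i, j)) \<in> borel_measurable N"
  shows "f \<in> measurable N (borel_mat n p)"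
  unfolding borel_mat_def
  by (rule measurable_vimage_algebra2) (use assms in \<open>auto intro!: measurable_restrict\<close>)

lemma measurable_borel_vecI:
  assumes "\<And>\<omega>. \<omega> \<in> space N \<Longrightarrow> f \<omega> \<in> carrier_vec n"
    and "\<And>i. i < n \<Longrightarrow> (\<lambda>\<omega>. f \<omega> $ i) \<in> borel_measurable N"
  shows "f \<in> measurable N (borel_vec n)"
  unfolding borel_vec_def
  by (rule measurable_vimage_algebra2) (use assms in \<open>auto intro!: measurable_restrict\<close>)

lemma measurable_mat_entry:
  assumes f: "f \<in> measurable N (borel_mat n p)" and ij: "i < n" "j < p"
  shows "(\<lambda>\<omega>. f \<omega> $$ (i, j)) \<in> borel_measurable N"
proof -
  have "(\<lambda>A. \<lambda>ij\<in>{..<n} \<times> {..<p}. A $$ ij) \<in> measurable (borel_mat n p) (PiM ({..<n} \<times> {..<p}) (\<lambda>_. borel :: real measure))"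
    unfolding borel_mat_def by (rule measurable_vimage_algebra1) (auto simp: space_PiM)
  from measurable_compose[OF measurable_compose[OF f this] measurable_component_singleton[of "(i, j)"]]
  show ?thesis using ij by simp
qed

lemma measurable_vec_entry:
  assumes f: "f \<in> measurable N (borel_vec n)" and i: "i < n"
  shows "(\<lambda>\<omega>. f \<omega> $ i) \<in> borel_measurable N"
proof -
  have "(\<lambda>v. \<lambda>i\<in>{..<n}. v $ i) \<in> measurable (borel_vec n) (PiM {..<n} (\<lambda>_. borel :: real measure))"
    unfolding borel_vec_def by (rule measurable_vimage_algebra1) (auto simp: space_PiM)
  from measurable_compose[OF measurable_compose[OF f this] measurable_component_singleton[of i]]
  show ?thesis using i by simp
qed

lemma measurable_mat_carrier:
  "f \<in> measurable N (borel_mat n p) \<Longrightarrow> \<omega> \<in> space N \<Longrightarrow> f \<omega> \<in> carrier_mat n p"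
  using measurable_space[of f N "borel_mat n p" \<omega>] by (simp add: space_borel_mat)

lemma measurable_vec_carrier:
  "f \<in> measurable N (borel_vec n) \<Longrightarrow> \<omega> \<in> space N \<Longrightarrow> f \<omega> \<in> carrier_vec n"
  using measurable_space[of f N "borel_vec n" \<omega>] by (simp add: space_borel_vec)

lemma measurable_mat_dims:
  assumes "f \<in> measurable N (borel_mat n p)" "\<omega> \<in> space N"
  shows "dim_row (f \<omega>) = n" "dim_col (f \<omega>) = p"
  by (rule carrier_matD[OF measurable_mat_carrier[OF assms]])+

lemma measurable_vec_dim:
  "f \<in> measurable N (borel_vec n) \<Longrightarrow> \<omega> \<in> space N \<Longrightarrow> dim_vec (f \<omega>) = n"
  by (rule carrier_vecD[OF measurable_vec_carrier])

lemma measurable_mat_mult: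
  assumes f: "f \<in> measurable N (borel_mat n k)" and g: "g \<in> measurable N (borel_mat k p)"
  shows "(\<lambda>\<omega>. f \<omega> * g \<omega>) \<in> measurable N (borel_mat n p)"
proof (rule measurable_borel_matI)
  show "f \<omega> * g \<omega> \<in> carrier_mat n p" if "\<omega> \<in> space N" for \<omega>
    using measurable_mat_carrier[OF f that] measurable_mat_carrier[OF g that] by simp
  fix i j assume ij: "i < n" "j < p"
  have "(\<lambda>\<omega>. \<Sum>r<k. f \<omega> $$ (i, r) * g \<omega> $$ (r, j)) \<in> borel_measurable N"
    using ij by (intro borel_measurable_sum borel_measurable_times measurable_mat_entry[OF f] measurable_mat_entry[OF g]) auto
  also have "?this \<longleftrightarrow> (\<lambda>\<omega>. (f \<omega> * g \<omega>) $$ (i, j)) \<in> borel_measurable N"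
    using ij by (intro measurable_cong)
      (simp add: scalar_prod_def atLeast0LessThan measurable_mat_dims[OF f] measurable_mat_dims[OF g])
  finally show "(\<lambda>\<omega>. (f \<omega> * g \<omega>) $$ (i, j)) \<in> borel_measurable N" .
qed

lemma measurable_mat_transpose:
  assumes f: "f \<in> measurable N (borel_mat n p)"
  shows "(\<lambda>\<omega>. transpose_mat (f \<omega>)) \<in> measurable N (borel_mat p n)"
proof (rule measurable_borel_matI)
  show "transpose_mat (f \<omega>) \<in> carrier_mat p n" if "\<omega> \<in> space N" for \<omega>
    using measurable_mat_carrier[OF f that] by simp
  fix i j assume ij: "i < p" "j < n"
  have "(\<lambda>\<omega>. f \<omega> $$ (j, i)) \<in> borel_measurable N" using ij by (intro measurable_mat_entry[OF f])
  also have "?this \<longleftrightarrow> (\<lambda>\<omega>. transpose_mat (f \<omega>) $$ (i, j)) \<in> borel_measurable N"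
    using ij by (intro measurable_cong) (simp add: measurable_mat_dims[OF f])
  finally show "(\<lambda>\<omega>. transpose_mat (f \<omega>) $$ (i, j)) \<in> borel_measurable N" .
qed

lemma measurable_mat_smult:
  assumes f: "f \<in> measurable N (borel_mat n p)"
  shows "(\<lambda>\<omega>. c \<cdot>\<^sub>m f \<omega>) \<in> measurable N (borel_mat n p)"
proof (rule measurable_borel_matI)
  show "c \<cdot>\<^sub>m f \<omega> \<in> carrier_mat n p" if "\<omega> \<in> space N" for \<omega>
    using measurable_mat_carrier[OF f that] by simp
  fix i j assume ij: "i < n" "j < p"
  have "(\<lambda>\<omega>. c * f \<omega> $$ (i, j)) \<in> borel_measurable N"
    using ij by (intro borel_measurable_times borel_measurable_const measurable_mat_entry[OF f])
  also have "?this \<longleftrightarrow> (\<lambda>\<omega>. (c \<cdot>\<^sub>m f \<omega>) $$ (i, j)) \<in> borel_measurable N"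
    using ij by (intro measurable_cong) (simp add: measurable_mat_dims[OF f])
  finally show "(\<lambda>\<omega>. (c \<cdot>\<^sub>m f \<omega>) $$ (i, j)) \<in> borel_measurable N" .
qed

lemma measurable_mult_mat_vec:
  assumes f: "f \<in> measurable N (borel_mat n k)" and g: "g \<in> measurable N (borel_vec k)"
  shows "(\<lambda>\<omega>. f \<omega> *\<^sub>v g \<omega>) \<in> measurable N (borel_vec n)"
proof (rule measurable_borel_vecI)
  show "f \<omega> *\<^sub>v g \<omega> \<in> carrier_vec n" if "\<omega> \<in> space N" for \<omega>
    using measurable_mat_carrier[OF f that] measurable_vec_carrier[OF g that] by simp
  fix i assume i: "i < n"
  have "(\<lambda>\<omega>. \<Sum>r<k. f \<omega> $$ (i, r) * g \<omega> $ r) \<in> borel_measurable N"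
    using i by (intro borel_measurable_sum borel_measurable_times measurable_mat_entry[OF f] measurable_vec_entry[OF g]) auto
  also have "?this \<longleftrightarrow> (\<lambda>\<omega>. (f \<omega> *\<^sub>v g \<omega>) $ i) \<in> borel_measurable N"
    using i by (intro measurable_cong)
      (simp add: scalar_prod_def atLeast0LessThan measurable_mat_dims[OF f] measurable_vec_dim[OF g])
  finally show "(\<lambda>\<omega>. (f \<omega> *\<^sub>v g \<omega>) $ i) \<in> borel_measurable N" .
qed

lemma measurable_scalar_prod:
  assumes f: "f \<in> measurable N (borel_vec n)" and g: "g \<in> measurable N (borel_vec n)"
  shows "(\<lambda>\<omega>. f \<omega> \<bullet> g \<omega>) \<in> borel_measurable N"
proof -
  have "(\<lambda>\<omega>. \<Sum>r<n. f \<omega> $ r * g \<omega> $ r) \<in> borel_measurable N"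
    by (intro borel_measurable_sum borel_measurable_times measurable_vec_entry[OF f] measurable_vec_entry[OF g]) auto
  also have "?this \<longleftrightarrow> (\<lambda>\<omega>. f \<omega> \<bullet> g \<omega>) \<in> borel_measurable N"
    by (intro measurable_cong)
      (simp add: scalar_prod_def atLeast0LessThan measurable_vec_dim[OF f] measurable_vec_dim[OF g])
  finally show ?thesis .
qed

lemma measurable_col_gram:
  assumes f: "f \<in> measurable N (borel_mat n p)" and "i < p" "j < p"
  shows "(\<lambda>\<omega>. col_gram (f \<omega>) i j) \<in> borel_measurable N"
proof -
  have "(\<lambda>\<omega>. \<Sum>r<n. f \<omega> $$ (r, i) * f \<omega> $$ (r, j)) \<in> borel_measurable N"
    using assms(2,3) by (intro borel_measurable_sum borel_measurable_times measurable_mat_entry[OF f]) auto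
  also have "?this \<longleftrightarrow> ?thesis"
    by (intro measurable_cong) (simp add: col_gram_def measurable_mat_dims[OF f])
  finally show ?thesis .
qed

lemma measurable_frob2:
  assumes f: "f \<in> measurable N (borel_mat n p)"
  shows "(\<lambda>\<omega>. frob2 (f \<omega>)) \<in> borel_measurable N"
proof -
  have "(\<lambda>\<omega>. \<Sum>i<p. col_gram (f \<omega>) i i) \<in> borel_measurable N"
    by (intro borel_measurable_sum measurable_col_gram[OF f]) auto
  also have "?this \<longleftrightarrow> ?thesis"
    by (intro measurable_cong) (rule sum_col_gram_frob2[OF measurable_mat_carrier[OF f]])
  finally show ?thesis .
qed

lemma measurable_det:
  assumes f: "f \<in> measurable N (borel_mat n n)"
  shows "(\<lambda>\<omega>. det (f \<omega>)) \<in> borel_measurable N"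
proof -
  have "(\<lambda>\<omega>. \<Sum>\<pi>\<in>{\<pi>. \<pi> permutes {0..<n}}. signof \<pi> * (\<Prod>i = 0..<n. f \<omega> $$ (i, \<pi> i))) \<in> borel_measurable N"
    by (intro borel_measurable_sum borel_measurable_times borel_measurable_const borel_measurable_prod
        measurable_mat_entry[OF f]) (auto dest: permutes_in_image)
  also have "?this \<longleftrightarrow> ?thesis"
    by (intro measurable_cong) (rule det_def'[OF measurable_mat_carrier[OF f], symmetric])
  finally show ?thesis .
qed

lemma measurable_cofactor:
  assumes f: "f \<in> measurable N (borel_mat n n)" and ij: "i < n" "j < n"
  shows "(\<lambda>\<omega>. cofactor (f \<omega>) i j) \<in> borel_measurable N"
proof -
  have "(\<lambda>\<omega>. mat_delete (f \<omega>) i j) \<in> measurable N (borel_mat (n - 1) (n - 1))"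
  proof (rule measurable_borel_matI)
    show "mat_delete (f \<omega>) i j \<in> carrier_mat (n - 1) (n - 1)" if "\<omega> \<in> space N" for \<omega>
      by (rule mat_delete_carrier[OF measurable_mat_carrier[OF f that]])
    fix a b assume ab: "a < n - 1" "b < n - 1"
    have "(\<lambda>\<omega>. f \<omega> $$ (if a < i then a else Suc a, if b < j then b else Suc b)) \<in> borel_measurable N"
      using ab ij by (intro measurable_mat_entry[OF f]) auto
    also have "?this \<longleftrightarrow> (\<lambda>\<omega>. mat_delete (f \<omega>) i j $$ (a, b)) \<in> borel_measurable N"
      using ab by (intro measurable_cong) (simp add: mat_delete_def measurable_mat_dims[OF f])
    finally show "(\<lambda>\<omega>. mat_delete (f \<omega>) i j $$ (a, b)) \<in> borel_measurable N" .
  qed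
  then show ?thesis unfolding cofactor_def by (intro borel_measurable_times borel_measurable_const measurable_det)
qed

lemma resolvent_eq_adj_mat:
  assumes X: "X \<in> carrier_mat n p" and l: "0 < l"
  shows "resolvent X l = (1 / det (ridge_gram X l)) \<cdot>\<^sub>m adj_mat (ridge_gram X l)"
proof (rule resolvent_unique[OF X l])
  note K = ridge_gram_carrier[OF X l]
  show "(1 / det (ridge_gram X l)) \<cdot>\<^sub>m adj_mat (ridge_gram X l) \<in> carrier_mat p p"
    using adj_mat(1)[OF K] by simp
  show "ridge_gram X l * ((1 / det (ridge_gram X l)) \<cdot>\<^sub>m adj_mat (ridge_gram X l)) = 1\<^sub>m p"
    using ridge_gram_det[OF X l] adj_mat[OF K] K
    by (simp add: mult_smult_distrib[of _ p p _ p]) (intro eq_matI, auto)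
qed

text \<open>
  By Cramer's rule the entries of the inverse are quotients of polynomials in the entries of the
  design.
\<close>

lemma measurable_resolvent:
  assumes f: "f \<in> measurable N (borel_mat n p)" and l: "0 < l"
  shows "(\<lambda>\<omega>. resolvent (f \<omega>) l) \<in> measurable N (borel_mat p p)"
proof -
  have K: "(\<lambda>\<omega>. ridge_gram (f \<omega>) l) \<in> measurable N (borel_mat p p)"
  proof (rule measurable_borel_matI)
    show "ridge_gram (f \<omega>) l \<in> carrier_mat p p" if "\<omega> \<in> space N" for \<omega>
      by (rule ridge_gram_carrier[OF measurable_mat_carrier[OF f that] l])
    fix i j assume ij: "i < p" "j < p"
    have "(\<lambda>\<omega>. (transpose_mat (f \<omega>) * f \<omega>) $$ (i, j) + (if i = j then l else 0)) \<in> borel_measurable N"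
      using ij by (intro borel_measurable_add borel_measurable_const
          measurable_mat_entry[OF measurable_mat_mult[OF measurable_mat_transpose[OF f] f]])
    also have "?this \<longleftrightarrow> (\<lambda>\<omega>. ridge_gram (f \<omega>) l $$ (i, j)) \<in> borel_measurable N"
      using ij by (intro measurable_cong) (simp add: ridge_gram_def measurable_mat_dims[OF f])
    finally show "(\<lambda>\<omega>. ridge_gram (f \<omega>) l $$ (i, j)) \<in> borel_measurable N" .
  qed
  show ?thesis
  proof (rule measurable_borel_matI)
    show "resolvent (f \<omega>) l \<in> carrier_mat p p" if "\<omega> \<in> space N" for \<omega>
      by (rule resolvent_carrier[OF measurable_mat_carrier[OF f that] l])
    fix i j assume ij: "i < p" "j < p"
    have "(\<lambda>\<omega>. 1 / det (ridge_gram (f \<omega>) l) * cofactor (ridge_gram (f \<omega>) l) j i) \<in> borel_measurable N"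
      using ij by (intro borel_measurable_times borel_measurable_divide borel_measurable_const measurable_det[OF K]
          measurable_cofactor[OF K])
    also have "?this \<longleftrightarrow> (\<lambda>\<omega>. resolvent (f \<omega>) l $$ (i, j)) \<in> borel_measurable N"
    proof (rule measurable_cong)
      fix \<omega> assume "\<omega> \<in> space N"
      note X = measurable_mat_carrier[OF f this]
      show "1 / det (ridge_gram (f \<omega>) l) * cofactor (ridge_gram (f \<omega>) l) j i = resolvent (f \<omega>) l $$ (i, j)"
        unfolding resolvent_eq_adj_mat[OF X l] using ij ridge_gram_carrier[OF X l]
        by (simp add: adj_mat_def carrier_matD)
    qed
    finally show "(\<lambda>\<omega>. resolvent (f \<omega>) l $$ (i, j)) \<in> borel_measurable N" .
  qed
qed


section \<open>The test design\<close>

lemma nn_integral_rotate: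
  assumes inv: "right_rot_invariant M n p X" and U: "is_orthogonal p U"
    and F: "F \<in> borel_measurable (borel_mat n p)"
  shows "(\<integral>\<^sup>+\<omega>. F (X \<omega> * U) \<partial>M) = (\<integral>\<^sup>+\<omega>. F (X \<omega>) \<partial>M)"
proof -
  have X: "X \<in> measurable M (borel_mat n p)"
    and eq: "distr M (borel_mat n p) (\<lambda>\<omega>. X \<omega> * U) = distr M (borel_mat n p) X"
    using inv U by (auto simp: right_rot_invariant_def)
  have "U \<in> carrier_mat p p" using U by (simp add: is_orthogonal_def)
  then have "(\<lambda>\<omega>. U) \<in> measurable M (borel_mat p p)" by (intro measurable_const) (simp add: space_borel_mat)
  from measurable_mat_mult[OF X this] have XU: "(\<lambda>\<omega>. X \<omega> * U) \<in> measurable M (borel_mat n p)" .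
  show ?thesis
    using nn_integral_distr[OF XU, of F] nn_integral_distr[OF X, of F] F eq by simp
qed

text \<open>
  For every \<open>j\<close> there is an orthogonal matrix taking \<open>c\<close> to \<open>|c|\<close> times the \<open>j\<close>-th unit vector. By invariance the
  left second moment equals \<open>|c|\<^sup>2\<close> times that of the \<open>j\<close>-th column; summing over \<open>j\<close> gives the
  claim. Working in the extended reals postpones integrability.
\<close>

lemma second_moment_rotation_invariant:
  assumes inv: "right_rot_invariant M n p X" and c: "c \<in> carrier_vec p"
  shows "ennreal (real p) * (\<integral>\<^sup>+\<omega>. ennreal ((X \<omega> *\<^sub>v c) \<bullet> (X \<omega> *\<^sub>v c)) \<partial>M)
    = ennreal (c \<bullet> c) * (\<integral>\<^sup>+\<omega>. ennreal (frob2 (X \<omega>)) \<partial>M)"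
proof -
  have X: "X \<in> measurable M (borel_mat n p)" using inv by (simp add: right_rot_invariant_def)
  have id: "(\<lambda>A. A) \<in> measurable (borel_mat n p) (borel_mat n p)" by simp
  have F: "(\<lambda>A. ennreal ((A *\<^sub>v v) \<bullet> (A *\<^sub>v v))) \<in> borel_measurable (borel_mat n p)" if "v \<in> carrier_vec p" for v
    by (intro measurable_compose[OF _ measurable_ennreal] measurable_scalar_prod[of _ _ n]
        measurable_mult_mat_vec[OF id] measurable_const) (auto simp: space_borel_vec that)
  have col: "(\<integral>\<^sup>+\<omega>. ennreal ((X \<omega> *\<^sub>v c) \<bullet> (X \<omega> *\<^sub>v c)) \<partial>M)
     = ennreal (c \<bullet> c) * (\<integral>\<^sup>+\<omega>. ennreal (col_gram (X \<omega>) j j) \<partial>M)" if j: "j < p" for j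
  proof -
    let ?t = "sqrt (c \<bullet> c)"
    let ?e = "?t \<cdot>\<^sub>v unit_vec p j"
    have e: "?e \<in> carrier_vec p" by simp
    have "c \<bullet> c = ?e \<bullet> ?e" using j scalar_prod_self_nonneg[of c] by simp
    then obtain U where U: "is_orthogonal p U" "U *\<^sub>v c = ?e"
      using exists_orthogonal_mapping[OF c e] by blast
    then have Uc: "U \<in> carrier_mat p p" by (simp add: is_orthogonal_def)
    have "(\<integral>\<^sup>+\<omega>. ennreal ((X \<omega> *\<^sub>v c) \<bullet> (X \<omega> *\<^sub>v c)) \<partial>M)
        = (\<integral>\<^sup>+\<omega>. ennreal (((X \<omega> * U) *\<^sub>v c) \<bullet> ((X \<omega> * U) *\<^sub>v c)) \<partial>M)"
      using nn_integral_rotate[OF inv U(1) F[OF c]] by simp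
    also have "\<dots> = (\<integral>\<^sup>+\<omega>. ennreal (c \<bullet> c) * ennreal (col_gram (X \<omega>) j j) \<partial>M)"
    proof (rule nn_integral_cong)
      fix \<omega> assume "\<omega> \<in> space M"
      note Xc = measurable_mat_carrier[OF X this]
      have "(X \<omega> * U) *\<^sub>v c = X \<omega> *\<^sub>v ?e"
        unfolding U(2)[symmetric] by (rule assoc_mult_mat_vec[OF Xc Uc c])
      also have "\<dots> = ?t \<cdot>\<^sub>v (X \<omega> *\<^sub>v unit_vec p j)" by (rule mult_mat_vec[OF Xc]) simp
      finally have "((X \<omega> * U) *\<^sub>v c) \<bullet> ((X \<omega> * U) *\<^sub>v c) = (c \<bullet> c) * col_gram (X \<omega>) j j"
        using Xc scalar_prod_self_nonneg[of c]
        by (simp add: col_gram_scalar_prod[OF Xc j j] flip: power2_eq_square mult.assoc)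
      then show "ennreal (((X \<omega> * U) *\<^sub>v c) \<bullet> ((X \<omega> * U) *\<^sub>v c)) = ennreal (c \<bullet> c) * ennreal (col_gram (X \<omega>) j j)"
        by (simp add: ennreal_mult' scalar_prod_self_nonneg)
    qed
    also have "\<dots> = ennreal (c \<bullet> c) * (\<integral>\<^sup>+\<omega>. ennreal (col_gram (X \<omega>) j j) \<partial>M)"
      using measurable_col_gram[OF X j j] by (intro nn_integral_cmult) simp
    finally show ?thesis .
  qed
  have "ennreal (real p) * (\<integral>\<^sup>+\<omega>. ennreal ((X \<omega> *\<^sub>v c) \<bullet> (X \<omega> *\<^sub>v c)) \<partial>M)
     = (\<Sum>j<p. ennreal (c \<bullet> c) * (\<integral>\<^sup>+\<omega>. ennreal (col_gram (X \<omega>) j j) \<partial>M))"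
  proof -
    have "(\<Sum>j<p. ennreal (c \<bullet> c) * (\<integral>\<^sup>+\<omega>. ennreal (col_gram (X \<omega>) j j) \<partial>M))
       = (\<Sum>j<p. \<integral>\<^sup>+\<omega>. ennreal ((X \<omega> *\<^sub>v c) \<bullet> (X \<omega> *\<^sub>v c)) \<partial>M)"
      using col by (intro sum.cong refl) simp
    then show ?thesis by (simp only: sum_constant card_lessThan ennreal_of_nat_eq_real_of_nat)
  qed
  also have "\<dots> = ennreal (c \<bullet> c) * (\<Sum>j<p. \<integral>\<^sup>+\<omega>. ennreal (col_gram (X \<omega>) j j) \<partial>M)"
    by (simp add: sum_distrib_left)
  also have "(\<Sum>j<p. \<integral>\<^sup>+\<omega>. ennreal (col_gram (X \<omega>) j j) \<partial>M) = (\<integral>\<^sup>+\<omega>. (\<Sum>j<p. ennreal (col_gram (X \<omega>) j j)) \<partial>M)"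
    using measurable_col_gram[OF X] by (intro nn_integral_sum[symmetric]) auto
  also have "\<dots> = (\<integral>\<^sup>+\<omega>. ennreal (frob2 (X \<omega>)) \<partial>M)"
  proof (rule nn_integral_cong)
    fix \<omega> assume "\<omega> \<in> space M"
    note sum_col_gram_frob2[OF measurable_mat_carrier[OF X this]]
    moreover have "(\<Sum>j<p. ennreal (col_gram (X \<omega>) j j)) = ennreal (\<Sum>j<p. col_gram (X \<omega>) j j)"
      by (rule sum_ennreal) (auto simp: col_gram_def intro!: sum_nonneg)
    ultimately show "(\<Sum>j<p. ennreal (col_gram (X \<omega>) j j)) = ennreal (frob2 (X \<omega>))" by simp
  qed
  finally show ?thesis .
qed

lemma mult_minus_distrib_mat_vec_real:
  fixes A :: "real mat"
  assumes "A \<in> carrier_mat m k" "v \<in> carrier_vec k" "w \<in> carrier_vec k"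
  shows "A *\<^sub>v (v - w) = A *\<^sub>v v - A *\<^sub>v w"
  using assms by (intro eq_vecI) (auto simp: scalar_prod_minus_distrib[of _ k])

text \<open>
  The trace condition says that the expected squared Frobenius norm of the design is \<open>m p / n\<close>. As this
  is nonzero, the Bochner integral in it is not a default value, and the squared Frobenius norm is
  integrable.
\<close>

lemma test_risk_eq:
  assumes prob: "prob_space M" and inv: "right_rot_invariant M m p X'"
    and svd: "\<And>\<omega>. \<omega> \<in> space M \<Longrightarrow> is_svd m p (X' \<omega>) (Q' \<omega>) (D' \<omega>) (V' \<omega>)"
    and trace: "real n * (\<integral>\<omega>. mat_trace (transpose_mat (D' \<omega>) * D' \<omega>) \<partial>M) / (real m * real p) = 1"
    and b: "b \<in> carrier_vec p" "c \<in> carrier_vec p"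
  shows "risk M m X' b c = ((b - c) \<bullet> (b - c)) / real n"
proof -
  interpret prob_space M by (rule prob)
  have X: "X' \<in> measurable M (borel_mat m p)" using inv by (simp add: right_rot_invariant_def)
  let ?d = "b - c"
  have d: "?d \<in> carrier_vec p" using b by simp
  have nz: "real n \<noteq> 0" "real m \<noteq> 0" "real p \<noteq> 0" using trace by (cases "n = 0"; auto)+
  have tr: "mat_trace (transpose_mat (D' \<omega>) * D' \<omega>) = frob2 (X' \<omega>)" if w: "\<omega> \<in> space M" for \<omega>
  proof -
    have Q: "is_orthogonal m (Q' \<omega>)" and V: "is_orthogonal p (V' \<omega>)" and D: "D' \<omega> \<in> carrier_mat m p"
      and eq: "X' \<omega> = transpose_mat (Q' \<omega>) * D' \<omega> * V' \<omega>"
      using svd[OF w] by (auto simp: is_svd_def)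
    have "transpose_mat (Q' \<omega>) * D' \<omega> \<in> carrier_mat m p" using Q D by (auto simp: is_orthogonal_def)
    from frob2_orthogonal_right[OF V this] frob2_orthogonal_left[OF is_orthogonal_transpose[OF Q] D]
    show ?thesis by (simp add: mat_trace_transpose_mult eq)
  qed
  define \<tau> where "\<tau> = (\<integral>\<omega>. frob2 (X' \<omega>) \<partial>M)"
  have "(\<integral>\<omega>. mat_trace (transpose_mat (D' \<omega>) * D' \<omega>) \<partial>M) = \<tau>"
    unfolding \<tau>_def by (intro Bochner_Integration.integral_cong refl tr)
  with trace nz have tau: "\<tau> = real m * real p / real n" by (simp add: field_simps)
  then have "\<tau> \<noteq> 0" using nz by simp
  then have int: "integrable M (\<lambda>\<omega>. frob2 (X' \<omega>))" using not_integrable_integral_eq[of M] unfolding \<tau>_def by blast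
  have f0: "0 \<le> frob2 A" for A by (auto simp: frob2_def intro!: sum_nonneg)
  have "(\<integral>\<^sup>+\<omega>. ennreal (frob2 (X' \<omega>)) \<partial>M) = ennreal \<tau>"
    unfolding \<tau>_def by (rule nn_integral_eq_integral[OF int]) (simp add: f0)
  with second_moment_rotation_invariant[OF inv d]
  have eq: "ennreal (real p) * (\<integral>\<^sup>+\<omega>. ennreal ((X' \<omega> *\<^sub>v ?d) \<bullet> (X' \<omega> *\<^sub>v ?d)) \<partial>M) = ennreal ((?d \<bullet> ?d) * \<tau>)"
    by (simp add: ennreal_mult' scalar_prod_self_nonneg)
  have dm: "(\<lambda>_. ?d) \<in> measurable M (borel_vec p)" by (rule measurable_const) (simp add: space_borel_vec d)
  have meas: "(\<lambda>\<omega>. (X' \<omega> *\<^sub>v ?d) \<bullet> (X' \<omega> *\<^sub>v ?d)) \<in> borel_measurable M"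
    by (intro measurable_scalar_prod[of _ _ m] measurable_mult_mat_vec[OF X dm])
  let ?I = "\<integral>\<^sup>+\<omega>. ennreal ((X' \<omega> *\<^sub>v ?d) \<bullet> (X' \<omega> *\<^sub>v ?d)) \<partial>M"
  have "(\<integral>\<omega>. (X' \<omega> *\<^sub>v ?d) \<bullet> (X' \<omega> *\<^sub>v ?d) \<partial>M) = enn2real ?I"
    by (rule integral_eq_nn_integral[OF meas]) (simp add: scalar_prod_self_nonneg)
  moreover have "real p * enn2real ?I = (?d \<bullet> ?d) * \<tau>"
    using arg_cong[OF eq, of enn2real] tau nz scalar_prod_self_nonneg[of ?d] by (simp add: enn2real_mult)
  ultimately have I: "(\<integral>\<omega>. (X' \<omega> *\<^sub>v ?d) \<bullet> (X' \<omega> *\<^sub>v ?d) \<partial>M) = (?d \<bullet> ?d) * real m / real n"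
    using nz by (simp add: tau field_simps)
  have "(\<integral>\<omega>. (l2norm (X' \<omega> *\<^sub>v b - X' \<omega> *\<^sub>v c))\<^sup>2 \<partial>M) = (\<integral>\<omega>. (X' \<omega> *\<^sub>v ?d) \<bullet> (X' \<omega> *\<^sub>v ?d) \<partial>M)"
    using b by (intro Bochner_Integration.integral_cong refl)
      (simp add: l2norm_def scalar_prod_self_nonneg mult_minus_distrib_mat_vec_real[OF measurable_mat_carrier[OF X]])
  then show ?thesis unfolding risk_def I using nz by simp
qed


section \<open>The bias\<close>

definition sign_pmf :: "nat \<Rightarrow> (nat \<Rightarrow> real) pmf" where
  "sign_pmf p = Pi_pmf {..<p} 0 (\<lambda>_. pmf_of_set {-1, 1})"

lemma sign_pmf_square: "s \<in> set_pmf (sign_pmf p) \<Longrightarrow> i < p \<Longrightarrow> (s i)\<^sup>2 = 1"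
  by (auto simp: sign_pmf_def set_Pi_pmf PiE_dflt_def)

lemma finite_sign_pmf: "finite (set_pmf (sign_pmf p))"
  by (auto simp: sign_pmf_def set_Pi_pmf intro!: finite_PiE_dflt)

lemma centred_indep_fourth_signs: "centred_indep_fourth (measure_pmf (sign_pmf p)) (\<lambda>i s. s i) p 1"
proof (intro centred_indep_fourth.intro centred_indep_fourth_axioms.intro)
  show "prob_space (measure_pmf (sign_pmf p))" by (rule measure_pmf.prob_space_axioms)
  have "prob_space.indep_vars (measure_pmf (sign_pmf p)) (\<lambda>_. count_space UNIV) (\<lambda>i s. s i) {..<p}"
    unfolding sign_pmf_def by (rule indep_vars_Pi_pmf) simp
  from prob_space.indep_vars_compose2[OF measure_pmf.prob_space_axioms this, of "\<lambda>_ x. x" "\<lambda>_. borel"]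
  show "prob_space.indep_vars (measure_pmf (sign_pmf p)) (\<lambda>_. borel) (\<lambda>i s. s i) {..<p}" by simp
  fix i assume i: "i < p"
  have "measure_pmf.expectation (sign_pmf p) (\<lambda>s. s i) = measure_pmf.expectation (map_pmf (\<lambda>s. s i) (sign_pmf p)) (\<lambda>x. x)"
    by simp
  also have "map_pmf (\<lambda>s. s i) (sign_pmf p) = pmf_of_set {-1, 1}"
    unfolding sign_pmf_def using i by (subst Pi_pmf_component) auto
  finally show "measure_pmf.expectation (sign_pmf p) (\<lambda>s. s i) = 0" by (simp add: integral_pmf_of_set)
  show "integrable (measure_pmf (sign_pmf p)) (\<lambda>s. s i ^ 4)"
    by (rule integrable_measure_pmf_finite[OF finite_sign_pmf])
  have "s i ^ 4 = 1" if "s \<in> set_pmf (sign_pmf p)" for s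
  proof -
    have "s i ^ 4 = ((s i)\<^sup>2)\<^sup>2" by (simp flip: power_mult)
    then show ?thesis using sign_pmf_square[OF that i] by simp
  qed
  then have "measure_pmf.expectation (sign_pmf p) (\<lambda>s. s i ^ 4) = measure_pmf.expectation (sign_pmf p) (\<lambda>s. 1)"
    by (intro integral_cong_AE) (auto simp: AE_measure_pmf_iff)
  then show "measure_pmf.expectation (sign_pmf p) (\<lambda>s. s i ^ 4) \<le> 1" by simp
qed simp

text \<open>
  The deviation of the squared bias in direction \<open>v\<close> from its average over all directions of the same
  length.
\<close>

definition quad_dev :: "nat \<Rightarrow> real \<Rightarrow> real vec \<Rightarrow> real mat \<Rightarrow> real" where
  "quad_dev p l v X = ((l \<cdot>\<^sub>m resolvent X l) *\<^sub>v v) \<bullet> ((l \<cdot>\<^sub>m resolvent X l) *\<^sub>v v)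
     - v \<bullet> v / real p * frob2 (l \<cdot>\<^sub>m resolvent X l)"

lemma measurable_quad_dev:
  assumes f: "f \<in> measurable N (borel_mat n p)" and g: "g \<in> measurable N (borel_vec p)" and l: "0 < l"
  shows "(\<lambda>\<omega>. quad_dev p l (g \<omega>) (f \<omega>)) \<in> borel_measurable N"
  unfolding quad_dev_def
  by (intro borel_measurable_diff borel_measurable_times borel_measurable_divide borel_measurable_const
      measurable_scalar_prod[of _ _ p] measurable_mult_mat_vec[of _ _ p p] measurable_frob2[of _ _ p p]
      measurable_mat_smult measurable_resolvent[OF f l] g)

lemma smult_resolvent_bound:
  assumes X: "X \<in> carrier_mat n p" and l: "0 < l" and v: "v \<in> carrier_vec p"
  shows "((l \<cdot>\<^sub>m resolvent X l) *\<^sub>v v) \<bullet> ((l \<cdot>\<^sub>m resolvent X l) *\<^sub>v v) \<le> 1 * (v \<bullet> v)"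
proof -
  note G = resolvent_carrier[OF X l]
  have eq: "(l \<cdot>\<^sub>m resolvent X l) *\<^sub>v v = l \<cdot>\<^sub>v (resolvent X l *\<^sub>v v)"
    using G v by (intro eq_vecI) (auto simp: carrier_matD)
  have "resolvent X l *\<^sub>v v \<in> carrier_vec p" using G v by simp
  then show ?thesis
    unfolding eq using resolvent_bound[OF X l v] by (simp add: power2_eq_square mult.assoc)
qed

lemma quad_dev_rotate:
  assumes X: "X \<in> carrier_mat n p" and l: "0 < l" and U: "is_orthogonal p U" and v: "v \<in> carrier_vec p"
  shows "quad_dev p l v (X * U) = quad_dev p l (U *\<^sub>v v) X"
proof -
  note G = resolvent_carrier[OF X l]
  let ?H = "l \<cdot>\<^sub>m resolvent X l"
  have H: "?H \<in> carrier_mat p p" using G by simp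
  have Uc: "U \<in> carrier_mat p p" using U by (simp add: is_orthogonal_def)
  have Ut: "is_orthogonal p (transpose_mat U)" by (rule is_orthogonal_transpose[OF U])
  have UtG: "transpose_mat U * resolvent X l \<in> carrier_mat p p" using Uc G by simp
  have UtH: "transpose_mat U * ?H \<in> carrier_mat p p" using Uc H by simp
  have eq: "l \<cdot>\<^sub>m resolvent (X * U) l = transpose_mat U * ?H * U"
    unfolding resolvent_rotate[OF X l U] using Uc G UtG
    by (simp add: mult_smult_distrib[of _ p p _ p] mult_smult_assoc_mat[of _ p p _ p])
  have "frob2 (transpose_mat U * ?H * U) = frob2 ?H"
    using frob2_orthogonal_right[OF U UtH] frob2_orthogonal_left[OF Ut H] by simp
  moreover have "(transpose_mat U * ?H * U) *\<^sub>v v = transpose_mat U *\<^sub>v (?H *\<^sub>v (U *\<^sub>v v))"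
    using Uc H UtH v by (simp add: assoc_mult_mat_vec[of _ p p _ p])
  moreover have "?H *\<^sub>v (U *\<^sub>v v) \<in> carrier_vec p"
    using H Uc v by (intro mult_mat_vec_carrier[of _ p p]) auto
  moreover note is_orthogonal_norm[OF Ut this] is_orthogonal_norm[OF U v]
  ultimately show ?thesis unfolding quad_dev_def eq by simp
qed

text \<open>
  For a vector with entries \<open>\<plusminus> t\<close> the diagonal of the quadratic form is deterministic and cancels against
  the trace, and what remains is twice a bilinear form in independent signs.
\<close>

lemma quad_dev_signs:
  assumes X: "X \<in> carrier_mat n p" and l: "0 < l" and p: "1 \<le> p" and t: "0 \<le> t"
  shows "(\<integral>\<^sup>+s. ennreal (quad_dev p l (vec p (\<lambda>i. t * s i)) X ^ 4) \<partial>measure_pmf (sign_pmf p))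
    \<le> ennreal (4096 * t ^ 8 * (real p)\<^sup>2)"
proof -
  let ?H = "l \<cdot>\<^sub>m resolvent X l"
  have H: "?H \<in> carrier_mat p p" using resolvent_carrier[OF X l] by simp
  interpret S: centred_indep_fourth "measure_pmf (sign_pmf p)" "\<lambda>i s. s i" p 1
    by (rule centred_indep_fourth_signs)
  have eq: "quad_dev p l (vec p (\<lambda>i. t * s i)) X ^ 4
     = 16 * t ^ 8 * (\<Sum>j<p. \<Sum>i<j. col_gram ?H i j * s i * s j) ^ 4" if s: "s \<in> set_pmf (sign_pmf p)" for s
  proof -
    let ?v = "vec p (\<lambda>i. t * s i)"
    have v: "?v \<in> carrier_vec p" by simp
    have sq: "(?v $ i)\<^sup>2 = t\<^sup>2" if "i < p" for i
      using sign_pmf_square[OF s that] that by (simp add: power_mult_distrib)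
    have "?v \<bullet> ?v = real p * t\<^sup>2"
      unfolding scalar_prod_self_sum[OF v] using sq by simp
    moreover have "(\<Sum>i<p. col_gram ?H i i * (?v $ i)\<^sup>2) = t\<^sup>2 * frob2 ?H"
      using sq by (simp add: sum_distrib_left mult.commute flip: sum_col_gram_frob2[OF H])
    moreover have "(\<Sum>j<p. \<Sum>i<j. col_gram ?H i j * ?v $ i * ?v $ j)
        = t\<^sup>2 * (\<Sum>j<p. \<Sum>i<j. col_gram ?H i j * s i * s j)"
      unfolding sum_distrib_left by (intro sum.cong refl) (auto simp: power2_eq_square)
    ultimately have "quad_dev p l ?v X = 2 * t\<^sup>2 * (\<Sum>j<p. \<Sum>i<j. col_gram ?H i j * s i * s j)"
      unfolding quad_dev_def norm_mult_mat_vec_split[OF H v] using p by simp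
    then show ?thesis by (simp add: power_mult_distrib flip: power_mult)
  qed
  have "(\<integral>\<^sup>+s. ennreal (quad_dev p l (vec p (\<lambda>i. t * s i)) X ^ 4) \<partial>measure_pmf (sign_pmf p))
    = (\<integral>\<^sup>+s. ennreal (16 * t ^ 8) * ennreal ((\<Sum>j<p. \<Sum>i<j. col_gram ?H i j * s i * s j) ^ 4) \<partial>measure_pmf (sign_pmf p))"
    using eq t by (intro nn_integral_cong_AE) (auto simp: AE_measure_pmf_iff simp flip: ennreal_mult)
  also have "\<dots> = ennreal (16 * t ^ 8) * (\<integral>\<^sup>+s. ennreal ((\<Sum>j<p. \<Sum>i<j. col_gram ?H i j * s i * s j) ^ 4) \<partial>measure_pmf (sign_pmf p))"
    by (intro nn_integral_cmult) simp
  \<comment> \<open>The factor 16 is the fourth power of the 2 in front of the off-diagonal sum; together with the 16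
    of the bilinear bound squared it gives \<open>4096 = 2\<^sup>1\<^sup>2\<close>.\<close>
  also have "\<dots> \<le> ennreal (16 * t ^ 8) * ennreal ((16 * 1\<^sup>2 * (\<Sum>j<p. \<Sum>i<j. (col_gram ?H i j)\<^sup>2))\<^sup>2)"
    by (intro mult_left_mono S.bilinear_form_fourth_moment) auto
  also have "\<dots> \<le> ennreal (16 * t ^ 8) * ennreal ((16 * real p)\<^sup>2)"
  proof (intro mult_left_mono ennreal_leI power_mono)
    have "(\<Sum>j<p. \<Sum>i<j. (col_gram ?H i j)\<^sup>2) \<le> 1\<^sup>2 * real p"
      by (rule col_gram_offdiag_bound[OF H _ smult_resolvent_bound[OF X l]]) simp_all
    then show "16 * 1\<^sup>2 * (\<Sum>j<p. \<Sum>i<j. (col_gram ?H i j)\<^sup>2) \<le> 16 * real p" by simp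
  qed (auto intro!: sum_nonneg)
  also have "\<dots> = ennreal (4096 * t ^ 8 * (real p)\<^sup>2)"
    using t by (simp add: power_mult_distrib flip: ennreal_mult)
  finally show ?thesis .
qed

text \<open>
  The integral is the same for all vectors of the length of \<open>b\<close>, by \<open>quad_dev_rotate\<close>. It is averaged
  over sign vectors scaled to this length, and the average is taken inside the expectation.
\<close>

lemma quad_dev_fourth_moment:
  assumes inv: "right_rot_invariant M n p X" and l: "0 < l" and p: "1 \<le> p" and b: "b \<in> carrier_vec p"
    and prob: "prob_space M"
  shows "(\<integral>\<^sup>+\<omega>. ennreal (quad_dev p l b (X \<omega>) ^ 4) \<partial>M) \<le> ennreal (4096 * (b \<bullet> b) ^ 4 / (real p)\<^sup>2)"
proof -
  interpret prob_space M by (rule prob)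
  have X: "X \<in> measurable M (borel_mat n p)" using inv by (simp add: right_rot_invariant_def)
  have id: "(\<lambda>A. A) \<in> measurable (borel_mat n p) (borel_mat n p)" by simp
  have F: "(\<lambda>A. ennreal (quad_dev p l v A ^ 4)) \<in> borel_measurable (borel_mat n p)" if "v \<in> carrier_vec p" for v
    by (intro measurable_compose[OF _ measurable_ennreal] borel_measurable_power
        measurable_quad_dev[OF id _ l] measurable_const) (simp add: space_borel_vec that)
  define t where "t = sqrt (b \<bullet> b / real p)"
  have t0: "0 \<le> t" by (simp add: t_def scalar_prod_self_nonneg)
  have t2: "t\<^sup>2 = b \<bullet> b / real p" by (simp add: t_def scalar_prod_self_nonneg)
  let ?v = "\<lambda>s. vec p (\<lambda>i. t * s i)"
  let ?I = "\<integral>\<^sup>+\<omega>. ennreal (quad_dev p l b (X \<omega>) ^ 4) \<partial>M"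
  have I: "(\<integral>\<^sup>+\<omega>. ennreal (quad_dev p l (?v s) (X \<omega>) ^ 4) \<partial>M) = ?I" if s: "s \<in> set_pmf (sign_pmf p)" for s
  proof -
    have v: "?v s \<in> carrier_vec p" by simp
    have "?v s \<bullet> ?v s = (\<Sum>i<p. t\<^sup>2)"
      unfolding scalar_prod_self_sum[OF v]
      by (intro sum.cong refl) (simp add: power_mult_distrib sign_pmf_square[OF s])
    then have "b \<bullet> b = ?v s \<bullet> ?v s" using p by (simp add: t2)
    then obtain U where U: "is_orthogonal p U" "U *\<^sub>v b = ?v s"
      using exists_orthogonal_mapping[OF b v] by blast
    have "?I = (\<integral>\<^sup>+\<omega>. ennreal (quad_dev p l b (X \<omega> * U) ^ 4) \<partial>M)"
      using nn_integral_rotate[OF inv U(1) F[OF b]] by simp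
    also have "\<dots> = (\<integral>\<^sup>+\<omega>. ennreal (quad_dev p l (?v s) (X \<omega>) ^ 4) \<partial>M)"
      using quad_dev_rotate[OF measurable_mat_carrier[OF X] l U(1) b] U(2)
      by (intro nn_integral_cong) simp
    finally show ?thesis by simp
  qed
  have "?I = (\<integral>\<^sup>+s. ?I \<partial>measure_pmf (sign_pmf p))" by (simp add: measure_pmf.emeasure_space_1)
  also have "\<dots> = (\<integral>\<^sup>+s. (\<integral>\<^sup>+\<omega>. ennreal (quad_dev p l (?v s) (X \<omega>) ^ 4) \<partial>M) \<partial>measure_pmf (sign_pmf p))"
    using I by (intro nn_integral_cong_AE) (auto simp: AE_measure_pmf_iff)
  also have "\<dots> = (\<Sum>s\<in>set_pmf (sign_pmf p). (\<integral>\<^sup>+\<omega>. ennreal (quad_dev p l (?v s) (X \<omega>) ^ 4) \<partial>M) * pmf (sign_pmf p) s)"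
    by (rule nn_integral_measure_pmf_finite[OF finite_sign_pmf]) simp
  also have "\<dots> = (\<Sum>s\<in>set_pmf (sign_pmf p). (\<integral>\<^sup>+\<omega>. ennreal (quad_dev p l (?v s) (X \<omega>) ^ 4) * pmf (sign_pmf p) s \<partial>M))"
    by (intro sum.cong refl nn_integral_multc[symmetric] measurable_compose[OF X F]) simp
  also have "\<dots> = (\<integral>\<^sup>+\<omega>. (\<Sum>s\<in>set_pmf (sign_pmf p). ennreal (quad_dev p l (?v s) (X \<omega>) ^ 4) * pmf (sign_pmf p) s) \<partial>M)"
    by (intro nn_integral_sum[symmetric] borel_measurable_times_ennreal measurable_compose[OF X F] borel_measurable_const) simp
  also have "\<dots> = (\<integral>\<^sup>+\<omega>. (\<integral>\<^sup>+s. ennreal (quad_dev p l (?v s) (X \<omega>) ^ 4) \<partial>measure_pmf (sign_pmf p)) \<partial>M)"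
    by (intro nn_integral_cong nn_integral_measure_pmf_finite[OF finite_sign_pmf, symmetric]) simp
  also have "\<dots> \<le> (\<integral>\<^sup>+\<omega>. ennreal (4096 * t ^ 8 * (real p)\<^sup>2) \<partial>M)"
    by (intro nn_integral_mono quad_dev_signs[OF measurable_mat_carrier[OF X] l p t0])
  also have "\<dots> = ennreal (4096 * t ^ 8 * (real p)\<^sup>2)" by (simp add: emeasure_space_1)
  also have "t ^ 8 = (t\<^sup>2) ^ 4" by (simp flip: power_mult)
  also have "4096 * (t\<^sup>2) ^ 4 * (real p)\<^sup>2 = 4096 * (b \<bullet> b) ^ 4 / (real p)\<^sup>2"
    unfolding t2 using p by (simp add: power_divide field_simps power4_eq_xxxx power2_eq_square)
  finally show ?thesis .
qed


section \<open>Quadratic forms in the noise\<close>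

lemma powr_le_one_plus: fixes x a b :: real assumes "0 \<le> x" "0 \<le> a" "a \<le> b" shows "x powr a \<le> 1 + x powr b"
proof (cases "x \<le> 1")
  case True
  then have "x powr a \<le> 1" using assms by (intro powr_le1) auto
  then show ?thesis by (smt (verit) powr_ge_zero)
next
  case False
  then have "x powr a \<le> x powr b" using assms by (intro powr_mono) auto
  then show ?thesis by simp
qed

lemma tendsto_zero_of_power:
  fixes f :: "nat \<Rightarrow> real" assumes "(\<lambda>n. f n ^ 4) \<longlonglongrightarrow> 0" shows "f \<longlonglongrightarrow> 0"
proof -
  have "(\<lambda>n. root 4 (f n ^ 4)) \<longlonglongrightarrow> root 4 0" by (intro tendsto_real_root assms)
  moreover have "root 4 (x ^ 4) = \<bar>x\<bar>" for x :: real
    using real_root_power_cancel[of 4 "\<bar>x\<bar>"] by simp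
  ultimately show ?thesis by (simp add: tendsto_rabs_zero_iff)
qed

lemma tendsto_zero_of_powr:
  fixes f :: "nat \<Rightarrow> real" assumes "(\<lambda>n. \<bar>f n\<bar> powr q) \<longlonglongrightarrow> 0" and q: "0 < q" shows "f \<longlonglongrightarrow> 0"
proof -
  have "(\<lambda>n. (\<bar>f n\<bar> powr q) powr (1 / q)) \<longlonglongrightarrow> 0"
    by (rule tendsto_zero_powrI[OF assms(1) tendsto_const]) (use q in auto)
  then show ?thesis using q by (simp add: powr_powr tendsto_rabs_zero_iff)
qed

locale noisy_design = prob_space +
  fixes p :: "nat \<Rightarrow> nat" and X :: "nat \<Rightarrow> 'a \<Rightarrow> real mat" and \<epsilon> :: "nat \<Rightarrow> 'a \<Rightarrow> real vec"
    and \<sigma> \<eta> K :: real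
  assumes eps_indep_X: "\<And>n. n \<ge> 1 \<Longrightarrow> indep_rv M (borel_vec n) (\<epsilon> n) (borel_mat n (p n)) (X n)"
    and eps_entries: "\<And>n. n \<ge> 1 \<Longrightarrow> indep_vars (\<lambda>_. borel) (\<lambda>i \<omega>. \<epsilon> n \<omega> $ i) {..<n}"
    and eps_mean: "\<And>n i. n \<ge> 1 \<Longrightarrow> i < n \<Longrightarrow> expectation (\<lambda>\<omega>. \<epsilon> n \<omega> $ i) = 0"
    and eps_var: "\<And>n i. n \<ge> 1 \<Longrightarrow> i < n \<Longrightarrow> expectation (\<lambda>\<omega>. (\<epsilon> n \<omega> $ i)\<^sup>2) = \<sigma>\<^sup>2"
    and eta: "\<eta> > 0"
    and eps_moment: "\<And>n i. n \<ge> 1 \<Longrightarrow> i < n \<Longrightarrow>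
          integrable M (\<lambda>\<omega>. \<bar>\<epsilon> n \<omega> $ i\<bar> powr (4 + \<eta>)) \<and>
          expectation (\<lambda>\<omega>. \<bar>\<epsilon> n \<omega> $ i\<bar> powr (4 + \<eta>)) \<le> K"
begin

lemma measurable_eps: "n \<ge> 1 \<Longrightarrow> \<epsilon> n \<in> measurable M (borel_vec n)"
  using eps_indep_X by (simp add: indep_rv_def)

lemma measurable_X: "n \<ge> 1 \<Longrightarrow> X n \<in> measurable M (borel_mat n (p n))"
  using eps_indep_X by (simp add: indep_rv_def)

lemma measurable_eps_entry: "n \<ge> 1 \<Longrightarrow> i < n \<Longrightarrow> (\<lambda>\<omega>. \<epsilon> n \<omega> $ i) \<in> borel_measurable M"
  by (rule measurable_vec_entry[OF measurable_eps])

lemma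
  assumes "n \<ge> 1" "i < n"
  shows integrable_eps_powr: "integrable M (\<lambda>\<omega>. \<bar>\<epsilon> n \<omega> $ i\<bar> powr (4 + \<eta>))"
    and expectation_eps_powr: "expectation (\<lambda>\<omega>. \<bar>\<epsilon> n \<omega> $ i\<bar> powr (4 + \<eta>)) \<le> \<bar>K\<bar>"
  using eps_moment[OF assms] by linarith+

definition fourth_moment_bound :: real where "fourth_moment_bound = 1 + \<bar>K\<bar>"

lemma centred_eps:
  assumes n: "n \<ge> 1"
  shows "centred_indep_fourth M (\<lambda>i \<omega>. \<epsilon> n \<omega> $ i) n fourth_moment_bound"
proof (intro centred_indep_fourth.intro centred_indep_fourth_axioms.intro)
  fix i assume i: "i < n"
  have x4: "x ^ 4 \<le> 1 + \<bar>x\<bar> powr (4 + \<eta>)" for x :: real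
  proof (cases "x = 0")
    case False
    have "x ^ 4 = \<bar>x\<bar> ^ 4" by simp
    also have "\<dots> = \<bar>x\<bar> powr 4" using False powr_realpow[of "\<bar>x\<bar>" 4] by simp
    also have "\<dots> \<le> 1 + \<bar>x\<bar> powr (4 + \<eta>)" using eta by (intro powr_le_one_plus) auto
    finally show ?thesis .
  qed simp
  show int: "integrable M (\<lambda>\<omega>. (\<epsilon> n \<omega> $ i) ^ 4)"
    by (rule Bochner_Integration.integrable_bound[of _ "\<lambda>\<omega>. 1 + \<bar>\<epsilon> n \<omega> $ i\<bar> powr (4 + \<eta>)"])
       (use integrable_eps_powr[OF n i] x4 measurable_eps_entry[OF n i] in auto)
  have "expectation (\<lambda>\<omega>. (\<epsilon> n \<omega> $ i) ^ 4) \<le> expectation (\<lambda>\<omega>. 1 + \<bar>\<epsilon> n \<omega> $ i\<bar> powr (4 + \<eta>))"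
    by (intro integral_mono int) (use integrable_eps_powr[OF n i] x4 in auto)
  also have "\<dots> \<le> fourth_moment_bound" using integrable_eps_powr[OF n i] expectation_eps_powr[OF n i] by (simp add: prob_space fourth_moment_bound_def)
  finally show "expectation (\<lambda>\<omega>. (\<epsilon> n \<omega> $ i) ^ 4) \<le> fourth_moment_bound" .
qed (use eps_entries[OF n] eps_mean[OF n] in \<open>auto simp: fourth_moment_bound_def prob_space_axioms\<close>)

text \<open>
  The exponent for \<open>centred_indep_powr\<close>. The cap at 4 keeps it within \<open>(0, 1]\<close>,
  and the definition makes \<open>2 (2 + 2 surplus) \<le> 4 + \<eta>\<close>, so that \<open>\<epsilon>\<^sub>i\<^sup>2 - \<sigma>\<^sup>2\<close> has a moment of order
  \<open>2 + 2 surplus\<close>.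
\<close>

definition surplus :: real where "surplus = min \<eta> 4 / 4"

lemma surplus: "0 < surplus" "surplus \<le> 1" "4 + 4 * surplus \<le> 4 + \<eta>" using eta by (auto simp: surplus_def)

definition square_dev_bound :: real where "square_dev_bound = 2 powr (2 + 2 * surplus) * (1 + \<bar>K\<bar> + (\<sigma>\<^sup>2) powr (2 + 2 * surplus))"

lemma eps_square_moment:
  assumes n: "n \<ge> 1" and i: "i < n"
  shows "integrable M (\<lambda>\<omega>. \<bar>(\<epsilon> n \<omega> $ i)\<^sup>2 - \<sigma>\<^sup>2\<bar> powr (2 + 2 * surplus))"
    and "expectation (\<lambda>\<omega>. \<bar>(\<epsilon> n \<omega> $ i)\<^sup>2 - \<sigma>\<^sup>2\<bar> powr (2 + 2 * surplus)) \<le> square_dev_bound"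
proof -
  let ?q = "2 + 2 * surplus"
  let ?B = "\<lambda>x. 2 powr ?q * (1 + \<bar>x\<bar> powr (4 + \<eta>) + (\<sigma>\<^sup>2) powr ?q)"
  have le: "\<bar>x\<^sup>2 - \<sigma>\<^sup>2\<bar> powr ?q \<le> ?B x" for x :: real
  proof -
    have "\<bar>x\<^sup>2 - \<sigma>\<^sup>2\<bar> \<le> 2 * max (x\<^sup>2) (\<sigma>\<^sup>2)"
    proof -
      have "\<bar>a - b\<bar> \<le> 2 * max a b" if "0 \<le> a" "0 \<le> b" for a b :: real using that by auto
      then show ?thesis by simp
    qed
    then have "\<bar>x\<^sup>2 - \<sigma>\<^sup>2\<bar> powr ?q \<le> (2 * max (x\<^sup>2) (\<sigma>\<^sup>2)) powr ?q" using surplus by (intro powr_mono2) auto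
    also have "\<dots> = 2 powr ?q * max (x\<^sup>2) (\<sigma>\<^sup>2) powr ?q" by (rule powr_mult) 
    also have "max (x\<^sup>2) (\<sigma>\<^sup>2) powr ?q \<le> (x\<^sup>2) powr ?q + (\<sigma>\<^sup>2) powr ?q" by (auto simp: max_def)
    also have "(x\<^sup>2) powr ?q = \<bar>x\<bar> powr (4 + 4 * surplus)"
    proof (cases "x = 0")
      case False
      then have "x\<^sup>2 = \<bar>x\<bar> powr 2" by simp
      then have "(x\<^sup>2) powr ?q = \<bar>x\<bar> powr (2 * ?q)" by (simp only: powr_powr)
      then show ?thesis by (simp add: algebra_simps)
    qed simp
    also have "\<bar>x\<bar> powr (4 + 4 * surplus) \<le> 1 + \<bar>x\<bar> powr (4 + \<eta>)" using surplus by (intro powr_le_one_plus) auto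
    finally show ?thesis by simp
  qed
  have B0: "0 \<le> ?B x" for x by (intro mult_nonneg_nonneg add_nonneg_nonneg) auto
  have intB: "integrable M (\<lambda>\<omega>. ?B (\<epsilon> n \<omega> $ i))" using integrable_eps_powr[OF n i] by auto
  note [measurable] = measurable_eps_entry[OF n i]
  show int: "integrable M (\<lambda>\<omega>. \<bar>(\<epsilon> n \<omega> $ i)\<^sup>2 - \<sigma>\<^sup>2\<bar> powr ?q)"
  proof (rule Bochner_Integration.integrable_bound[OF intB])
    show "AE \<omega> in M. norm (\<bar>(\<epsilon> n \<omega> $ i)\<^sup>2 - \<sigma>\<^sup>2\<bar> powr ?q) \<le> norm (?B (\<epsilon> n \<omega> $ i))"
      unfolding real_norm_def abs_of_nonneg[OF B0] abs_of_nonneg[OF powr_ge_zero] by (intro AE_I2 le)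
  qed measurable
  have "expectation (\<lambda>\<omega>. \<bar>(\<epsilon> n \<omega> $ i)\<^sup>2 - \<sigma>\<^sup>2\<bar> powr ?q) \<le> expectation (\<lambda>\<omega>. ?B (\<epsilon> n \<omega> $ i))"
    by (intro integral_mono int intB le)
  also have "\<dots> = 2 powr ?q * (1 + expectation (\<lambda>\<omega>. \<bar>\<epsilon> n \<omega> $ i\<bar> powr (4 + \<eta>)) + (\<sigma>\<^sup>2) powr ?q)"
    using integrable_eps_powr[OF n i] by (simp add: prob_space)
  also have "\<dots> \<le> square_dev_bound" unfolding square_dev_bound_def using expectation_eps_powr[OF n i] by (intro mult_left_mono add_mono) auto
  finally show "expectation (\<lambda>\<omega>. \<bar>(\<epsilon> n \<omega> $ i)\<^sup>2 - \<sigma>\<^sup>2\<bar> powr ?q) \<le> square_dev_bound" .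
qed

lemma centred_eps_square:
  assumes n: "n \<ge> 1" and a: "\<And>i. i < n \<Longrightarrow> \<bar>a i\<bar> \<le> c"
  shows "centred_indep_powr M (\<lambda>i \<omega>. a i * ((\<epsilon> n \<omega> $ i)\<^sup>2 - \<sigma>\<^sup>2)) n surplus (1 + c powr (2 + 2 * surplus) * square_dev_bound)"
proof (intro centred_indep_powr.intro centred_indep_powr_axioms.intro)
  show "prob_space M" by (rule prob_space_axioms)
  show "indep_vars (\<lambda>_. borel) (\<lambda>i \<omega>. a i * ((\<epsilon> n \<omega> $ i)\<^sup>2 - \<sigma>\<^sup>2)) {..<n}"
    by (rule indep_vars_compose2[OF eps_entries[OF n], of "\<lambda>i x. a i * (x\<^sup>2 - \<sigma>\<^sup>2)"]) simp
  have mq0: "0 \<le> square_dev_bound" unfolding square_dev_bound_def by (intro mult_nonneg_nonneg add_nonneg_nonneg) auto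
  show "1 \<le> 1 + c powr (2 + 2 * surplus) * square_dev_bound" using mq0 by simp
  show "0 < surplus" "surplus \<le> 1" using surplus by auto
  fix i assume i: "i < n"
  interpret C: centred_indep_fourth M "\<lambda>i \<omega>. \<epsilon> n \<omega> $ i" n fourth_moment_bound by (rule centred_eps[OF n])
  note [measurable] = measurable_eps_entry[OF n i]
  have sq: "integrable M (\<lambda>\<omega>. (\<epsilon> n \<omega> $ i)\<^sup>2)"
    by (rule square_integrable_imp_integrable) (use C.int4[OF i] in \<open>simp_all flip: power_mult\<close>)
  show "expectation (\<lambda>\<omega>. a i * ((\<epsilon> n \<omega> $ i)\<^sup>2 - \<sigma>\<^sup>2)) = 0"
    using sq eps_var[OF n i] by (simp add: prob_space)
  have eq: "\<bar>a i * x\<bar> powr (2 + 2 * surplus) = \<bar>a i\<bar> powr (2 + 2 * surplus) * \<bar>x\<bar> powr (2 + 2 * surplus)" for x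
    unfolding abs_mult by (rule powr_mult)
  show "integrable M (\<lambda>\<omega>. \<bar>a i * ((\<epsilon> n \<omega> $ i)\<^sup>2 - \<sigma>\<^sup>2)\<bar> powr (2 + 2 * surplus))"
    unfolding eq using eps_square_moment(1)[OF n i] by simp
  have "expectation (\<lambda>\<omega>. \<bar>a i * ((\<epsilon> n \<omega> $ i)\<^sup>2 - \<sigma>\<^sup>2)\<bar> powr (2 + 2 * surplus))
      = \<bar>a i\<bar> powr (2 + 2 * surplus) * expectation (\<lambda>\<omega>. \<bar>(\<epsilon> n \<omega> $ i)\<^sup>2 - \<sigma>\<^sup>2\<bar> powr (2 + 2 * surplus))"
    unfolding eq by simp
  also have "\<dots> \<le> c powr (2 + 2 * surplus) * square_dev_bound"
    using a[OF i] surplus by (intro mult_mono powr_mono2 eps_square_moment(2)[OF n i]) auto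
  finally show "expectation (\<lambda>\<omega>. \<bar>a i * ((\<epsilon> n \<omega> $ i)\<^sup>2 - \<sigma>\<^sup>2)\<bar> powr (2 + 2 * surplus)) \<le> 1 + c powr (2 + 2 * surplus) * square_dev_bound"
    by simp
qed

text \<open>
  Given the design, the diagonal part is a sum of independent centred variables with bounded weights,
  and the off-diagonal part is a bilinear form with squared Frobenius norm \<open>O(n)\<close>. Both normalized
  moments are summable in \<open>n\<close>.
\<close>

lemma noise_quadratic_form:
  fixes P :: "nat \<Rightarrow> real mat \<Rightarrow> real mat" and k :: "nat \<Rightarrow> nat"
  assumes meas: "\<And>n. n \<ge> 1 \<Longrightarrow> P n \<in> measurable (borel_mat n (p n)) (borel_mat (k n) n)"
    and c: "0 \<le> c"
    and bd: "\<And>n x v. n \<ge> 1 \<Longrightarrow> x \<in> carrier_mat n (p n) \<Longrightarrow> v \<in> carrier_vec n \<Longrightarrow> (P n x *\<^sub>v v) \<bullet> (P n x *\<^sub>v v) \<le> c * (v \<bullet> v)"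
  shows "AE \<omega> in M. (\<lambda>n. ((P n (X n \<omega>) *\<^sub>v \<epsilon> n \<omega>) \<bullet> (P n (X n \<omega>) *\<^sub>v \<epsilon> n \<omega>) - \<sigma>\<^sup>2 * frob2 (P n (X n \<omega>))) / real n) \<longlonglongrightarrow> 0"
proof -
  define off where "off n x e = (\<Sum>j<n. \<Sum>i<j. col_gram (P n x) i j * e $ i * e $ j) / real n" for n x and e :: "real vec"
  define dg where "dg n x e = (\<Sum>i<n. col_gram (P n x) i i * ((e $ i)\<^sup>2 - \<sigma>\<^sup>2)) / real n" for n x and e :: "real vec"
  let ?q = "2 + 2 * surplus"
  have Pc: "P n x \<in> carrier_mat (k n) n" if "n \<ge> 1" "x \<in> carrier_mat n (p n)" for n x
    using measurable_mat_carrier[OF meas[OF that(1)], of x] that by (simp add: space_borel_mat)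
  have Pm: "(\<lambda>z. P n (fst z)) \<in> measurable (borel_mat n (p n) \<Otimes>\<^sub>M borel_vec n) (borel_mat (k n) n)" if "n \<ge> 1" for n
    by (rule measurable_compose[OF measurable_fst meas[OF that]])
  have offm: "(\<lambda>z. off n (fst z) (snd z)) \<in> borel_measurable (borel_mat n (p n) \<Otimes>\<^sub>M borel_vec n)" if n: "n \<ge> 1" for n
    unfolding off_def
    by (intro borel_measurable_divide borel_measurable_sum borel_measurable_times measurable_col_gram[OF Pm[OF n]]
        measurable_vec_entry[OF measurable_snd] borel_measurable_const) auto
  have dgm: "(\<lambda>z. dg n (fst z) (snd z)) \<in> borel_measurable (borel_mat n (p n) \<Otimes>\<^sub>M borel_vec n)" if n: "n \<ge> 1" for n
    unfolding dg_def
    by (intro borel_measurable_divide borel_measurable_sum borel_measurable_times measurable_col_gram[OF Pm[OF n]]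
        borel_measurable_diff borel_measurable_power
        measurable_vec_entry[OF measurable_snd] borel_measurable_const) auto
  have XE: "(\<lambda>\<omega>. (X n \<omega>, \<epsilon> n \<omega>)) \<in> measurable M (borel_mat n (p n) \<Otimes>\<^sub>M borel_vec n)" if n: "n \<ge> 1" for n
    by (intro measurable_Pair measurable_X measurable_eps n)
  have "AE \<omega> in M. (\<lambda>n. off n (X n \<omega>) (\<epsilon> n \<omega>) ^ 4) \<longlonglongrightarrow> 0"
  proof (rule AE_tendsto_zero_of_summable_nn_integral)
    fix n :: nat assume n: "n \<ge> 1"
    interpret C: centred_indep_fourth M "\<lambda>i \<omega>. \<epsilon> n \<omega> $ i" n fourth_moment_bound by (rule centred_eps[OF n])
    show "(\<lambda>\<omega>. off n (X n \<omega>) (\<epsilon> n \<omega>) ^ 4) \<in> borel_measurable M"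
      using measurable_compose[OF XE[OF n] offm[OF n]] by simp
    have "(\<integral>\<^sup>+\<omega>. ennreal (off n (X n \<omega>) (\<epsilon> n \<omega>) ^ 4) \<partial>M)
        = (\<integral>\<^sup>+\<omega>. (\<integral>\<^sup>+\<omega>'. ennreal (off n (X n \<omega>) (\<epsilon> n \<omega>') ^ 4) \<partial>M) \<partial>M)"
      using nn_integral_indep_rv[OF indep_rv_commute[OF eps_indep_X[OF n]], of "\<lambda>z. ennreal (off n (fst z) (snd z) ^ 4)"] offm[OF n]
      by simp
    also have "\<dots> \<le> (\<integral>\<^sup>+\<omega>. ennreal ((16 * fourth_moment_bound\<^sup>2 * c\<^sup>2)\<^sup>2 * (1 / (real n)\<^sup>2)) \<partial>M)"
    proof (rule nn_integral_mono)
      fix \<omega> assume "\<omega> \<in> space M"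
      then have x: "X n \<omega> \<in> carrier_mat n (p n)" by (rule measurable_mat_carrier[OF measurable_X[OF n]])
      let ?S = "\<lambda>\<omega>'. \<Sum>j<n. \<Sum>i<j. col_gram (P n (X n \<omega>)) i j * \<epsilon> n \<omega>' $ i * \<epsilon> n \<omega>' $ j"
      have "(\<integral>\<^sup>+\<omega>'. ennreal (off n (X n \<omega>) (\<epsilon> n \<omega>') ^ 4) \<partial>M) = (\<integral>\<^sup>+\<omega>'. ennreal (1 / real n ^ 4) * ennreal (?S \<omega>' ^ 4) \<partial>M)"
        unfolding off_def by (intro nn_integral_cong) (simp add: power_divide flip: ennreal_mult')
      also have "\<dots> = ennreal (1 / real n ^ 4) * (\<integral>\<^sup>+\<omega>'. ennreal (?S \<omega>' ^ 4) \<partial>M)"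
        by (intro nn_integral_cmult measurable_compose[OF _ measurable_ennreal] borel_measurable_power
            borel_measurable_sum borel_measurable_times borel_measurable_const C.rv) auto
      also have "\<dots> \<le> ennreal (1 / real n ^ 4) * ennreal ((16 * fourth_moment_bound\<^sup>2 * (\<Sum>j<n. \<Sum>i<j. (col_gram (P n (X n \<omega>)) i j)\<^sup>2))\<^sup>2)"
        by (intro mult_left_mono C.bilinear_form_fourth_moment) auto
      also have "\<dots> \<le> ennreal (1 / real n ^ 4) * ennreal ((16 * fourth_moment_bound\<^sup>2 * (c\<^sup>2 * real n))\<^sup>2)"
        by (intro mult_left_mono ennreal_leI power_mono col_gram_offdiag_bound[OF Pc[OF n x] c bd[OF n x]])
           (auto intro!: sum_nonneg mult_nonneg_nonneg)
      also have "\<dots> = ennreal ((16 * fourth_moment_bound\<^sup>2 * c\<^sup>2)\<^sup>2 * (1 / (real n)\<^sup>2))"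
        using n by (simp add: field_simps power4_eq_xxxx power2_eq_square flip: ennreal_mult')
      finally show "(\<integral>\<^sup>+\<omega>'. ennreal (off n (X n \<omega>) (\<epsilon> n \<omega>') ^ 4) \<partial>M) \<le> ennreal ((16 * fourth_moment_bound\<^sup>2 * c\<^sup>2)\<^sup>2 * (1 / (real n)\<^sup>2))" .
    qed
    finally show "(\<integral>\<^sup>+\<omega>. ennreal (off n (X n \<omega>) (\<epsilon> n \<omega>) ^ 4) \<partial>M) \<le> ennreal ((16 * fourth_moment_bound\<^sup>2 * c\<^sup>2)\<^sup>2 * (1 / (real n)\<^sup>2))"
      by (simp add: emeasure_space_1)
  next
    show "summable (\<lambda>n. (16 * fourth_moment_bound\<^sup>2 * c\<^sup>2)\<^sup>2 * (1 / (real n)\<^sup>2))"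
      using inverse_power_summable[of 2, where 'a = real] by (intro summable_mult) (simp add: inverse_eq_divide)
  qed auto
  moreover have "AE \<omega> in M. (\<lambda>n. \<bar>dg n (X n \<omega>) (\<epsilon> n \<omega>)\<bar> powr ?q) \<longlonglongrightarrow> 0"
  proof (rule AE_tendsto_zero_of_summable_nn_integral)
    let ?m = "1 + c powr ?q * square_dev_bound"
    fix n :: nat assume n: "n \<ge> 1"
    show "(\<lambda>\<omega>. \<bar>dg n (X n \<omega>) (\<epsilon> n \<omega>)\<bar> powr ?q) \<in> borel_measurable M"
      using measurable_compose[OF XE[OF n] dgm[OF n]] by simp
    have "(\<integral>\<^sup>+\<omega>. ennreal (\<bar>dg n (X n \<omega>) (\<epsilon> n \<omega>)\<bar> powr ?q) \<partial>M)
        = (\<integral>\<^sup>+\<omega>. (\<integral>\<^sup>+\<omega>'. ennreal (\<bar>dg n (X n \<omega>) (\<epsilon> n \<omega>')\<bar> powr ?q) \<partial>M) \<partial>M)"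
      using nn_integral_indep_rv[OF indep_rv_commute[OF eps_indep_X[OF n]], of "\<lambda>z. ennreal (\<bar>dg n (fst z) (snd z)\<bar> powr ?q)"] dgm[OF n]
      by simp
    also have "\<dots> \<le> (\<integral>\<^sup>+\<omega>. ennreal ((1 + 144 * ?m\<^sup>2) * real n powr (- (1 + surplus))) \<partial>M)"
    proof (rule nn_integral_mono)
      fix \<omega> assume "\<omega> \<in> space M"
      then have x: "X n \<omega> \<in> carrier_mat n (p n)" by (rule measurable_mat_carrier[OF measurable_X[OF n]])
      let ?a = "\<lambda>i. col_gram (P n (X n \<omega>)) i i"
      have a: "\<bar>?a i\<bar> \<le> c" if "i < n" for i
      proof -
        have "0 \<le> ?a i" by (auto simp: col_gram_def intro!: sum_nonneg)
        then show ?thesis using col_gram_diag_bound[OF Pc[OF n x] c bd[OF n x] that] by simp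
      qed
      interpret D: centred_indep_powr M "\<lambda>i \<omega>'. ?a i * ((\<epsilon> n \<omega>' $ i)\<^sup>2 - \<sigma>\<^sup>2)" n surplus ?m
        by (rule centred_eps_square[OF n a])
      let ?S = "\<lambda>\<omega>'. \<Sum>i<n. ?a i * ((\<epsilon> n \<omega>' $ i)\<^sup>2 - \<sigma>\<^sup>2)"
      have eq: "\<bar>t / real n\<bar> powr ?q = real n powr (- ?q) * \<bar>t\<bar> powr ?q" for t
      proof -
        have "\<bar>t / real n\<bar> powr ?q = \<bar>t\<bar> powr ?q / real n powr ?q" by (simp add: abs_divide powr_divide)
        also have "\<dots> = inverse (real n powr ?q) * \<bar>t\<bar> powr ?q" by (simp add: divide_inverse)
        finally show ?thesis by (simp only: powr_minus)
      qed
      have "(\<integral>\<^sup>+\<omega>'. ennreal (\<bar>dg n (X n \<omega>) (\<epsilon> n \<omega>')\<bar> powr ?q) \<partial>M)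
          = (\<integral>\<^sup>+\<omega>'. ennreal (real n powr (- ?q)) * ennreal (\<bar>?S \<omega>'\<bar> powr ?q) \<partial>M)"
        unfolding dg_def eq by (intro nn_integral_cong) (simp add: ennreal_mult')
      also have "\<dots> = ennreal (real n powr (- ?q)) * (\<integral>\<^sup>+\<omega>'. ennreal (\<bar>?S \<omega>'\<bar> powr ?q) \<partial>M)"
        by (intro nn_integral_cmult measurable_compose[OF _ measurable_ennreal] powr_real_measurable
            borel_measurable_abs borel_measurable_sum borel_measurable_const D.rv) auto
      also have "\<dots> \<le> ennreal (real n powr (- ?q)) * ennreal ((1 + 144 * ?m\<^sup>2) * real n powr (1 + surplus))"
        by (intro mult_left_mono D.sum_powr_moment n) auto
      also have "\<dots> = ennreal ((1 + 144 * ?m\<^sup>2) * real n powr (- (1 + surplus)))"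
      proof -
        have "real n powr (- ?q) * real n powr (1 + surplus) = real n powr (- (1 + surplus))"
          unfolding powr_add[symmetric] by simp
        then show ?thesis by (simp add: mult.left_commute flip: ennreal_mult')
      qed
      finally show "(\<integral>\<^sup>+\<omega>'. ennreal (\<bar>dg n (X n \<omega>) (\<epsilon> n \<omega>')\<bar> powr ?q) \<partial>M)
        \<le> ennreal ((1 + 144 * ?m\<^sup>2) * real n powr (- (1 + surplus)))" .
    qed
    finally show "(\<integral>\<^sup>+\<omega>. ennreal (\<bar>dg n (X n \<omega>) (\<epsilon> n \<omega>)\<bar> powr ?q) \<partial>M)
        \<le> ennreal ((1 + 144 * ?m\<^sup>2) * real n powr (- (1 + surplus)))"
      by (simp add: emeasure_space_1)
  next
    show "summable (\<lambda>n. (1 + 144 * (1 + c powr ?q * square_dev_bound)\<^sup>2) * real n powr (- (1 + surplus)))"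
      using surplus by (intro summable_mult) (simp add: summable_real_powr_iff)
  qed auto
  ultimately show ?thesis using AE_space
  proof (eventually_elim, goal_cases)
    case (1 \<omega>)
    have "(\<lambda>n. dg n (X n \<omega>) (\<epsilon> n \<omega>) + 2 * off n (X n \<omega>) (\<epsilon> n \<omega>)) \<longlonglongrightarrow> 0 + 2 * 0"
      using surplus by (intro tendsto_add tendsto_mult tendsto_const tendsto_zero_of_power[OF 1(1)] tendsto_zero_of_powr[OF 1(2)]) auto
    then have lim: "(\<lambda>n. dg n (X n \<omega>) (\<epsilon> n \<omega>) + 2 * off n (X n \<omega>) (\<epsilon> n \<omega>)) \<longlonglongrightarrow> 0" by simp
    show ?case
    proof (rule Lim_transform_eventually[OF lim], rule eventually_sequentiallyI[of 1])
      fix n :: nat assume n: "1 \<le> n"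
      note A = Pc[OF n measurable_mat_carrier[OF measurable_X[OF n] 1(3)]]
      note e = measurable_vec_carrier[OF measurable_eps[OF n] 1(3)]
      show "dg n (X n \<omega>) (\<epsilon> n \<omega>) + 2 * off n (X n \<omega>) (\<epsilon> n \<omega>)
        = ((P n (X n \<omega>) *\<^sub>v \<epsilon> n \<omega>) \<bullet> (P n (X n \<omega>) *\<^sub>v \<epsilon> n \<omega>) - \<sigma>\<^sup>2 * frob2 (P n (X n \<omega>))) / real n"
        unfolding norm_mult_mat_vec_split[OF A e] sum_col_gram_frob2[OF A, symmetric] dg_def off_def
        by (simp add: right_diff_distrib sum_subtractf sum_distrib_left mult.commute add_divide_distrib diff_divide_distrib)
    qed
  qed
qed

end


section \<open>The three terms of the estimation error\<close>

locale ridge_model = noisy_design +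
  fixes \<beta> :: "nat \<Rightarrow> 'a \<Rightarrow> real vec" and Q D V :: "nat \<Rightarrow> 'a \<Rightarrow> real mat" and \<gamma> r :: real
  assumes dims: "\<And>n. n \<ge> 1 \<Longrightarrow> p n \<ge> 1"
    and gamma: "\<gamma> > 0" "(\<lambda>n. real (p n) / real n) \<longlonglongrightarrow> \<gamma>"
    and X_inv: "\<And>n. n \<ge> 1 \<Longrightarrow> right_rot_invariant M n (p n) (X n)"
    and X_svd: "\<And>n \<omega>. n \<ge> 1 \<Longrightarrow> \<omega> \<in> space M \<Longrightarrow> is_svd n (p n) (X n \<omega>) (Q n \<omega>) (D n \<omega>) (V n \<omega>)"
    and beta_norm: "\<And>n. n \<ge> 1 \<Longrightarrow> AE \<omega> in M. l2norm (\<beta> n \<omega>) = r * sqrt (real n)"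
    and beta_indep: "\<And>n. n \<ge> 1 \<Longrightarrow>
          indep_rv M (borel_vec (p n)) (\<beta> n)
            (borel_mat n (p n) \<Otimes>\<^sub>M borel_vec n) (\<lambda>\<omega>. (X n \<omega>, \<epsilon> n \<omega>))"
begin

lemma measurable_beta: "n \<ge> 1 \<Longrightarrow> \<beta> n \<in> measurable M (borel_vec (p n))"
  using beta_indep by (simp add: indep_rv_def)

lemma beta_square: assumes "n \<ge> 1" shows "AE \<omega> in M. \<beta> n \<omega> \<bullet> \<beta> n \<omega> = r\<^sup>2 * real n"
  using beta_norm[OF assms]
proof eventually_elim
  case (elim \<omega>)
  then have "(l2norm (\<beta> n \<omega>))\<^sup>2 = r\<^sup>2 * real n" by (simp add: power_mult_distrib)
  then show ?case by (simp add: l2norm_def scalar_prod_self_nonneg)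
qed

lemma ratio_inverse: "(\<lambda>n. real n / real (p n)) \<longlonglongrightarrow> 1 / \<gamma>"
  using tendsto_divide[OF tendsto_const[of 1] gamma(2)] gamma(1) by simp

text \<open>
  Since \<open>p\<close> grows proportionally to \<open>n\<close>, this compares with the sum of \<open>1 / n\<^sup>2\<close>.
\<close>

lemma summable_inverse_p: "summable (\<lambda>n. C / (real (p n))\<^sup>2)"
proof (rule summable_comparison_test_ev)
  have "\<forall>\<^sub>F n in sequentially. \<gamma> / 2 < real (p n) / real n"
    using gamma by (intro order_tendstoD(1)[OF gamma(2)]) auto
  then show "\<forall>\<^sub>F n in sequentially. norm (C / (real (p n))\<^sup>2) \<le> (\<bar>C\<bar> / (\<gamma> / 2)\<^sup>2) * (1 / (real n)\<^sup>2)"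
    using eventually_gt_at_top[of 0]
  proof eventually_elim
    case (elim n)
    then have "\<gamma> / 2 * real n \<le> real (p n)" by (simp add: field_simps)
    then have "(\<gamma> / 2 * real n)\<^sup>2 \<le> (real (p n))\<^sup>2" using gamma(1) by (intro power_mono) auto
    moreover have "0 < (\<gamma> / 2 * real n)\<^sup>2" using gamma(1) elim by simp
    ultimately have "\<bar>C\<bar> / (real (p n))\<^sup>2 \<le> \<bar>C\<bar> / (\<gamma> / 2 * real n)\<^sup>2"
      by (intro divide_left_mono mult_pos_pos) linarith+
    moreover have "(\<bar>C\<bar> / (\<gamma> / 2)\<^sup>2) * (1 / (real n)\<^sup>2) = \<bar>C\<bar> / (\<gamma> / 2 * real n)\<^sup>2"
      by (simp only: power_mult_distrib times_divide_times_eq mult_1_right)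
    ultimately show ?case by (simp only: real_norm_def abs_divide abs_power2)
  qed
  show "summable (\<lambda>n. (\<bar>C\<bar> / (\<gamma> / 2)\<^sup>2) * (1 / (real n)\<^sup>2))"
    using inverse_power_summable[of 2, where 'a = real] by (intro summable_mult) (simp add: inverse_eq_divide)
qed

lemma signal_term:
  assumes l: "0 < l"
  shows "AE \<omega> in M. (\<lambda>n. quad_dev (p n) l (\<beta> n \<omega>) (X n \<omega>) / real n) \<longlonglongrightarrow> 0"
proof -
  have "AE \<omega> in M. (\<lambda>n. (quad_dev (p n) l (\<beta> n \<omega>) (X n \<omega>) / real n) ^ 4) \<longlonglongrightarrow> 0"
  proof (rule AE_tendsto_zero_of_summable_nn_integral)
    fix n :: nat assume n: "n \<ge> 1"
    let ?F = "\<lambda>z. ennreal ((quad_dev (p n) l (fst z) (fst (snd z)) / real n) ^ 4)"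
    have Fm: "?F \<in> borel_measurable (borel_vec (p n) \<Otimes>\<^sub>M (borel_mat n (p n) \<Otimes>\<^sub>M borel_vec n))"
      by (intro measurable_compose[OF _ measurable_ennreal] borel_measurable_power borel_measurable_divide
          borel_measurable_const measurable_quad_dev[of _ _ n] measurable_compose[OF measurable_snd measurable_fst]
          measurable_fst l)
    show "(\<lambda>\<omega>. (quad_dev (p n) l (\<beta> n \<omega>) (X n \<omega>) / real n) ^ 4) \<in> borel_measurable M"
      by (intro borel_measurable_power borel_measurable_divide borel_measurable_const
          measurable_quad_dev[OF measurable_X[OF n] measurable_beta[OF n] l])
    have "(\<integral>\<^sup>+\<omega>. ennreal ((quad_dev (p n) l (\<beta> n \<omega>) (X n \<omega>) / real n) ^ 4) \<partial>M)
        = (\<integral>\<^sup>+\<omega>. (\<integral>\<^sup>+\<omega>'. ennreal ((quad_dev (p n) l (\<beta> n \<omega>) (X n \<omega>') / real n) ^ 4) \<partial>M) \<partial>M)"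
      using nn_integral_indep_rv[OF beta_indep[OF n] Fm] by simp
    also have "\<dots> \<le> (\<integral>\<^sup>+\<omega>. ennreal (4096 * r ^ 8 / (real (p n))\<^sup>2) \<partial>M)"
    proof (rule nn_integral_mono_AE)
      show "AE \<omega> in M. (\<integral>\<^sup>+\<omega>'. ennreal ((quad_dev (p n) l (\<beta> n \<omega>) (X n \<omega>') / real n) ^ 4) \<partial>M)
          \<le> ennreal (4096 * r ^ 8 / (real (p n))\<^sup>2)"
        using beta_square[OF n] AE_space
      proof eventually_elim
        case (elim \<omega>)
        have b: "\<beta> n \<omega> \<in> carrier_vec (p n)" by (rule measurable_vec_carrier[OF measurable_beta[OF n] elim(2)])
        have bm: "(\<lambda>_. \<beta> n \<omega>) \<in> measurable M (borel_vec (p n))"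
          by (rule measurable_const) (simp add: space_borel_vec b)
        have "(\<integral>\<^sup>+\<omega>'. ennreal ((quad_dev (p n) l (\<beta> n \<omega>) (X n \<omega>') / real n) ^ 4) \<partial>M)
          = (\<integral>\<^sup>+\<omega>'. ennreal (1 / real n ^ 4) * ennreal (quad_dev (p n) l (\<beta> n \<omega>) (X n \<omega>') ^ 4) \<partial>M)"
          by (intro nn_integral_cong) (simp add: power_divide flip: ennreal_mult')
        also have "\<dots> = ennreal (1 / real n ^ 4) * (\<integral>\<^sup>+\<omega>'. ennreal (quad_dev (p n) l (\<beta> n \<omega>) (X n \<omega>') ^ 4) \<partial>M)"
          by (intro nn_integral_cmult measurable_compose[OF _ measurable_ennreal] borel_measurable_power
              measurable_quad_dev[OF measurable_X[OF n] bm l])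
        also have "\<dots> \<le> ennreal (1 / real n ^ 4) * ennreal (4096 * (\<beta> n \<omega> \<bullet> \<beta> n \<omega>) ^ 4 / (real (p n))\<^sup>2)"
          by (intro mult_left_mono quad_dev_fourth_moment[OF X_inv[OF n] l dims[OF n] b prob_space_axioms]) simp
        also have "\<dots> = ennreal (1 / real n ^ 4 * (4096 * (r\<^sup>2 * real n) ^ 4 / (real (p n))\<^sup>2))"
          unfolding elim(1) by (rule ennreal_mult'[symmetric]) simp
        also have "1 / real n ^ 4 * (4096 * (r\<^sup>2 * real n) ^ 4 / (real (p n))\<^sup>2) = 4096 * r ^ 8 / (real (p n))\<^sup>2"
          using n by (simp add: power_mult_distrib flip: power_mult)
        finally show ?case .
      qed
    qed
    finally show "(\<integral>\<^sup>+\<omega>. ennreal ((quad_dev (p n) l (\<beta> n \<omega>) (X n \<omega>) / real n) ^ 4) \<partial>M)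
      \<le> ennreal (4096 * r ^ 8 / (real (p n))\<^sup>2)" by (simp add: emeasure_space_1)
  qed (auto intro!: summable_inverse_p)
  then show ?thesis by eventually_elim (rule tendsto_zero_of_power)
qed

lemma noise_term:
  assumes l: "0 < l"
  defines "P \<equiv> \<lambda>x. resolvent x l * transpose_mat x"
  shows "AE \<omega> in M. (\<lambda>n. ((P (X n \<omega>) *\<^sub>v \<epsilon> n \<omega>) \<bullet> (P (X n \<omega>) *\<^sub>v \<epsilon> n \<omega>) - \<sigma>\<^sup>2 * frob2 (P (X n \<omega>))) / real n) \<longlonglongrightarrow> 0"
proof (rule noise_quadratic_form[of "\<lambda>n. P" p "1 / (4 * l)"])
  fix n
  have id: "(\<lambda>A. A) \<in> measurable (borel_mat n (p n)) (borel_mat n (p n))" by simp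
  show "P \<in> measurable (borel_mat n (p n)) (borel_mat (p n) n)"
    unfolding P_def by (intro measurable_mat_mult[OF measurable_resolvent[OF id l]] measurable_mat_transpose[OF id])
  fix x :: "real mat" and v :: "real vec" assume "x \<in> carrier_mat n (p n)" "v \<in> carrier_vec n"
  then show "(P x *\<^sub>v v) \<bullet> (P x *\<^sub>v v) \<le> 1 / (4 * l) * (v \<bullet> v)"
    unfolding P_def by (intro resolvent_transpose_bound l)
qed (use l in simp)

text \<open>
  The law of large numbers for the squared noise is the case of the identity matrix.
\<close>

lemma noise_norm: "AE \<omega> in M. (\<lambda>n. (\<epsilon> n \<omega> \<bullet> \<epsilon> n \<omega>) / real n) \<longlonglongrightarrow> \<sigma>\<^sup>2"
proof -
  have "AE \<omega> in M. (\<lambda>n. ((1\<^sub>m n *\<^sub>v \<epsilon> n \<omega>) \<bullet> (1\<^sub>m n *\<^sub>v \<epsilon> n \<omega>) - \<sigma>\<^sup>2 * frob2 (1\<^sub>m n)) / real n) \<longlonglongrightarrow> 0"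
    by (rule noise_quadratic_form[of "\<lambda>n _. 1\<^sub>m n" "\<lambda>n. n" 1]) (auto simp: space_borel_mat intro!: measurable_const)
  then show ?thesis using AE_space
  proof eventually_elim
    case (elim \<omega>)
    from tendsto_add[OF elim(1) tendsto_const[of "\<sigma>\<^sup>2"]]
    have lim: "(\<lambda>n. ((1\<^sub>m n *\<^sub>v \<epsilon> n \<omega>) \<bullet> (1\<^sub>m n *\<^sub>v \<epsilon> n \<omega>) - \<sigma>\<^sup>2 * frob2 (1\<^sub>m n)) / real n + \<sigma>\<^sup>2) \<longlonglongrightarrow> \<sigma>\<^sup>2" by simp
    show ?case
    proof (rule Lim_transform_eventually[OF lim], rule eventually_sequentiallyI[of 1])
      fix n :: nat assume n: "1 \<le> n"
      have e: "\<epsilon> n \<omega> \<in> carrier_vec n" by (rule measurable_vec_carrier[OF measurable_eps[OF n] elim(2)])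
      have "frob2 (1\<^sub>m n) = real n" by (simp add: frob2_cols)
      then show "((1\<^sub>m n *\<^sub>v \<epsilon> n \<omega>) \<bullet> (1\<^sub>m n *\<^sub>v \<epsilon> n \<omega>) - \<sigma>\<^sup>2 * frob2 (1\<^sub>m n)) / real n + \<sigma>\<^sup>2
        = (\<epsilon> n \<omega> \<bullet> \<epsilon> n \<omega>) / real n"
        using n e by (simp add: field_simps)
    qed
  qed
qed

definition cross :: "real \<Rightarrow> real mat \<Rightarrow> real vec \<Rightarrow> real vec \<Rightarrow> real" where
  "cross l x b e = ((resolvent x l * transpose_mat x) *\<^sub>v e) \<bullet> ((l \<cdot>\<^sub>m resolvent x l) *\<^sub>v b)"

text \<open>
  With the design and the signal fixed, the cross term is linear in the noise with a coefficient
  vector of squared norm at most \<open>|b|\<^sup>2 / (4 l)\<close>.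
\<close>

lemma cross_fourth_moment:
  assumes n: "n \<ge> 1" and x: "x \<in> carrier_mat n (p n)" and b: "b \<in> carrier_vec (p n)" and l: "0 < l"
  shows "(\<integral>\<^sup>+\<omega>. ennreal (cross l x b (\<epsilon> n \<omega>) ^ 4) \<partial>M) \<le> ennreal ((fourth_moment_bound / l * (b \<bullet> b))\<^sup>2)"
proof -
  interpret C: centred_indep_fourth M "\<lambda>i \<omega>. \<epsilon> n \<omega> $ i" n fourth_moment_bound by (rule centred_eps[OF n])
  let ?P = "resolvent x l * transpose_mat x" and ?Hb = "(l \<cdot>\<^sub>m resolvent x l) *\<^sub>v b"
  have G: "resolvent x l \<in> carrier_mat (p n) (p n)" by (rule resolvent_carrier[OF x l])
  have P: "?P \<in> carrier_mat (p n) n" using G x by simp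
  have Hb: "?Hb \<in> carrier_vec (p n)" using G b by (intro mult_mat_vec_carrier[of _ "p n" "p n"]) auto
  define w where "w = transpose_mat ?P *\<^sub>v ?Hb"
  have w: "w \<in> carrier_vec n" unfolding w_def using P Hb by (intro mult_mat_vec_carrier[of _ n "p n"]) auto
  have "w \<bullet> w \<le> 1 / (4 * l) * (?Hb \<bullet> ?Hb)"
    unfolding w_def using l by (intro transpose_op_bound[OF P _ resolvent_transpose_bound[OF x l] Hb]) auto
  also have "\<dots> \<le> 1 / (4 * l) * (b \<bullet> b)"
    using smult_resolvent_bound[OF x l b] l by (intro mult_left_mono) auto
  finally have ww: "(\<Sum>i<n. (w $ i)\<^sup>2) \<le> 1 / (4 * l) * (b \<bullet> b)" by (simp add: scalar_prod_self_sum[OF w])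
  have "(\<integral>\<^sup>+\<omega>. ennreal (cross l x b (\<epsilon> n \<omega>) ^ 4) \<partial>M) = (\<integral>\<^sup>+\<omega>. ennreal ((\<Sum>i<n. w $ i * \<epsilon> n \<omega> $ i) ^ 4) \<partial>M)"
  proof (rule nn_integral_cong)
    fix \<omega> assume "\<omega> \<in> space M"
    note e = measurable_vec_carrier[OF measurable_eps[OF n] this]
    have "cross l x b (\<epsilon> n \<omega>) = \<epsilon> n \<omega> \<bullet> w"
      unfolding cross_def w_def by (rule transpose_scalar_prod[OF P e Hb])
    also have "\<dots> = (\<Sum>i<n. w $ i * \<epsilon> n \<omega> $ i)"
      using w by (simp add: scalar_prod_def atLeast0LessThan mult.commute)
    finally show "ennreal (cross l x b (\<epsilon> n \<omega>) ^ 4) = ennreal ((\<Sum>i<n. w $ i * \<epsilon> n \<omega> $ i) ^ 4)" by simp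
  qed
  also have "\<dots> \<le> ennreal ((4 * fourth_moment_bound * (\<Sum>i<n. (w $ i)\<^sup>2))\<^sup>2)"
    by (rule C.linear_form_fourth_moment) simp
  also have "\<dots> \<le> ennreal ((4 * fourth_moment_bound * (1 / (4 * l) * (b \<bullet> b)))\<^sup>2)"
    using C.m1 by (intro ennreal_leI power_mono mult_left_mono ww) (auto intro!: mult_nonneg_nonneg sum_nonneg)
  also have "4 * fourth_moment_bound * (1 / (4 * l) * (b \<bullet> b)) = fourth_moment_bound / l * (b \<bullet> b)" by simp
  finally show ?thesis .
qed

text \<open>
  The signal is independent of the pair of design and noise, and the noise of the design. Integrating
  out the noise first leaves a bound that depends on \<open>|\<beta>|\<^sup>2 = r\<^sup>2 n\<close> only.
\<close>

lemma cross_term: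
  assumes l: "0 < l"
  shows "AE \<omega> in M. (\<lambda>n. cross l (X n \<omega>) (\<beta> n \<omega>) (\<epsilon> n \<omega>) / real n) \<longlonglongrightarrow> 0"
proof -
  have "AE \<omega> in M. (\<lambda>n. (cross l (X n \<omega>) (\<beta> n \<omega>) (\<epsilon> n \<omega>) / real n) ^ 4) \<longlonglongrightarrow> 0"
  proof (rule AE_tendsto_zero_of_summable_nn_integral)
    fix n :: nat assume n: "n \<ge> 1"
    have cm: "(\<lambda>\<omega>. cross l (f \<omega>) (g \<omega>) (h \<omega>)) \<in> borel_measurable N"
      if "f \<in> measurable N (borel_mat n (p n))" "g \<in> measurable N (borel_vec (p n))" "h \<in> measurable N (borel_vec n)"
      for f g h and N :: "'b measure"
      unfolding cross_def
      by (intro measurable_scalar_prod[of _ _ "p n"] measurable_mult_mat_vec[of _ _ "p n" n] measurable_mult_mat_vec[of _ _ "p n" "p n"]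
          measurable_mat_mult[of _ _ "p n" "p n"] measurable_mat_smult measurable_resolvent[OF _ l]
          measurable_mat_transpose that) (rule that)+
    let ?F = "\<lambda>z. ennreal ((cross l (fst (snd z)) (fst z) (snd (snd z)) / real n) ^ 4)"
    have Fm: "?F \<in> borel_measurable (borel_vec (p n) \<Otimes>\<^sub>M (borel_mat n (p n) \<Otimes>\<^sub>M borel_vec n))"
      by (intro measurable_compose[OF _ measurable_ennreal] borel_measurable_power borel_measurable_divide
          borel_measurable_const cm measurable_compose[OF measurable_snd measurable_fst]
          measurable_compose[OF measurable_snd measurable_snd] measurable_fst)
    show "(\<lambda>\<omega>. (cross l (X n \<omega>) (\<beta> n \<omega>) (\<epsilon> n \<omega>) / real n) ^ 4) \<in> borel_measurable M"
      by (intro borel_measurable_power borel_measurable_divide borel_measurable_const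
          cm measurable_X measurable_beta measurable_eps n)
    have "(\<integral>\<^sup>+\<omega>. ennreal ((cross l (X n \<omega>) (\<beta> n \<omega>) (\<epsilon> n \<omega>) / real n) ^ 4) \<partial>M)
        = (\<integral>\<^sup>+\<omega>. (\<integral>\<^sup>+\<omega>'. ennreal ((cross l (X n \<omega>') (\<beta> n \<omega>) (\<epsilon> n \<omega>') / real n) ^ 4) \<partial>M) \<partial>M)"
      using nn_integral_indep_rv[OF beta_indep[OF n] Fm] by simp
    also have "\<dots> \<le> (\<integral>\<^sup>+\<omega>. ennreal ((fourth_moment_bound / l * r\<^sup>2)\<^sup>2 * (1 / (real n)\<^sup>2)) \<partial>M)"
    proof (rule nn_integral_mono_AE)
      show "AE \<omega> in M. (\<integral>\<^sup>+\<omega>'. ennreal ((cross l (X n \<omega>') (\<beta> n \<omega>) (\<epsilon> n \<omega>') / real n) ^ 4) \<partial>M)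
          \<le> ennreal ((fourth_moment_bound / l * r\<^sup>2)\<^sup>2 * (1 / (real n)\<^sup>2))"
        using beta_square[OF n] AE_space
      proof eventually_elim
        case (elim \<omega>)
        have b: "\<beta> n \<omega> \<in> carrier_vec (p n)" by (rule measurable_vec_carrier[OF measurable_beta[OF n] elim(2)])
        have bm: "(\<lambda>_. \<beta> n \<omega>) \<in> measurable N (borel_vec (p n))" for N :: "'b measure"
          by (rule measurable_const) (simp add: space_borel_vec b)
        let ?c = "\<lambda>\<omega>' \<omega>''. cross l (X n \<omega>') (\<beta> n \<omega>) (\<epsilon> n \<omega>'')"
        have Gm: "(\<lambda>z. ennreal (cross l (fst z) (\<beta> n \<omega>) (snd z) ^ 4)) \<in> borel_measurable (borel_mat n (p n) \<Otimes>\<^sub>M borel_vec n)"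
          by (intro measurable_compose[OF _ measurable_ennreal] borel_measurable_power cm measurable_fst measurable_snd bm)
        have "(\<integral>\<^sup>+\<omega>'. ennreal ((?c \<omega>' \<omega>' / real n) ^ 4) \<partial>M)
          = (\<integral>\<^sup>+\<omega>'. ennreal (1 / real n ^ 4) * ennreal (?c \<omega>' \<omega>' ^ 4) \<partial>M)"
          by (intro nn_integral_cong) (simp add: power_divide flip: ennreal_mult')
        also have "\<dots> = ennreal (1 / real n ^ 4) * (\<integral>\<^sup>+\<omega>'. ennreal (?c \<omega>' \<omega>' ^ 4) \<partial>M)"
          by (intro nn_integral_cmult measurable_compose[OF _ measurable_ennreal] borel_measurable_power
              cm measurable_X measurable_eps bm n)
        also have "(\<integral>\<^sup>+\<omega>'. ennreal (?c \<omega>' \<omega>' ^ 4) \<partial>M) = (\<integral>\<^sup>+\<omega>'. (\<integral>\<^sup>+\<omega>''. ennreal (?c \<omega>' \<omega>'' ^ 4) \<partial>M) \<partial>M)"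
          using nn_integral_indep_rv[OF indep_rv_commute[OF eps_indep_X[OF n]] Gm] by simp
        also have "\<dots> \<le> (\<integral>\<^sup>+\<omega>'. ennreal ((fourth_moment_bound / l * (\<beta> n \<omega> \<bullet> \<beta> n \<omega>))\<^sup>2) \<partial>M)"
          by (intro nn_integral_mono cross_fourth_moment[OF n _ b l] measurable_mat_carrier[OF measurable_X[OF n]])
        also have "\<dots> = ennreal ((fourth_moment_bound / l * (r\<^sup>2 * real n))\<^sup>2)" unfolding elim(1) by (simp add: emeasure_space_1)
        also have "ennreal (1 / real n ^ 4) * ennreal ((fourth_moment_bound / l * (r\<^sup>2 * real n))\<^sup>2)
            = ennreal (1 / real n ^ 4 * (fourth_moment_bound / l * (r\<^sup>2 * real n))\<^sup>2)"
          by (rule ennreal_mult'[symmetric]) simp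
        also have "1 / real n ^ 4 * (fourth_moment_bound / l * (r\<^sup>2 * real n))\<^sup>2 = (fourth_moment_bound / l * r\<^sup>2)\<^sup>2 * (1 / (real n)\<^sup>2)"
          using n by (simp add: field_simps power4_eq_xxxx power2_eq_square)
        finally show ?case by (simp add: mult_left_mono)
      qed
    qed
    finally show "(\<integral>\<^sup>+\<omega>. ennreal ((cross l (X n \<omega>) (\<beta> n \<omega>) (\<epsilon> n \<omega>) / real n) ^ 4) \<partial>M)
      \<le> ennreal ((fourth_moment_bound / l * r\<^sup>2)\<^sup>2 * (1 / (real n)\<^sup>2))" by (simp add: emeasure_space_1)
  next
    show "summable (\<lambda>n. (fourth_moment_bound / l * r\<^sup>2)\<^sup>2 * (1 / (real n)\<^sup>2))"
      using inverse_power_summable[of 2, where 'a = real] by (intro summable_mult) (simp add: inverse_eq_divide)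
  qed auto
  then show ?thesis by eventually_elim (rule tendsto_zero_of_power)
qed

end


section \<open>Dependence of the error on the penalty\<close>

lemma scalar_prod_add_self_le:
  fixes v w :: "real vec" assumes "v \<in> carrier_vec k" "w \<in> carrier_vec k"
  shows "(v + w) \<bullet> (v + w) \<le> 2 * (v \<bullet> v) + 2 * (w \<bullet> w)"
    and "(v - w) \<bullet> (v - w) \<le> 2 * (v \<bullet> v) + 2 * (w \<bullet> w)"
proof -
  have le: "(x + y)\<^sup>2 \<le> 2 * x\<^sup>2 + 2 * y\<^sup>2" "(x - y)\<^sup>2 \<le> 2 * x\<^sup>2 + 2 * y\<^sup>2" for x y :: real
    using sum_squares_bound[of x y] sum_squares_bound[of x "- y"] by (auto simp: power2_sum power2_diff)
  have R: "2 * (v \<bullet> v) + 2 * (w \<bullet> w) = (\<Sum>i<k. 2 * (v $ i)\<^sup>2 + 2 * (w $ i)\<^sup>2)"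
    using assms by (simp add: scalar_prod_self_sum sum.distrib sum_distrib_left)
  have "(v + w) \<bullet> (v + w) = (\<Sum>i<k. (v $ i + w $ i)\<^sup>2)"
    using assms by (subst scalar_prod_self_sum[of _ k]) auto
  then show "(v + w) \<bullet> (v + w) \<le> 2 * (v \<bullet> v) + 2 * (w \<bullet> w)"
    unfolding R by (simp only:) (intro sum_mono le)
  have "(v - w) \<bullet> (v - w) = (\<Sum>i<k. (v $ i - w $ i)\<^sup>2)"
    using assms by (subst scalar_prod_self_sum[of _ k]) auto
  then show "(v - w) \<bullet> (v - w) \<le> 2 * (v \<bullet> v) + 2 * (w \<bullet> w)"
    unfolding R by (simp only:) (intro sum_mono le)
qed

definition ridge_sq_error :: "real mat \<Rightarrow> real vec \<Rightarrow> real vec \<Rightarrow> real \<Rightarrow> real" where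
  "ridge_sq_error X b e l = (ridge X (X *\<^sub>v b + e) l - b) \<bullet> (ridge X (X *\<^sub>v b + e) l - b)"

context
  fixes X :: "real mat" and n p :: nat and b e :: "real vec"
  assumes X: "X \<in> carrier_mat n p" and b: "b \<in> carrier_vec p" and e: "e \<in> carrier_vec n"
begin

abbreviation (input) est :: "real \<Rightarrow> real vec" where "est l \<equiv> ridge X (X *\<^sub>v b + e) l"

lemma ridge_carrier:
  assumes l: "0 < l" shows "est l \<in> carrier_vec p"
  by (rule carrier_vecI) (simp add: ridge_resolvent carrier_matD(1)[OF resolvent_carrier[OF X l]])

lemma ridge_error_carriers:
  assumes l: "0 < l"
  shows "(resolvent X l * transpose_mat X) *\<^sub>v e \<in> carrier_vec p" "(l \<cdot>\<^sub>m resolvent X l) *\<^sub>v b \<in> carrier_vec p"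
  by (rule carrier_vecI, simp add: carrier_matD(1)[OF resolvent_carrier[OF X l]])+

lemma ridge_error_norm:
  assumes l: "0 < l"
  shows "ridge_sq_error X b e l
    = ((resolvent X l * transpose_mat X) *\<^sub>v e) \<bullet> ((resolvent X l * transpose_mat X) *\<^sub>v e)
      - 2 * (((resolvent X l * transpose_mat X) *\<^sub>v e) \<bullet> ((l \<cdot>\<^sub>m resolvent X l) *\<^sub>v b))
      + ((l \<cdot>\<^sub>m resolvent X l) *\<^sub>v b) \<bullet> ((l \<cdot>\<^sub>m resolvent X l) *\<^sub>v b)"
proof -
  have "(v - w) \<bullet> (v - w) = v \<bullet> v - 2 * (v \<bullet> w) + w \<bullet> w" if "v \<in> carrier_vec p" "w \<in> carrier_vec p" for v w :: "real vec"
    using that by (simp add: minus_scalar_prod_distrib[of _ p] scalar_prod_minus_distrib[of _ p] comm_scalar_prod[of w p v])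
  from this[OF ridge_error_carriers[OF l]] show ?thesis unfolding ridge_sq_error_def ridge_error[OF X l b e] .
qed

lemma ridge_error_bound:
  assumes l: "0 < l" shows "(est l - b) \<bullet> (est l - b) \<le> 1 / (2 * l) * (e \<bullet> e) + 2 * (b \<bullet> b)"
proof -
  have "(est l - b) \<bullet> (est l - b) \<le> 2 * (1 / (4 * l) * (e \<bullet> e)) + 2 * (1 * (b \<bullet> b))"
    unfolding ridge_error[OF X l b e]
    by (intro order_trans[OF scalar_prod_add_self_le(2)[OF ridge_error_carriers[OF l]]] add_mono mult_left_mono
        resolvent_transpose_bound[OF X l e] smult_resolvent_bound[OF X l b]) auto
  then show ?thesis by simp
qed

text \<open>
  The resolvent identity: \<open>(X\<^sup>T X + k I) (b\<^sub>k - b\<^sub>l) = (l - k) b\<^sub>l\<close> for the estimators \<open>b\<^sub>k\<close>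
  and \<open>b\<^sub>l\<close>.
\<close>

lemma ridge_diff_bound:
  assumes l: "0 < l" and k: "0 < k"
  shows "k\<^sup>2 * ((est k - est l) \<bullet> (est k - est l)) \<le> (l - k)\<^sup>2 * (est l \<bullet> est l)"
proof -
  note ck = ridge_carrier[OF k] and cl = ridge_carrier[OF l]
  let ?z = "transpose_mat X *\<^sub>v (X *\<^sub>v b + e)"
  have z: "?z \<in> carrier_vec p" using X by (intro carrier_vecI) simp
  have el: "ridge_gram X l *\<^sub>v est l = ?z" unfolding ridge_resolvent by (rule ridge_gram_resolvent_vec[OF X l z])
  have tl: "transpose_mat X *\<^sub>v (X *\<^sub>v est l) \<in> carrier_vec p" using X by (intro carrier_vecI) simp
  have "ridge_gram X k *\<^sub>v est l = ?z + (k - l) \<cdot>\<^sub>v est l"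
    unfolding el[symmetric] ridge_gram_mult_vec[OF X l cl] ridge_gram_mult_vec[OF X k cl] using cl tl
    by (intro eq_vecI) (auto simp: algebra_simps simp del: index_mult_mat_vec)
  then have "est l = resolvent X k *\<^sub>v (?z + (k - l) \<cdot>\<^sub>v est l)"
    using resolvent_ridge_gram_vec[OF X k cl] by simp
  also have "\<dots> = est k + (k - l) \<cdot>\<^sub>v (resolvent X k *\<^sub>v est l)"
    using z cl resolvent_carrier[OF X k]
    by (simp add: mult_add_distrib_mat_vec[of _ p p] mult_mat_vec[of _ p p] ridge_resolvent[of _ _ k])
  finally have eq: "est l = est k + (k - l) \<cdot>\<^sub>v (resolvent X k *\<^sub>v est l)" .
  have u: "resolvent X k *\<^sub>v est l \<in> carrier_vec p"
    by (rule carrier_vecI) (simp add: carrier_matD(1)[OF resolvent_carrier[OF X k]])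
  have "est k - est l = (l - k) \<cdot>\<^sub>v (resolvent X k *\<^sub>v est l)"
  proof (rule eq_vecI)
    fix i assume "i < dim_vec ((l - k) \<cdot>\<^sub>v (resolvent X k *\<^sub>v est l))"
    then have i: "i < p" using u by (simp del: dim_mult_mat_vec)
    have "est l $ i = est k $ i + (k - l) * (resolvent X k *\<^sub>v est l) $ i"
      using i u ck by (subst eq) (simp del: dim_mult_mat_vec index_mult_mat_vec)
    then show "(est k - est l) $ i = ((l - k) \<cdot>\<^sub>v (resolvent X k *\<^sub>v est l)) $ i"
      using i u ck cl by (simp add: algebra_simps del: dim_mult_mat_vec index_mult_mat_vec)
  qed (use u cl in \<open>simp del: dim_mult_mat_vec\<close>)
  then have "(est k - est l) \<bullet> (est k - est l) = (l - k)\<^sup>2 * ((resolvent X k *\<^sub>v est l) \<bullet> (resolvent X k *\<^sub>v est l))"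
    using u by (simp add: power2_eq_square mult.assoc)
  then have "k\<^sup>2 * ((est k - est l) \<bullet> (est k - est l))
      = (l - k)\<^sup>2 * (k\<^sup>2 * ((resolvent X k *\<^sub>v est l) \<bullet> (resolvent X k *\<^sub>v est l)))" by simp
  also have "\<dots> \<le> (l - k)\<^sup>2 * (est l \<bullet> est l)"
    by (intro mult_left_mono resolvent_bound[OF X k cl]) simp
  finally show ?thesis .
qed

text \<open>
  The difference of squared norms is a scalar product of \<open>b\<^sub>l - b\<^sub>k\<close> with the sum of the two errors; the
  first factor is \<open>O(|l - k|)\<close> by \<open>ridge_diff_bound\<close>, and both factors are bounded in terms of the
  norms of noise and signal.
\<close>

lemma ridge_error_norm_lipschitz:
  assumes l1: "0 < l1" and l: "l1 \<le> l" and k: "l1 \<le> k"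
  shows "\<bar>ridge_sq_error X b e l - ridge_sq_error X b e k\<bar>
    \<le> 2 * (1 / l1 * (e \<bullet> e) + 6 * (b \<bullet> b)) / l1 * \<bar>l - k\<bar>"
proof -
  have l0: "0 < l" and k0: "0 < k" using assms by auto
  note ck = ridge_carrier[OF k0] and cl = ridge_carrier[OF l0]
  define B where "B = 1 / l1 * (e \<bullet> e) + 6 * (b \<bullet> b)"
  have B0: "0 \<le> B" using l1 unfolding B_def by (intro add_nonneg_nonneg mult_nonneg_nonneg scalar_prod_self_nonneg) auto
  have err: "2 * ((est t - b) \<bullet> (est t - b)) + 2 * (b \<bullet> b) \<le> B" if t: "l1 \<le> t" for t
  proof -
    have "1 / (2 * t) * (e \<bullet> e) \<le> 1 / (2 * l1) * (e \<bullet> e)"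
      using t l1 by (intro mult_right_mono scalar_prod_self_nonneg divide_left_mono) auto
    then have "(est t - b) \<bullet> (est t - b) \<le> 1 / (2 * l1) * (e \<bullet> e) + 2 * (b \<bullet> b)"
      using ridge_error_bound[of t] t l1 by linarith
    then show ?thesis by (simp add: B_def)
  qed
  have bb: "0 \<le> b \<bullet> b" by (rule scalar_prod_self_nonneg)
  let ?u = "est l - b" and ?v = "est k - b"
  have uv: "?u \<in> carrier_vec p" "?v \<in> carrier_vec p" using ck cl b by auto
  have "est l = ?u + b" using cl b by (intro eq_vecI) auto
  then have "est l \<bullet> est l \<le> 2 * (?u \<bullet> ?u) + 2 * (b \<bullet> b)" using scalar_prod_add_self_le(1)[OF uv(1) b] by simp
  then have est: "est l \<bullet> est l \<le> B" using err[OF l] by simp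
  have "l1\<^sup>2 * ((est k - est l) \<bullet> (est k - est l)) \<le> k\<^sup>2 * ((est k - est l) \<bullet> (est k - est l))"
    using k l1 by (intro mult_right_mono power_mono scalar_prod_self_nonneg) auto
  also have "\<dots> \<le> (l - k)\<^sup>2 * (est l \<bullet> est l)" by (rule ridge_diff_bound[OF l0 k0])
  also have "\<dots> \<le> (l - k)\<^sup>2 * B" by (intro mult_left_mono est) simp
  finally have diff: "l1\<^sup>2 * ((est k - est l) \<bullet> (est k - est l)) \<le> (l - k)\<^sup>2 * B" .
  have eq1: "est k - est l = ?v - ?u" using ck cl b by (intro eq_vecI) auto
  have "(?u \<bullet> ?u - ?v \<bullet> ?v) = - ((?v - ?u) \<bullet> (?u + ?v))"
    using uv by (simp add: minus_scalar_prod_distrib[of _ p] scalar_prod_add_distrib[of _ p] comm_scalar_prod[of ?u p ?v])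
  then have "(?u \<bullet> ?u - ?v \<bullet> ?v)\<^sup>2 \<le> ((?v - ?u) \<bullet> (?v - ?u)) * ((?u + ?v) \<bullet> (?u + ?v))"
    using scalar_prod_Cauchy_Schwarz[of "?v - ?u" p "?u + ?v"] uv by simp
  also have "\<dots> \<le> ((?v - ?u) \<bullet> (?v - ?u)) * (2 * B)"
    using scalar_prod_add_self_le(1)[OF uv] err[OF l] err[OF k] bb
    by (intro mult_left_mono scalar_prod_self_nonneg) linarith
  finally have "l1\<^sup>2 * (?u \<bullet> ?u - ?v \<bullet> ?v)\<^sup>2 \<le> l1\<^sup>2 * (((?v - ?u) \<bullet> (?v - ?u)) * (2 * B))"
    by (intro mult_left_mono) auto
  also have "\<dots> \<le> ((l - k)\<^sup>2 * B) * (2 * B)"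
    using mult_right_mono[OF diff[unfolded eq1], of "2 * B"] B0 by (simp add: mult.assoc)
  also have "\<dots> \<le> (2 * B * \<bar>l - k\<bar>)\<^sup>2"
  proof -
    have eq: "((l - k)\<^sup>2 * B) * (2 * B) = 2 * (B * (l - k))\<^sup>2" "(2 * B * \<bar>l - k\<bar>)\<^sup>2 = 4 * (B * (l - k))\<^sup>2"
      by (simp_all add: power_mult_distrib power2_eq_square[of B])
    show ?thesis unfolding eq by simp
  qed
  finally have "(l1 * \<bar>?u \<bullet> ?u - ?v \<bullet> ?v\<bar>)\<^sup>2 \<le> (2 * B * \<bar>l - k\<bar>)\<^sup>2"
    by (simp only: power_mult_distrib[of l1] power2_abs)
  then have "l1 * \<bar>?u \<bullet> ?u - ?v \<bullet> ?v\<bar> \<le> 2 * B * \<bar>l - k\<bar>" by (rule power2_le_imp_le) (use B0 in simp)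
  then show ?thesis using l1 unfolding B_def[symmetric] ridge_sq_error_def by (simp add: field_simps)
qed

end


section \<open>The limiting risk\<close>

text \<open>
  Both sums run over the singular values, padded with zeros; they differ in the number of
  zeros.
\<close>

lemma sum_diag_ext:
  assumes "D \<in> carrier_mat n p"
  shows "(\<Sum>i<p. g (diag_ext D i)) = (\<Sum>i<n. g (diag_ext D i)) + (real p - real n) * (g 0 :: real)"
proof -
  have *: "(\<Sum>i<k. g (diag_ext D i)) = (\<Sum>i<min n p. g (diag_ext D i)) + (real k - real (min n p)) * g 0"
    if "min n p \<le> k" for k
  proof -
    have "(\<Sum>i<k. g (diag_ext D i)) = (\<Sum>i<min n p. g (diag_ext D i)) + (\<Sum>i\<in>{min n p..<k}. g (diag_ext D i))"
      using sum.atLeastLessThan_concat[of 0 "min n p" k "\<lambda>i. g (diag_ext D i)"] that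
      by (simp add: atLeast0LessThan)
    also have "(\<Sum>i\<in>{min n p..<k}. g (diag_ext D i)) = (\<Sum>i\<in>{min n p..<k}. g 0)"
      using assms by (intro sum.cong refl) (auto simp: diag_ext_def)
    finally show ?thesis using that by (simp add: of_nat_diff del: of_nat_min)
  qed
  show ?thesis using *[of p] *[of n] by (simp add: algebra_simps)
qed

lemma v_st_neg:
  assumes "D \<in> carrier_mat n p"
  shows "v_st D (- l) = (\<Sum>i<n. 1 / ((diag_ext D i)\<^sup>2 + l)) / real n"
  using assms by (simp add: v_st_def)

lemma deriv_v_st:
  assumes D: "D \<in> carrier_mat n p" and l: "0 < l"
  shows "deriv (v_st D) (- l) = (\<Sum>i<n. 1 / ((diag_ext D i)\<^sup>2 + l)\<^sup>2) / real n"
proof (rule DERIV_imp_deriv)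
  have nz: "(diag_ext D i)\<^sup>2 - (- l) \<noteq> 0" for i using l by (smt (verit) zero_le_power2)
  have "DERIV (\<lambda>z. 1 / ((diag_ext D i)\<^sup>2 - z)) (- l) :> 1 / ((diag_ext D i)\<^sup>2 + l)\<^sup>2" for i
    using nz[of i] by (auto intro!: derivative_eq_intros simp: power2_eq_square)
  then have "DERIV (\<lambda>z. 1 / real n * (\<Sum>i<n. 1 / ((diag_ext D i)\<^sup>2 - z))) (- l)
      :> 1 / real n * (\<Sum>i<n. 1 / ((diag_ext D i)\<^sup>2 + l)\<^sup>2)"
    by (intro DERIV_cmult DERIV_sum)
  then show "DERIV (v_st D) (- l) :> (\<Sum>i<n. 1 / ((diag_ext D i)\<^sup>2 + l)\<^sup>2) / real n"
    using D unfolding v_st_def[abs_def] by simp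
qed

lemma asym_risk_eq:
  assumes D: "D \<in> carrier_mat n p" and l: "0 < l" and \<gamma>: "0 < \<gamma>"
  shows "asym_risk \<gamma> D r2 s2 l = r2 * ((\<Sum>i<n. (l / ((diag_ext D i)\<^sup>2 + l))\<^sup>2) / real n / \<gamma> + (\<gamma> - 1) / \<gamma>)
     + s2 * ((\<Sum>i<n. (diag_ext D i)\<^sup>2 / ((diag_ext D i)\<^sup>2 + l)\<^sup>2) / real n)"
proof -
  have nz: "(diag_ext D i)\<^sup>2 + l \<noteq> 0" for i using l by (smt (verit) zero_le_power2)
  have "1 / ((diag_ext D i)\<^sup>2 + l) - l * (1 / ((diag_ext D i)\<^sup>2 + l)\<^sup>2) = (diag_ext D i)\<^sup>2 / ((diag_ext D i)\<^sup>2 + l)\<^sup>2" for i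
  proof -
    have "1 / t - l * (1 / t\<^sup>2) = (t - l) / t\<^sup>2" if "t \<noteq> 0" for t
      using that by (simp add: diff_divide_distrib power2_eq_square)
    from this[OF nz[of i]] show ?thesis by simp
  qed
  then have "(\<Sum>i<n. 1 / ((diag_ext D i)\<^sup>2 + l)) - l * (\<Sum>i<n. 1 / ((diag_ext D i)\<^sup>2 + l)\<^sup>2)
      = (\<Sum>i<n. (diag_ext D i)\<^sup>2 / ((diag_ext D i)\<^sup>2 + l)\<^sup>2)"
    by (simp add: sum_distrib_left flip: sum_subtractf)
  then have "v_st D (- l) - l * deriv (v_st D) (- l) = (\<Sum>i<n. (diag_ext D i)\<^sup>2 / ((diag_ext D i)\<^sup>2 + l)\<^sup>2) / real n"
    unfolding v_st_neg[OF D] deriv_v_st[OF D l] by (simp flip: diff_divide_distrib)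
  moreover have "l\<^sup>2 / \<gamma> * deriv (v_st D) (- l) = (\<Sum>i<n. (l / ((diag_ext D i)\<^sup>2 + l))\<^sup>2) / real n / \<gamma>"
  proof -
    have "(\<Sum>i<n. (l / ((diag_ext D i)\<^sup>2 + l))\<^sup>2) = l\<^sup>2 * (\<Sum>i<n. 1 / ((diag_ext D i)\<^sup>2 + l)\<^sup>2)"
      by (simp add: sum_distrib_left power_divide)
    then show ?thesis unfolding deriv_v_st[OF D l] by simp
  qed
  ultimately show ?thesis unfolding asym_risk_def by simp
qed

text \<open>
  Both functions are polynomials in \<open>t / (a + t) \<le> 1\<close> and \<open>1 / (a + t) \<le> 1 / l\<^sub>1\<close>, which are
  Lipschitz in \<open>t \<ge> l\<^sub>1\<close> uniformly in \<open>a\<close>.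
\<close>

lemma shrinkage_lipschitz:
  fixes a l k l1 :: real
  assumes a: "0 \<le> a" and l1: "0 < l1" and l: "l1 \<le> l" and k: "l1 \<le> k"
  shows "\<bar>(l / (a + l))\<^sup>2 - (k / (a + k))\<^sup>2\<bar> \<le> 2 / l1 * \<bar>l - k\<bar>"
    and "\<bar>a / (a + l)\<^sup>2 - a / (a + k)\<^sup>2\<bar> \<le> 2 / l1\<^sup>2 * \<bar>l - k\<bar>"
proof -
  have pos: "0 < l" "0 < k" "0 < a + l" "0 < a + k" using assms by auto
  let ?f = "\<lambda>t. t / (a + t)" and ?g = "\<lambda>t. 1 / (a + t)"
  have f01: "0 \<le> ?f t" "?f t \<le> 1" and gb: "0 \<le> ?g t" "?g t \<le> 1 / l1" if "l1 \<le> t" for t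
    using that a l1 by (auto intro!: divide_left_mono simp: divide_le_eq)
  have "?f l - ?f k = (a * ?g l) * (?g k) * (l - k)" using pos by (simp add: field_simps)
  then have "\<bar>?f l - ?f k\<bar> = (a * ?g l) * ?g k * \<bar>l - k\<bar>" using pos a by (simp add: abs_mult)
  also have "\<dots> \<le> 1 * (1 / l1) * \<bar>l - k\<bar>"
    using pos a gb[OF k] by (intro mult_right_mono mult_mono) (auto simp: divide_le_eq)
  finally have df: "\<bar>?f l - ?f k\<bar> \<le> 1 / l1 * \<bar>l - k\<bar>" by simp
  have "?g l - ?g k = ?g l * ?g k * (k - l)" using pos by (simp add: field_simps)
  then have "\<bar>?g l - ?g k\<bar> = ?g l * ?g k * \<bar>l - k\<bar>" using pos by (simp add: abs_mult abs_minus_commute)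
  also have "\<dots> \<le> (1 / l1) * (1 / l1) * \<bar>l - k\<bar>"
    using gb[OF k] gb[OF l] l1 by (intro mult_right_mono mult_mono) auto
  finally have dg: "\<bar>?g l - ?g k\<bar> \<le> 1 / l1\<^sup>2 * \<bar>l - k\<bar>" by (simp add: power2_eq_square)
  have "(?f l)\<^sup>2 - (?f k)\<^sup>2 = (?f l - ?f k) * (?f l + ?f k)" by (simp add: power2_eq_square algebra_simps)
  then have "\<bar>(?f l)\<^sup>2 - (?f k)\<^sup>2\<bar> = \<bar>?f l - ?f k\<bar> * \<bar>?f l + ?f k\<bar>" by (simp add: abs_mult)
  also have "\<dots> \<le> (1 / l1 * \<bar>l - k\<bar>) * 2"
    using df f01[OF l] f01[OF k] l1 by (intro mult_mono) auto
  finally show "\<bar>(l / (a + l))\<^sup>2 - (k / (a + k))\<^sup>2\<bar> \<le> 2 / l1 * \<bar>l - k\<bar>" by (simp add: mult.commute)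
  have h: "a / (a + t)\<^sup>2 = ?g t * (1 - ?f t)" if "0 < a + t" for t
    using that by (simp add: field_simps power2_eq_square)
  have "a / (a + l)\<^sup>2 - a / (a + k)\<^sup>2 = (?g l - ?g k) * (1 - ?f l) + ?g k * (?f k - ?f l)"
    unfolding h[OF pos(3)] h[OF pos(4)] by (simp only: algebra_simps) 
  then have "\<bar>a / (a + l)\<^sup>2 - a / (a + k)\<^sup>2\<bar> \<le> \<bar>?g l - ?g k\<bar> * \<bar>1 - ?f l\<bar> + \<bar>?g k\<bar> * \<bar>?f l - ?f k\<bar>"
    using abs_triangle_ineq[of "(?g l - ?g k) * (1 - ?f l)" "?g k * (?f k - ?f l)"]
    by (simp add: abs_mult abs_minus_commute)
  also have "\<dots> \<le> (1 / l1\<^sup>2 * \<bar>l - k\<bar>) * 1 + (1 / l1) * (1 / l1 * \<bar>l - k\<bar>)"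
    using dg df f01[OF l] gb[OF k] l1 by (intro add_mono mult_mono) auto
  also have "\<dots> = 2 / l1\<^sup>2 * \<bar>l - k\<bar>" using l1 by (simp add: power2_eq_square field_simps)
  finally show "\<bar>a / (a + l)\<^sup>2 - a / (a + k)\<^sup>2\<bar> \<le> 2 / l1\<^sup>2 * \<bar>l - k\<bar>" .
qed

lemma average_lipschitz:
  fixes f g :: "nat \<Rightarrow> real"
  assumes "\<And>i. i < n \<Longrightarrow> \<bar>f i - g i\<bar> \<le> c" "0 \<le> c"
  shows "\<bar>(\<Sum>i<n. f i) / real n - (\<Sum>i<n. g i) / real n\<bar> \<le> c"
proof -
  have "\<bar>(\<Sum>i<n. f i) - (\<Sum>i<n. g i)\<bar> \<le> (\<Sum>i<n. \<bar>f i - g i\<bar>)"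
    unfolding sum_subtractf[symmetric] by (rule sum_abs)
  also have "\<dots> \<le> real n * c" using sum_bounded_above[of "{..<n}" "\<lambda>i. \<bar>f i - g i\<bar>" c] assms by simp
  finally show ?thesis using assms by (cases "n = 0") (auto simp: field_simps simp flip: diff_divide_distrib)
qed

lemma asym_risk_lipschitz:
  assumes D: "D \<in> carrier_mat n p" and \<gamma>: "0 < \<gamma>" and l1: "0 < l1" "l1 \<le> l" "l1 \<le> k"
    and rs: "0 \<le> r2" "0 \<le> s2"
  shows "\<bar>asym_risk \<gamma> D r2 s2 l - asym_risk \<gamma> D r2 s2 k\<bar> \<le> (2 * r2 / (\<gamma> * l1) + 2 * s2 / l1\<^sup>2) * \<bar>l - k\<bar>"
proof -
  let ?a = "\<lambda>i. (diag_ext D i)\<^sup>2"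
  let ?f = "\<lambda>t. (\<Sum>i<n. (t / (?a i + t))\<^sup>2) / real n" and ?g = "\<lambda>t. (\<Sum>i<n. ?a i / (?a i + t)\<^sup>2) / real n"
  have f: "\<bar>?f l - ?f k\<bar> \<le> 2 / l1 * \<bar>l - k\<bar>"
    using l1 by (intro average_lipschitz shrinkage_lipschitz(1)) auto
  have g: "\<bar>?g l - ?g k\<bar> \<le> 2 / l1\<^sup>2 * \<bar>l - k\<bar>"
    using l1 by (intro average_lipschitz shrinkage_lipschitz(2)) auto
  have l0: "0 < l" "0 < k" using l1 by auto
  have "asym_risk \<gamma> D r2 s2 l - asym_risk \<gamma> D r2 s2 k = (r2 / \<gamma>) * (?f l - ?f k) + s2 * (?g l - ?g k)"
  proof -
    have "r2 * (F / \<gamma> + c) + s2 * G - (r2 * (F' / \<gamma> + c) + s2 * G') = (r2 / \<gamma>) * (F - F') + s2 * (G - G')" for F F' G G' c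
      using \<gamma> by (simp add: field_simps)
    then show ?thesis unfolding asym_risk_eq[OF D l0(1) \<gamma>] asym_risk_eq[OF D l0(2) \<gamma>] .
  qed
  then have "\<bar>asym_risk \<gamma> D r2 s2 l - asym_risk \<gamma> D r2 s2 k\<bar>
      \<le> \<bar>(r2 / \<gamma>) * (?f l - ?f k)\<bar> + \<bar>s2 * (?g l - ?g k)\<bar>"
    by (simp only: abs_triangle_ineq)
  also have "\<dots> = (r2 / \<gamma>) * \<bar>?f l - ?f k\<bar> + s2 * \<bar>?g l - ?g k\<bar>"
    using rs \<gamma> by (simp only: abs_mult abs_of_nonneg divide_nonneg_pos)
  also have "\<dots> \<le> (r2 / \<gamma>) * (2 / l1 * \<bar>l - k\<bar>) + s2 * (2 / l1\<^sup>2 * \<bar>l - k\<bar>)"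
    using rs \<gamma> by (intro add_mono mult_left_mono f g) auto
  finally show ?thesis using l1 \<gamma> by (simp add: algebra_simps)
qed


section \<open>Uniform convergence\<close>

text \<open>
  Only countably many points are involved in the pointwise hypothesis, so it can be verified on one
  event of probability one.
\<close>

lemma uniform_of_pointwise_lipschitz:
  fixes F :: "nat \<Rightarrow> real \<Rightarrow> real"
  assumes ab: "a < b"
    and pt: "\<And>i N :: nat. (\<lambda>n. F n (a + (b - a) * (real i / real (Suc N)))) \<longlonglongrightarrow> 0"
    and lip: "\<And>n x y. 1 \<le> n \<Longrightarrow> a \<le> x \<Longrightarrow> a \<le> y \<Longrightarrow> \<bar>F n x - F n y\<bar> \<le> C * \<bar>x - y\<bar>"
  shows "(\<lambda>n. SUP x\<in>{a..b}. \<bar>F n x\<bar>) \<longlonglongrightarrow> 0"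
proof (rule LIMSEQ_I)
  fix e :: real assume e: "0 < e"
  obtain N :: nat where N: "\<bar>C\<bar> * (b - a) * 4 / e < real N" using reals_Archimedean2 by blast
  define t where "t i = a + (b - a) * (real i / real (Suc N))" for i
  have "\<forall>\<^sub>F n in sequentially. \<forall>i\<in>{..Suc N}. \<bar>F n (t i)\<bar> < e / 4"
    unfolding t_def using e
    by (intro eventually_ball_finite ballI order_tendstoD(2)[OF tendsto_rabs_zero[OF pt]]) auto
  then have "\<forall>\<^sub>F n in sequentially. \<bar>(SUP x\<in>{a..b}. \<bar>F n x\<bar>) - 0\<bar> < e"
    using eventually_ge_at_top[of 1]
  proof eventually_elim
    case (elim n)
    have le: "\<bar>F n x\<bar> \<le> e / 2" if x: "x \<in> {a..b}" for x
    proof -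
      define i where "i = nat \<lfloor>(x - a) / (b - a) * real (Suc N)\<rfloor>"
      have q: "0 \<le> (x - a) / (b - a) * real (Suc N)" using x ab by simp
      have i1: "real i \<le> (x - a) / (b - a) * real (Suc N)" "(x - a) / (b - a) * real (Suc N) < real i + 1"
        unfolding i_def using q by linarith+
      have "(x - a) / (b - a) \<le> 1" using x ab by simp
      then have "(x - a) / (b - a) * real (Suc N) \<le> 1 * real (Suc N)" by (intro mult_right_mono) auto
      from order_trans[OF i1(1) this] have "real i \<le> real (Suc N)" by (simp only: mult_1)
      then have i2: "i \<in> {..Suc N}" by simp
      \<comment> \<open>The largest grid point below \<open>x\<close> is less than one mesh width away.\<close>
      have "x - t i = (b - a) / real (Suc N) * ((x - a) / (b - a) * real (Suc N) - real i)"
      proof -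
        have "x - (a + L * (j / S)) = L / S * ((x - a) / L * S - j)" if "L \<noteq> 0" "S \<noteq> 0" for L S j :: real
          using that by (simp add: field_simps)
        from this[of "b - a" "real (Suc N)" "real i"] ab show ?thesis unfolding t_def by simp
      qed
      then have "\<bar>x - t i\<bar> = (b - a) / real (Suc N) * \<bar>(x - a) / (b - a) * real (Suc N) - real i\<bar>"
        using ab by (simp add: abs_mult)
      also have "\<dots> \<le> (b - a) / real (Suc N) * 1" using i1 ab by (intro mult_left_mono) auto
      finally have d: "\<bar>x - t i\<bar> \<le> (b - a) / real (Suc N)" by simp
      have "\<bar>F n x - F n (t i)\<bar> \<le> C * \<bar>x - t i\<bar>"
        using x ab elim(2) by (intro lip) (auto simp: t_def)
      also have "\<dots> \<le> \<bar>C\<bar> * ((b - a) / real (Suc N))" using d by (intro mult_mono) auto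
      also have "\<dots> \<le> e / 4"
      proof -
        have "\<bar>C\<bar> * (b - a) * 4 \<le> e * real (Suc N)" using N e by (simp add: field_simps)
        then show ?thesis using e by (simp add: field_simps)
      qed
      finally have "\<bar>F n x - F n (t i)\<bar> \<le> e / 4" .
      moreover have "\<bar>F n (t i)\<bar> < e / 4" using elim(1) i2 by (rule bspec)
      ultimately show ?thesis by linarith
    qed
    have "(SUP x\<in>{a..b}. \<bar>F n x\<bar>) \<le> e / 2" using ab by (intro cSUP_least le) auto
    moreover have "0 \<le> (SUP x\<in>{a..b}. \<bar>F n x\<bar>)"
      using ab by (intro order_trans[OF abs_ge_zero cSUP_upper[of a]]) (auto intro!: bdd_aboveI2[where M = "e / 2"] le)
    ultimately show ?case using e by simp
  qed
  then show "\<exists>no. \<forall>n\<ge>no. norm ((SUP x\<in>{a..b}. \<bar>F n x\<bar>) - 0) < e"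
    unfolding eventually_sequentially by simp
qed
text \<open>
  Besides the three concentration statements there is a deterministic discrepancy: the bias term
  produces \<open>n / p\<close> in place of its limit \<open>1 / \<gamma>\<close>.
\<close>

lemma (in ridge_model) risk_pointwise:
  assumes l: "0 < l"
  shows "AE \<omega> in M. (\<lambda>n. ridge_sq_error (X n \<omega>) (\<beta> n \<omega>) (\<epsilon> n \<omega>) l / real n
      - asym_risk \<gamma> (D n \<omega>) (r\<^sup>2) (\<sigma>\<^sup>2) l) \<longlonglongrightarrow> 0"
proof -
  have "AE \<omega> in M. \<forall>n. n \<ge> 1 \<longrightarrow> \<beta> n \<omega> \<bullet> \<beta> n \<omega> = r\<^sup>2 * real n"
    unfolding AE_all_countable using beta_square by (auto intro: AE_mp)
  with signal_term[OF l] cross_term[OF l] noise_term[OF l] AE_space show ?thesis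
  proof (eventually_elim, goal_cases)
    case (1 \<omega>)
    let ?P = "\<lambda>n. resolvent (X n \<omega>) l * transpose_mat (X n \<omega>)"
    let ?noise = "\<lambda>n. ((?P n *\<^sub>v \<epsilon> n \<omega>) \<bullet> (?P n *\<^sub>v \<epsilon> n \<omega>) - \<sigma>\<^sup>2 * frob2 (?P n)) / real n"
    let ?cross = "\<lambda>n. cross l (X n \<omega>) (\<beta> n \<omega>) (\<epsilon> n \<omega>) / real n"
    let ?signal = "\<lambda>n. quad_dev (p n) l (\<beta> n \<omega>) (X n \<omega>) / real n"
    define W where "W n = (\<Sum>i<n. (l / ((diag_ext (D n \<omega>) i)\<^sup>2 + l))\<^sup>2) / real n" for n
    define Z where "Z n = (\<Sum>i<n. (diag_ext (D n \<omega>) i)\<^sup>2 / ((diag_ext (D n \<omega>) i)\<^sup>2 + l)\<^sup>2) / real n" for n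
    have W: "0 \<le> W n \<and> W n \<le> 1" for n
    proof -
      have "(l / ((diag_ext (D n \<omega>) i)\<^sup>2 + l))\<^sup>2 \<le> 1" for i
      proof -
        have "0 \<le> l / ((diag_ext (D n \<omega>) i)\<^sup>2 + l)" "l / ((diag_ext (D n \<omega>) i)\<^sup>2 + l) \<le> 1"
          using l by (auto simp: divide_le_eq add_nonneg_pos)
        then show ?thesis by (rule power_le_one)
      qed
      then have "(\<Sum>i<n. (l / ((diag_ext (D n \<omega>) i)\<^sup>2 + l))\<^sup>2) \<le> (\<Sum>i<n. 1)" by (intro sum_mono)
      then show ?thesis unfolding W_def by (cases "n = 0") (auto intro!: divide_nonneg_nonneg sum_nonneg)
    qed
    have bias: "(\<lambda>n. r\<^sup>2 * (real n / real (p n) - 1 / \<gamma>) * (W n - 1)) \<longlonglongrightarrow> 0"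
    proof (rule Lim_null_comparison)
      have "\<bar>W n - 1\<bar> \<le> 1" for n using W[of n] by auto
      then have "\<bar>r\<^sup>2 * (real n / real (p n) - 1 / \<gamma>)\<bar> * \<bar>W n - 1\<bar> \<le> \<bar>r\<^sup>2 * (real n / real (p n) - 1 / \<gamma>)\<bar> * 1" for n
        by (intro mult_left_mono) auto
      then show "\<forall>\<^sub>F n in sequentially. norm (r\<^sup>2 * (real n / real (p n) - 1 / \<gamma>) * (W n - 1)) \<le> \<bar>r\<^sup>2 * (real n / real (p n) - 1 / \<gamma>)\<bar>"
        by (simp only: real_norm_def abs_mult[of _ "W _ - 1"] mult_1_right eventually_True)
      have "(\<lambda>n. \<bar>r\<^sup>2 * (real n / real (p n) - 1 / \<gamma>)\<bar>) \<longlonglongrightarrow> \<bar>r\<^sup>2 * (1 / \<gamma> - 1 / \<gamma>)\<bar>"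
        by (intro tendsto_intros ratio_inverse)
      then show "(\<lambda>n. \<bar>r\<^sup>2 * (real n / real (p n) - 1 / \<gamma>)\<bar>) \<longlonglongrightarrow> 0" by simp
    qed
    have "(\<lambda>n. ?signal n - 2 * ?cross n + ?noise n + r\<^sup>2 * (real n / real (p n) - 1 / \<gamma>) * (W n - 1)) \<longlonglongrightarrow> 0 - 2 * 0 + 0 + 0"
      by (intro tendsto_add tendsto_diff tendsto_mult tendsto_const 1 bias)
    then have lim: "(\<lambda>n. ?signal n - 2 * ?cross n + ?noise n + r\<^sup>2 * (real n / real (p n) - 1 / \<gamma>) * (W n - 1)) \<longlonglongrightarrow> 0"
      by simp
    show ?case
    proof (rule Lim_transform_eventually[OF lim], rule eventually_sequentiallyI[of 1])
      fix n :: nat assume n: "1 \<le> n"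
      note x = measurable_mat_carrier[OF measurable_X[OF n] 1(4)]
      note b = measurable_vec_carrier[OF measurable_beta[OF n] 1(4)]
      note e = measurable_vec_carrier[OF measurable_eps[OF n] 1(4)]
      note sv = X_svd[OF n 1(4)]
      then have D: "D n \<omega> \<in> carrier_mat n (p n)" by (simp add: is_svd_def)
      have bb: "\<beta> n \<omega> \<bullet> \<beta> n \<omega> = r\<^sup>2 * real n" using 1(5) n by simp
      have n0: "real n \<noteq> 0" "real (p n) \<noteq> 0" using n dims[OF n] by auto
      have H: "frob2 (l \<cdot>\<^sub>m resolvent (X n \<omega>) l) = real n * W n + (real (p n) - real n)"
        unfolding frob2_svd_resolvent(1)[OF sv l] W_def
        using sum_diag_ext[OF D, of "\<lambda>d. l\<^sup>2 / (d\<^sup>2 + l)\<^sup>2"] n0 l by (simp add: power_divide)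
      have A: "frob2 (?P n) = real n * Z n"
        unfolding frob2_svd_resolvent(2)[OF sv l] Z_def
        using sum_diag_ext[OF D, of "\<lambda>d. d\<^sup>2 / (d\<^sup>2 + l)\<^sup>2"] n0 by simp
      \<comment> \<open>The four summands on the left are bias, cross term, variance and the discrepancy of \<open>n / p\<close> and
        \<open>1 / \<gamma>\<close>; here \<open>N = n\<close>, \<open>q = p\<close>, \<open>R = r\<^sup>2\<close>, \<open>S = \<sigma>\<^sup>2\<close>, and \<open>w\<close>, \<open>z\<close> stand for the averages \<open>W\<close>, \<open>Z\<close>.\<close>
      have alg: "(h - R * N / q * (N * w + (q - N))) / N - 2 * (c / N) + (a - S * (N * z)) / N + R * (N / q - 1 / \<gamma>) * (w - 1)
          = (a - 2 * c + h) / N - (R * (w / \<gamma> + (\<gamma> - 1) / \<gamma>) + S * z)"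
        if "N \<noteq> 0" "q \<noteq> 0" for h R N q w c a S z :: real
        using that gamma(1) by (simp add: field_simps)
      show "?signal n - 2 * ?cross n + ?noise n + r\<^sup>2 * (real n / real (p n) - 1 / \<gamma>) * (W n - 1)
        = ridge_sq_error (X n \<omega>) (\<beta> n \<omega>) (\<epsilon> n \<omega>) l / real n
          - asym_risk \<gamma> (D n \<omega>) (r\<^sup>2) (\<sigma>\<^sup>2) l"
        unfolding ridge_error_norm[OF x b e l] asym_risk_eq[OF D l gamma(1)] W_def[symmetric] Z_def[symmetric]
          quad_dev_def bb H A cross_def
        by (rule alg[OF n0])
    qed
  qed
qed

text \<open>
  By the law of large numbers the Lipschitz constant of the normalized squared error is bounded in
  \<open>n\<close>, almost surely.
\<close>

lemma (in ridge_model) risk_uniform: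
  assumes l1: "0 < l\<^sub>1" "l\<^sub>1 < l\<^sub>2"
  shows "AE \<omega> in M. (\<lambda>n. SUP l\<in>{l\<^sub>1..l\<^sub>2}. \<bar>ridge_sq_error (X n \<omega>) (\<beta> n \<omega>) (\<epsilon> n \<omega>) l / real n
      - asym_risk \<gamma> (D n \<omega>) (r\<^sup>2) (\<sigma>\<^sup>2) l\<bar>) \<longlonglongrightarrow> 0"
proof -
  define F where "F \<omega> n l = ridge_sq_error (X n \<omega>) (\<beta> n \<omega>) (\<epsilon> n \<omega>) l / real n
      - asym_risk \<gamma> (D n \<omega>) (r\<^sup>2) (\<sigma>\<^sup>2) l" for \<omega> n l
  have "AE \<omega> in M. \<forall>n. n \<ge> 1 \<longrightarrow> \<beta> n \<omega> \<bullet> \<beta> n \<omega> = r\<^sup>2 * real n"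
    unfolding AE_all_countable using beta_square by (auto intro: AE_mp)
  moreover have "AE \<omega> in M. \<forall>i N :: nat. (\<lambda>n. F \<omega> n (l\<^sub>1 + (l\<^sub>2 - l\<^sub>1) * (real i / real (Suc N)))) \<longlonglongrightarrow> 0"
    unfolding AE_all_countable F_def
    using l1 by (intro allI risk_pointwise add_pos_nonneg mult_nonneg_nonneg) auto
  ultimately show ?thesis using noise_norm AE_space unfolding F_def[symmetric]
  proof (eventually_elim, goal_cases)
    case (1 \<omega>)
    from 1(3) have "Bseq (\<lambda>n. (\<epsilon> n \<omega> \<bullet> \<epsilon> n \<omega>) / real n)" by (rule convergent_imp_Bseq[OF convergentI])
    then obtain B where B: "\<And>n. \<bar>(\<epsilon> n \<omega> \<bullet> \<epsilon> n \<omega>) / real n\<bar> \<le> B" by (auto simp: Bseq_def)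
    show ?case
    proof (rule uniform_of_pointwise_lipschitz[OF l1(2)])
      show "(\<lambda>n. F \<omega> n (l\<^sub>1 + (l\<^sub>2 - l\<^sub>1) * (real i / real (Suc N)))) \<longlonglongrightarrow> 0" for i N using 1(2) by blast
      fix n :: nat and l k assume n: "1 \<le> n" and l: "l\<^sub>1 \<le> l" and k: "l\<^sub>1 \<le> k"
      note x = measurable_mat_carrier[OF measurable_X[OF n] 1(4)]
      note b = measurable_vec_carrier[OF measurable_beta[OF n] 1(4)]
      note e = measurable_vec_carrier[OF measurable_eps[OF n] 1(4)]
      have D: "D n \<omega> \<in> carrier_mat n (p n)" using X_svd[OF n 1(4)] by (simp add: is_svd_def)
      have bb: "\<beta> n \<omega> \<bullet> \<beta> n \<omega> = r\<^sup>2 * real n" using 1(1) n by simp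
      have n0: "0 < real n" using n by simp
      let ?E = "\<lambda>l. ridge_sq_error (X n \<omega>) (\<beta> n \<omega>) (\<epsilon> n \<omega>) l"
      have scale: "\<bar>s / real n - t / real n\<bar> \<le> c / real n" if "\<bar>s - t\<bar> \<le> c" for s t c
        using divide_right_mono[OF that, of "real n"] by (simp add: abs_divide flip: diff_divide_distrib)
      have "\<bar>?E l / real n - ?E k / real n\<bar> \<le> 2 * (1 / l\<^sub>1 * (\<epsilon> n \<omega> \<bullet> \<epsilon> n \<omega>) + 6 * (\<beta> n \<omega> \<bullet> \<beta> n \<omega>)) / l\<^sub>1 * \<bar>l - k\<bar> / real n"
        by (rule scale[OF ridge_error_norm_lipschitz[OF x b e l1(1) l k]])
      also have "\<dots> = 2 * (1 / l\<^sub>1 * ((\<epsilon> n \<omega> \<bullet> \<epsilon> n \<omega>) / real n) + 6 * r\<^sup>2) / l\<^sub>1 * \<bar>l - k\<bar>"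
        unfolding bb using n0 l1(1) by (simp add: field_simps)
      also have "\<dots> \<le> 2 * (1 / l\<^sub>1 * B + 6 * r\<^sup>2) / l\<^sub>1 * \<bar>l - k\<bar>"
        using abs_le_D1[OF B[of n]] l1(1) by (intro mult_right_mono divide_right_mono mult_left_mono add_mono) auto
      finally have 1: "\<bar>?E l / real n - ?E k / real n\<bar> \<le> 2 * (1 / l\<^sub>1 * B + 6 * r\<^sup>2) / l\<^sub>1 * \<bar>l - k\<bar>" .
      have 2: "\<bar>asym_risk \<gamma> (D n \<omega>) (r\<^sup>2) (\<sigma>\<^sup>2) l - asym_risk \<gamma> (D n \<omega>) (r\<^sup>2) (\<sigma>\<^sup>2) k\<bar>
        \<le> (2 * r\<^sup>2 / (\<gamma> * l\<^sub>1) + 2 * \<sigma>\<^sup>2 / l\<^sub>1\<^sup>2) * \<bar>l - k\<bar>"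
        by (rule asym_risk_lipschitz[OF D gamma(1) l1(1) l k]) auto
      have triangle: "\<bar>(a - b) - (c - d)\<bar> \<le> (A + B) * t" if "\<bar>a - c\<bar> \<le> A * t" "\<bar>b - d\<bar> \<le> B * t" for a b c d A B t :: real
        using that unfolding distrib_right by linarith
      show "\<bar>F \<omega> n l - F \<omega> n k\<bar> \<le> (2 * (1 / l\<^sub>1 * B + 6 * r\<^sup>2) / l\<^sub>1 + (2 * r\<^sup>2 / (\<gamma> * l\<^sub>1) + 2 * \<sigma>\<^sup>2 / l\<^sub>1\<^sup>2)) * \<bar>l - k\<bar>"
        unfolding F_def by (rule triangle[OF 1 2])
    qed
  qed
qed

theorem theorem2:
  fixes M :: "'w measure"
    and p n' :: "nat \<Rightarrow> nat"
    and X Q D V X' Q' D' V' :: "nat \<Rightarrow> 'w \<Rightarrow> real mat"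
    and y \<beta> \<epsilon> :: "nat \<Rightarrow> 'w \<Rightarrow> real vec"
    and \<gamma> C r \<sigma> \<eta> K l\<^sub>1 l\<^sub>2 :: real
  assumes prob: "prob_space M"
    and dims: "\<And>n. n \<ge> 1 \<Longrightarrow> p n \<ge> 1 \<and> n' n \<ge> 1"
    and gamma: "\<gamma> > 0" "(\<lambda>n. real (p n) / real n) \<longlonglongrightarrow> \<gamma>"
    and X_inv: "\<And>n. n \<ge> 1 \<Longrightarrow> right_rot_invariant M n (p n) (X n)"
    and X_svd: "\<And>n \<omega>. n \<ge> 1 \<Longrightarrow> \<omega> \<in> space M \<Longrightarrow>
                  is_svd n (p n) (X n \<omega>) (Q n \<omega>) (D n \<omega>) (V n \<omega>)"
    and D_bound: "AE \<omega> in M. limsup (\<lambda>n. ereal (max_diag (D n \<omega>))) < ereal C"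
    and model: "\<And>n \<omega>. n \<ge> 1 \<Longrightarrow> \<omega> \<in> space M \<Longrightarrow> y n \<omega> = X n \<omega> *\<^sub>v \<beta> n \<omega> + \<epsilon> n \<omega>"
    and r: "r \<ge> 0"
    and beta_norm: "\<And>n. n \<ge> 1 \<Longrightarrow> AE \<omega> in M. l2norm (\<beta> n \<omega>) = r * sqrt (real n)"
    and beta_indep: "\<And>n. n \<ge> 1 \<Longrightarrow>
          indep_rv M (borel_vec (p n)) (\<beta> n)
            (borel_mat n (p n) \<Otimes>\<^sub>M borel_vec n) (\<lambda>\<omega>. (X n \<omega>, \<epsilon> n \<omega>))"
    and eps_indep_X: "\<And>n. n \<ge> 1 \<Longrightarrow>
          indep_rv M (borel_vec n) (\<epsilon> n) (borel_mat n (p n)) (X n)"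
    and eps_entries: "\<And>n. n \<ge> 1 \<Longrightarrow>
          prob_space.indep_vars M (\<lambda>_. borel) (\<lambda>i \<omega>. \<epsilon> n \<omega> $ i) {..<n}"
    and eps_mean: "\<And>n i. n \<ge> 1 \<Longrightarrow> i < n \<Longrightarrow> (\<integral>\<omega>. \<epsilon> n \<omega> $ i \<partial>M) = 0"
    and eps_var: "\<And>n i. n \<ge> 1 \<Longrightarrow> i < n \<Longrightarrow> (\<integral>\<omega>. (\<epsilon> n \<omega> $ i)\<^sup>2 \<partial>M) = \<sigma>\<^sup>2"
    and eta: "\<eta> > 0"
    and eps_moment: "\<And>n i. n \<ge> 1 \<Longrightarrow> i < n \<Longrightarrow>
          integrable M (\<lambda>\<omega>. \<bar>\<epsilon> n \<omega> $ i\<bar> powr (4 + \<eta>)) \<and>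
          (\<integral>\<omega>. \<bar>\<epsilon> n \<omega> $ i\<bar> powr (4 + \<eta>) \<partial>M) \<le> K"
    and X'_inv: "\<And>n. n \<ge> 1 \<Longrightarrow> right_rot_invariant M (n' n) (p n) (X' n)"
    and X'_svd: "\<And>n \<omega>. n \<ge> 1 \<Longrightarrow> \<omega> \<in> space M \<Longrightarrow>
                  is_svd (n' n) (p n) (X' n \<omega>) (Q' n \<omega>) (D' n \<omega>) (V' n \<omega>)"
    and X'_indep: "\<And>n. n \<ge> 1 \<Longrightarrow>
          indep_rv M (borel_mat (n' n) (p n)) (X' n)
            (borel_mat n (p n) \<Otimes>\<^sub>M borel_vec n \<Otimes>\<^sub>M borel_vec (p n))
            (\<lambda>\<omega>. (X n \<omega>, y n \<omega>, \<beta> n \<omega>))"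
    and X'_trace: "\<And>n. n \<ge> 1 \<Longrightarrow>
          real n * (\<integral>\<omega>. mat_trace (transpose_mat (D' n \<omega>) * D' n \<omega>) \<partial>M)
            / (real (n' n) * real (p n)) = 1"
    and lambda: "0 < l\<^sub>1" "l\<^sub>1 < l\<^sub>2"
  shows "AE \<omega> in M.
    (\<lambda>n. SUP l\<in>{l\<^sub>1..l\<^sub>2}.
       \<bar>risk M (n' n) (X' n) (ridge (X n \<omega>) (y n \<omega>) l) (\<beta> n \<omega>)
         - asym_risk \<gamma> (D n \<omega>) (r\<^sup>2) (\<sigma>\<^sup>2) l\<bar>) \<longlonglongrightarrow> 0"
proof -
  interpret ridge_model M p X \<epsilon> \<sigma> \<eta> K \<beta> Q D V \<gamma> r
  proof (intro ridge_model.intro noisy_design.intro noisy_design_axioms.intro ridge_model_axioms.intro)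
    show "prob_space M" by (rule prob)
    show "n \<ge> 1 \<Longrightarrow> p n \<ge> 1" for n using dims by blast
  qed (fact eps_indep_X eps_entries eps_mean eps_var eta eps_moment gamma X_inv X_svd beta_norm beta_indep)+
  show ?thesis
    using risk_uniform[OF lambda] AE_space
  proof eventually_elim
    case (elim \<omega>)
    show ?case
    proof (rule Lim_transform_eventually[OF elim(1)], rule eventually_sequentiallyI[of 1])
      fix n :: nat assume n: "1 \<le> n"
      note x = measurable_mat_carrier[OF measurable_X[OF n] elim(2)]
      note b = measurable_vec_carrier[OF measurable_beta[OF n] elim(2)]
      note e = measurable_vec_carrier[OF measurable_eps[OF n] elim(2)]
      show "(SUP l\<in>{l\<^sub>1..l\<^sub>2}. \<bar>ridge_sq_error (X n \<omega>) (\<beta> n \<omega>) (\<epsilon> n \<omega>) l / real n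
          - asym_risk \<gamma> (D n \<omega>) (r\<^sup>2) (\<sigma>\<^sup>2) l\<bar>)
        = (SUP l\<in>{l\<^sub>1..l\<^sub>2}. \<bar>risk M (n' n) (X' n) (ridge (X n \<omega>) (y n \<omega>) l) (\<beta> n \<omega>)
          - asym_risk \<gamma> (D n \<omega>) (r\<^sup>2) (\<sigma>\<^sup>2) l\<bar>)"
      proof (intro SUP_cong refl)
        fix l assume "l \<in> {l\<^sub>1..l\<^sub>2}"
        then have l: "0 < l" using lambda by auto
        have "risk M (n' n) (X' n) (ridge (X n \<omega>) (X n \<omega> *\<^sub>v \<beta> n \<omega> + \<epsilon> n \<omega>) l) (\<beta> n \<omega>)
          = ridge_sq_error (X n \<omega>) (\<beta> n \<omega>) (\<epsilon> n \<omega>) l / real n"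
          unfolding ridge_sq_error_def
          by (rule test_risk_eq[OF prob X'_inv[OF n] X'_svd[OF n] X'_trace[OF n] ridge_carrier[OF x b e l] b])
        then show "\<bar>ridge_sq_error (X n \<omega>) (\<beta> n \<omega>) (\<epsilon> n \<omega>) l / real n
            - asym_risk \<gamma> (D n \<omega>) (r\<^sup>2) (\<sigma>\<^sup>2) l\<bar>
          = \<bar>risk M (n' n) (X' n) (ridge (X n \<omega>) (y n \<omega>) l) (\<beta> n \<omega>) - asym_risk \<gamma> (D n \<omega>) (r\<^sup>2) (\<sigma>\<^sup>2) l\<bar>"
          unfolding model[OF n elim(2)] by (simp only:)
      qed
    qed
  qed
qed


end
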